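(* Let $(\eta_k)_{k\in\mathbb N}$ be i.i.d. real random variables with $\mathbb{E}\eta_1=0$ and $\sigma_1^2:=\mathbb{E}\eta_1^2\in(0,\infty)$, and let $\alpha>-1/2$. Then $$\limsup_{s\to0+}\Big(\frac{s^{1+2\alpha}}{\log\log(1/s)}\Big)^{1/2}\sum_{k\ge2}\frac{(\log k)^\alpha}{k^{1/2+s}}\eta_k=\Big(\frac{\sigma_1^2\Gamma(1+2\alpha)}{2^{2\alpha}}\Big)^{1/2}\quad\text{a.s.},$$ $$\liminf_{s\to0+}\Big(\frac{s^{1+2\alpha}}{\log\log(1/s)}\Big)^{1/2}\sum_{k\ge2}\frac{(\log k)^\alpha}{k^{1/2+s}}\eta_k=-\Big(\frac{\sigma_1^2\Gamma(1+2\alpha)}{2^{2\alpha}}\Big)^{1/2}\quad\text{a.s.},$$ and, almost surely, the set of limit points as $s\to0+$ of $$\Big(\frac{2^{2\alpha}}{\sigma_1^2\Gamma(1+2\alpha)}\frac{s^{1+2\alpha}}{\log\log(1/s)}\Big)^{1/2}\sum_{k\ge2}\frac{(\log k)^\alpha}{k^{1/2+s}}\eta_k,\qquad s\in(0,1/e),$$ is exactly $[-1,1]$.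
   Context: For each $s>0$ the series $\sum_{k\ge2}(\log k)^\alpha k^{-1/2-s}\eta_k$ converges a.s. *)

theory Defs
  imports "HOL-Analysis.Analysis" "HOL-Probability.Probability"
begin

definition rand_series :: "real \<Rightarrow> (nat \<Rightarrow> 'a \<Rightarrow> real) \<Rightarrow> real \<Rightarrow> 'a \<Rightarrow> real" where
  "rand_series \<alpha> \<eta> s \<omega> =
     (\<Sum>n. ln (real (n + 2)) powr \<alpha> / real (n + 2) powr (1/2 + s) * \<eta> (n + 2) \<omega>)"

definition limit_points_at_right0 :: "(real \<Rightarrow> real) \<Rightarrow> real set" where
  "limit_points_at_right0 f =
     {L. \<forall>e>0. frequently (\<lambda>s. dist (f s) L < e) (at_right 0)}"

end

theory Submission
  imports Defs "HOL-Real_Asymp.Real_Asymp"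
begin

text \<open>
  Since \<open>\<eta>\<close> has a finite second moment, almost surely \<open>\<bar>\<eta> k\<bar> \<le> sqrt k\<close> for all large \<open>k\<close>, so \<open>\<eta> k\<close>
  may be truncated at \<open>sqrt k\<close>. With the weights of the series the truncated summands are then
  smaller than the standard deviation by a power of \<open>s\<close>, so the logarithmic moment generating
  functions are Gaussian up to a factor tending to one, uniformly in the tilts of order
  \<open>sqrt (ln (ln (1 / s)))\<close> that matter; the variance is asymptotic to
  \<open>\<sigma>2 * Gamma (1 + 2 * \<alpha>) / (2 * s) powr (1 + 2 * \<alpha>)\<close>.

  Upper bound: Chernoff bound and Borel-Cantelli along \<open>q ^ n\<close>. Between grid points the series moves
  by at most the integral of its derivative, which is minus the series with \<open>\<alpha> + 1\<close>; Jensen's inequality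
  and Fubini transfer the Gaussian bound to that integral, and its contribution vanishes as \<open>q \<rightarrow> 1\<close>.

  Lower bound: for small \<open>q\<close> the series at \<open>q ^ n\<close> is dominated by the terms with \<open>ln k\<close> of order
  \<open>q ^ -n\<close>. These blocks are disjoint, hence independent, and exponential tilting gives a lower bound
  for their tails to which the second Borel-Cantelli lemma applies.

  The set of limit points then follows from continuity in \<open>s\<close> and the intermediate value theorem.
\<close>

section \<open>Asymptotics of the variance\<close>

text \<open>The sharp constant comes from two facts. Along \<open>q ^ n\<close> the quantity
  \<open>exp (- \<theta> * ln (ln (1 / q ^ n)))\<close> is a constant times n^(-\<theta>), so both
  Borel-Cantelli arguments switch at \<theta> = 1; and the Gaussian exponent x^2 / (2 V) equals
  \<open>ln (ln (1 / s))\<close> when x^2 is twice the variance V times the iterated logarithm. Two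
  obstacles shape the proof. Exponential moments are estimated for finite sums, while the
  conclusions concern infinite series: Fatou's lemma for the liminf over partial sums bridges this,
  which is why almost sure bounds are first stated for infinitely many \<open>N\<close>. Truncation
  destroys centring: a tilted weight b costs at most (|b| * sqrt k) * (|mean| / sqrt k), and the sum
  over k of |mean| / sqrt k is bounded by twice the second moment. Convergence for all s > 0 outside
  one null set, and continuity in s, both follow by Abel summation from a growth bound on the
  partial sums at s = 0.\<close>

lemma incomplete_Gamma_exists:
  fixes \<beta> :: real
  assumes "\<beta> > -1"
  obtains H :: "real \<Rightarrow> real" where
    "\<And>y. y > 0 \<Longrightarrow> (H has_real_derivative y powr \<beta> * exp (-y)) (at y)"
    "(H \<longlongrightarrow> 0) (at_right 0)" "(H \<longlongrightarrow> Gamma (1 + \<beta>)) at_top"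
proof
  define g where "g = (\<lambda>t::real. t powr \<beta> / exp t)"
  define H where "H = (\<lambda>y. integral {0..y} g)"
  have hi: "(g has_integral Gamma (1 + \<beta>)) {0..}"
    using Gamma_integral_real[of "1 + \<beta>"] assms by (simp add: g_def)
  have int: "g integrable_on {a..b}" if "a \<ge> 0" for a b
    using integrable_on_subinterval[of g "{0..}" a b] hi that by (auto simp: integrable_on_def)
  show "(H has_real_derivative y powr \<beta> * exp (-y)) (at y)" if y: "y > 0" for y
  proof -
    \<comment> \<open>For negative \<beta> the integrand blows up at 0, so the derivative is taken
      on an interval away from 0 and the constant \<open>H (y/2)\<close> is added back.\<close>
    have cont: "continuous_on {y/2..2*y} g"
      unfolding g_def using y by (auto intro!: continuous_intros)
    have "((\<lambda>z. integral {y/2..z} g) has_real_derivative g y) (at y within {y/2..2*y})"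
      by (rule integral_has_real_derivative[OF cont]) (use y in auto)
    also have "at y within {y/2..2*y} = at y"
      by (rule at_within_interior) (use y in auto)
    finally have "((\<lambda>z. H (y/2) + integral {y/2..z} g) has_real_derivative g y) (at y)"
      by (auto intro!: derivative_eq_intros)
    then have "(H has_real_derivative g y) (at y)"
    proof (rule has_field_derivative_transform_within_open[where S = "{y/2<..}"])
      fix z assume "z \<in> {y/2<..}"
      then show "H (y/2) + integral {y/2..z} g = H z"
        unfolding H_def using y by (intro Henstock_Kurzweil_Integration.integral_combine int) auto
    qed (use y in auto)
    then show ?thesis by (simp add: g_def exp_minus field_simps)
  qed
  have "continuous_on {0..1} H"
    unfolding H_def by (rule indefinite_integral_continuous_1) (use int in auto)
  then have "(H \<longlongrightarrow> H 0) (at 0 within {0..1})"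
    by (auto simp: continuous_on_def)
  moreover have "at (0::real) within {0..1} = at_right 0"
    by (rule at_within_Icc_at_right) auto
  ultimately show "(H \<longlongrightarrow> 0) (at_right 0)" by (simp add: H_def)
  have "g absolutely_integrable_on {0..}"
    by (rule nonnegative_absolutely_integrable_1) (use hi in \<open>auto simp: g_def integrable_on_def\<close>)
  then have "set_integrable lborel {0..} g"
    unfolding set_integrable_def by (subst (asm) integrable_completion) (simp_all add: g_def)
  then have intl: "integrable lborel (\<lambda>x. indicator {0..} x *\<^sub>R g x)"
    by (simp add: set_integrable_def)
  have eq: "(LINT x|lborel. indicat_real {..y} x *\<^sub>R (indicator {0..} x *\<^sub>R g x)) = H y" for y
  proof -
    have "set_integrable lborel {0..y} g"
      by (rule set_integrable_subset[OF \<open>set_integrable lborel {0..} g\<close>]) auto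
    then have "(LINT x:{0..y}|lborel. g x) = H y"
      unfolding H_def by (rule set_borel_integral_eq_integral)
    then show ?thesis
      unfolding set_lebesgue_integral_def
      by (simp add: mult.assoc[symmetric] indicator_inter_arith[symmetric] flip: atLeastAtMost_def)
         (simp add: Int_commute atLeastAtMost_def)
  qed
  have "(LINT x|lborel. indicator {0..} x *\<^sub>R g x) = Gamma (1 + \<beta>)"
    using set_borel_integral_eq_integral(2)[OF \<open>set_integrable lborel {0..} g\<close>] hi
    by (simp add: set_lebesgue_integral_def integral_unique)
  with tendsto_integral_at_top[OF _ intl] eq show "(H \<longlongrightarrow> Gamma (1 + \<beta>)) at_top"
    by simp
qed

text \<open>Integral test. The substitution y = u * ln x in the incomplete Gamma function gives the
  antiderivative \<open>F u\<close> of the summand, so the series differs from an explicit Gamma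
  expression by an error bounded uniformly in u. Multiplying by \<open>u powr (1 + \<beta>)\<close>,
  which tends to 0 because \<beta> > -1, removes this error.\<close>

lemma log_power_zeta:
  fixes \<beta> :: real
  defines "f \<equiv> \<lambda>(u::real) (x::real). ln x powr \<beta> / x powr (1 + u)"
  assumes b: "\<beta> > -1"
  shows log_power_zeta_summable: "u > 0 \<Longrightarrow> summable (\<lambda>k. f u (real k))"
    and log_power_zeta_asymp:
      "((\<lambda>u. u powr (1 + \<beta>) * (\<Sum>k. f u (real k))) \<longlongrightarrow> Gamma (1 + \<beta>)) (at_right 0)"
proof -
  obtain H :: "real \<Rightarrow> real" where
    H: "\<And>y. y > 0 \<Longrightarrow> (H has_real_derivative y powr \<beta> * exp (-y)) (at y)"
    "(H \<longlongrightarrow> 0) (at_right 0)" "(H \<longlongrightarrow> Gamma (1 + \<beta>)) at_top"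
    using incomplete_Gamma_exists[OF b] by blast
  \<comment> \<open>From \<open>K\<close> on, ln x is at least \<beta> and at least 1; then every
    \<open>f u\<close> with u > 0 decreases, its logarithmic derivative being (\<beta> / ln x - (1 +
    u)) / x.\<close>
  define K where "K = nat \<lceil>exp (max \<beta> 1)\<rceil>"
  have Kge: "real K \<ge> exp (max \<beta> 1)" unfolding K_def by linarith
  have K1: "x > 1" "ln x \<ge> max \<beta> 1" if "x \<ge> real K" for x :: real
  proof -
    have "exp (max \<beta> 1) \<ge> 1 + max \<beta> 1" by (rule exp_ge_add_one_self)
    then show x: "x > 1" using that Kge by linarith
    show "ln x \<ge> max \<beta> 1" using Kge that x ln_ge_iff[of x "max \<beta> 1"] by linarith
  qed
  have anti: "f u y \<le> f u x" if u: "u > 0" and xy: "real K \<le> x" "x \<le> y" for u x y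
  proof -
    define h where "h = (\<lambda>x::real. \<beta> * ln (ln x) - (1 + u) * ln x)"
    have "h y \<le> h x"
    proof (rule DERIV_nonpos_imp_nonincreasing[OF xy(2)])
      fix t assume t: "x \<le> t" "t \<le> y"
      then have t1: "t > 1" "ln t \<ge> max \<beta> 1" using K1[of t] xy by auto
      then have lt: "ln t > 0" by auto
      have "(h has_real_derivative \<beta> * (1 / ln t * (1 / t)) - (1 + u) * (1 / t)) (at t)"
        unfolding h_def using t1 lt by (auto intro!: derivative_eq_intros)
      moreover have "\<beta> * (1 / ln t * (1 / t)) - (1 + u) * (1 / t) = (\<beta> / ln t - (1 + u)) / t"
        using t1 by (simp add: field_simps)
      moreover have "\<beta> / ln t \<le> 1" using t1 lt by (simp add: field_simps)
      then have "\<beta> / ln t \<le> 1 + u" using u by linarith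
      ultimately show "\<exists>d. (h has_real_derivative d) (at t) \<and> d \<le> 0"
        using t1 u by (intro exI[of _ "(\<beta> / ln t - (1 + u)) / t"]) (auto simp: divide_le_0_iff simp del: divide_le_eq divide_le_eq_1)
    qed
    moreover have "f u t = exp (h t)" if "t \<ge> real K" for t
    proof -
      have "t > 1" "ln t > 0" using K1[OF that] by auto
      then show ?thesis by (simp add: f_def h_def powr_def exp_diff)
    qed
    ultimately show ?thesis using xy by simp
  qed
  define F where "F = (\<lambda>u x::real. u powr (-1 - \<beta>) * H (u * ln x))"
  have dF: "(F u has_real_derivative f u x) (at x)" if u: "u > 0" and x: "x > 1" for u x
  proof -
    have pos: "u * ln x > 0" using u x by simp
    have "(F u has_real_derivative u powr (-1 - \<beta>) * (((u * ln x) powr \<beta> * exp (-(u * ln x))) * (u * (1 / x)))) (at x)"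
    proof -
      have "((\<lambda>x. u * ln x) has_real_derivative u * (1 / x)) (at x)"
        using x by (auto intro!: derivative_eq_intros)
      from DERIV_chain2[where f = H, OF H(1)[OF pos] this]
      show ?thesis unfolding F_def by (rule DERIV_cmult)
    qed
    moreover have "u powr (-1 - \<beta>) * (((u * ln x) powr \<beta> * exp (-(u * ln x))) * (u * (1 / x))) = f u x"
    proof -
      have "u powr (-1 - \<beta>) * u powr \<beta> * u = 1"
        using u by (simp add: powr_diff powr_minus field_simps)
      moreover have "(u * ln x) powr \<beta> = u powr \<beta> * ln x powr \<beta>"
        using u x by (simp add: powr_mult)
      moreover have "exp (-(u * ln x)) / x = 1 / x powr (1 + u)"
        using x by (simp add: powr_add exp_minus field_simps) (simp add: powr_def)
      moreover have "u powr (-1 - \<beta>) * (((u * ln x) powr \<beta> * exp (-(u * ln x))) * (u * (1 / x)))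
          = (u * ln x) powr \<beta> / u powr \<beta> * (u powr (-1 - \<beta>) * u powr \<beta> * u) * (exp (-(u * ln x)) / x)"
        using u by (simp add: field_simps)
      ultimately show ?thesis using u by (simp add: f_def)
    qed
    ultimately show ?thesis by simp
  qed
  have mvt: "f u (real (k + 1)) \<le> F u (real (k + 1)) - F u (real k) \<and> F u (real (k + 1)) - F u (real k) \<le> f u (real k)"
    if u: "u > 0" and k: "k \<ge> K" for u k
  proof -
    have "\<exists>z>real k. z < real (k + 1) \<and> F u (real (k + 1)) - F u (real k) = (real (k + 1) - real k) * f u z"
      by (rule MVT2) (use K1(1) k in \<open>auto intro!: dF u\<close>)
    then obtain z where "z > real k" "z < real (k + 1)" "F u (real (k + 1)) - F u (real k) = f u z" by auto
    with anti[OF u, of z "real (k + 1)"] anti[OF u, of "real k" z] k show ?thesis by auto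
  qed
  define d where "d = (\<lambda>u k. F u (real (k + 1 + K)) - F u (real (k + K)))"
  have dsums: "d u sums (u powr (-1 - \<beta>) * Gamma (1 + \<beta>) - F u (real K))" if u: "u > 0" for u
  proof -
    have "filterlim (\<lambda>n. u * ln (real (n + K))) at_top sequentially" using u by real_asymp
    then have "(\<lambda>n. F u (real (n + K))) \<longlonglongrightarrow> u powr (-1 - \<beta>) * Gamma (1 + \<beta>)"
      unfolding F_def by (intro tendsto_intros filterlim_compose[OF H(3)])
    from telescope_sums[OF this] show ?thesis by (simp add: d_def)
  qed
  have fnn: "f u x \<ge> 0" for u x by (simp add: f_def)
  have md: "f u (real (k + 1 + K)) \<le> d u k" "d u k \<le> f u (real (k + K))" if "u > 0" for u k
    using mvt[OF that, of "k + K"] by (simp_all add: d_def add_ac)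
  have sm1: "summable (\<lambda>k. f u (real (k + 1 + K)))" if u: "u > 0" for u
    by (rule summable_comparison_test'[OF sums_summable[OF dsums[OF u]]]) (use md fnn u in auto)
  show sm: "summable (\<lambda>k. f u (real k))" if u: "u > 0" for u
    using sm1[OF u] summable_iff_shift[of "\<lambda>k. f u (real k)" "1 + K"] by (simp add: add_ac)
  \<comment> \<open>Bounds, uniformly in u, what the integral comparison skips: the terms below
    \<open>K\<close> and one further term at \<open>K\<close>, each replaced by its value at u =
    0.\<close>
  define C where "C = (\<Sum>k<K. ln (real k) powr \<beta> / real k) + ln (real K) powr \<beta> / real K"
  have fle: "f u (real k) \<le> ln (real k) powr \<beta> / real k" if "u > 0" for u k
  proof (cases "k = 0")
    case False
    then have "real k powr 1 \<le> real k powr (1 + u)" using that by (intro powr_mono) auto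
    then show ?thesis using False unfolding f_def by (intro divide_left_mono) auto
  qed (simp add: f_def)
  have bd: "Gamma (1 + \<beta>) - H (u * ln (real K)) \<le> u powr (1 + \<beta>) * (\<Sum>k. f u (real k))"
    "u powr (1 + \<beta>) * (\<Sum>k. f u (real k)) \<le> Gamma (1 + \<beta>) - H (u * ln (real K)) + u powr (1 + \<beta>) * C"
    if u: "u > 0" for u
  proof -
    define S where "S = (\<Sum>k. f u (real k))"
    define S' where "S' = (\<Sum>k. f u (real (k + K)))"
    have shK: "summable (\<lambda>k. f u (real (k + K)))"
      using sm[OF u] summable_iff_shift[of "\<lambda>k. f u (real k)" K] by simp
    have S: "S = (\<Sum>k<K. f u (real k)) + S'"
      using suminf_split_initial_segment[OF sm[OF u], of K] by (simp add: S_def S'_def)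
    have S'1: "S' = f u (real K) + (\<Sum>k. f u (real (k + 1 + K)))"
      using suminf_split_head[OF shK] by (simp add: S'_def)
    have D: "suminf (d u) = u powr (-1 - \<beta>) * Gamma (1 + \<beta>) - F u (real K)"
      using dsums[OF u] sums_unique by metis
    have d1: "suminf (d u) \<le> S'" unfolding S'_def
      by (rule suminf_le[OF md(2)[OF u] sums_summable[OF dsums[OF u]] shK])
    have d2: "(\<Sum>k. f u (real (k + 1 + K))) \<le> suminf (d u)"
      by (rule suminf_le[OF md(1)[OF u] sm1[OF u] sums_summable[OF dsums[OF u]]])
    have "(\<Sum>k<K. f u (real k)) + f u (real K) \<le> C"
      unfolding C_def by (intro add_mono sum_mono fle u)
    then have 1: "suminf (d u) \<le> S" "S \<le> suminf (d u) + C"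
      using d1 d2 S S'1 sum_nonneg[of "{..<K}" "\<lambda>k. f u (real k)"] fnn by auto
    have p1: "u powr (1 + \<beta>) * u powr (-1 - \<beta>) = 1"
      using u by (simp add: powr_add[symmetric])
    have "u powr (1 + \<beta>) * suminf (d u) = (u powr (1 + \<beta>) * u powr (-1 - \<beta>)) * (Gamma (1 + \<beta>) - H (u * ln (real K)))"
      unfolding D F_def by (simp add: algebra_simps)
    then have 2: "u powr (1 + \<beta>) * suminf (d u) = Gamma (1 + \<beta>) - H (u * ln (real K))"
      by (simp add: p1)
    have "u powr (1 + \<beta>) * suminf (d u) \<le> u powr (1 + \<beta>) * S"
      "u powr (1 + \<beta>) * S \<le> u powr (1 + \<beta>) * (suminf (d u) + C)"
      using 1 by (auto intro!: mult_left_mono)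
    then show "Gamma (1 + \<beta>) - H (u * ln (real K)) \<le> u powr (1 + \<beta>) * (\<Sum>k. f u (real k))"
      "u powr (1 + \<beta>) * (\<Sum>k. f u (real k)) \<le> Gamma (1 + \<beta>) - H (u * ln (real K)) + u powr (1 + \<beta>) * C"
      using 2 by (simp_all add: S_def distrib_left)
  qed
  have "filterlim (\<lambda>u. u * ln (real K)) (at_right 0) (at_right 0)"
  proof -
    have "ln (real K) > 0" using K1[of "real K"] by simp
    then show ?thesis by real_asymp
  qed
  then have Hl: "((\<lambda>u. H (u * ln (real K))) \<longlongrightarrow> 0) (at_right 0)"
    by (rule filterlim_compose[OF H(2)])
  have ul: "((\<lambda>u::real. u powr (1 + \<beta>)) \<longlongrightarrow> 0) (at_right 0)"
    using b by real_asymp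
  have ev: "\<forall>\<^sub>F u::real in at_right 0. u > 0" by (rule eventually_at_right_less)
  show "((\<lambda>u. u powr (1 + \<beta>) * (\<Sum>k. f u (real k))) \<longlongrightarrow> Gamma (1 + \<beta>)) (at_right 0)"
  proof (rule tendsto_sandwich)
    show "((\<lambda>u. Gamma (1 + \<beta>) - H (u * ln (real K))) \<longlongrightarrow> Gamma (1 + \<beta>)) (at_right 0)"
      using tendsto_diff[OF tendsto_const Hl, of "Gamma (1 + \<beta>)"] by simp
    show "((\<lambda>u. Gamma (1 + \<beta>) - H (u * ln (real K)) + u powr (1 + \<beta>) * C) \<longlongrightarrow> Gamma (1 + \<beta>)) (at_right 0)"
      using tendsto_add[OF tendsto_diff[OF tendsto_const Hl, of "Gamma (1 + \<beta>)"] tendsto_mult_left_zero[OF ul, of C]]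
      by simp
  qed (use bd ev in \<open>auto elim!: eventually_mono\<close>)
qed

section \<open>The weights of the series and their sum of squares\<close>

definition dweight :: "real \<Rightarrow> real \<Rightarrow> nat \<Rightarrow> real" where
  "dweight \<alpha> s k = ln (real k) powr \<alpha> / real k powr (1/2 + s)"

definition dvar :: "real \<Rightarrow> real \<Rightarrow> real" where
  "dvar \<alpha> s = (\<Sum>k. (dweight \<alpha> s k)\<^sup>2)"

definition lil_scale :: "real \<Rightarrow> real \<Rightarrow> real" where
  "lil_scale \<alpha> s = sqrt (ln (ln (1 / s)) / s powr (1 + 2 * \<alpha>))"

text \<open>At k = 1 the numerator is \<open>0 powr \<alpha>\<close>, which is 0 even for \<alpha> =
  0; at k = 0 the denominator is 0 and division by zero yields 0. Hence sums over all naturals are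
  sums over k >= 2.\<close>

lemma dweight_eq_0 [simp]: "k < 2 \<Longrightarrow> dweight \<alpha> s k = 0"
  by (auto simp: dweight_def less_2_cases_iff)

lemma dweight_nonneg [simp]: "dweight \<alpha> s k \<ge> 0"
  by (simp add: dweight_def)

lemma dweight_sq: "(dweight \<alpha> s k)\<^sup>2 = ln (real k) powr (2 * \<alpha>) / real k powr (1 + 2 * s)"
  by (simp add: dweight_def power_divide power2_eq_square powr_add[symmetric] algebra_simps)

lemma dweight_altdef: "dweight \<alpha> s k = ln (real k) powr \<alpha> * real k powr (-1/2 - s)"
  using powr_minus_divide[of "real k" "1/2 + s"] by (simp add: dweight_def)

lemma dweight_shift: "dweight \<alpha> (s + t) k = dweight \<alpha> s k * real k powr (-t)"
proof -
  have "real k powr (-1/2 - (s + t)) = real k powr (-1/2 - s) * real k powr (-t)"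
    unfolding powr_add[symmetric] by (rule arg_cong[where f = "(powr) (real k)"]) simp
  then show ?thesis by (simp add: dweight_altdef)
qed

lemma dweight_Suc: "dweight (\<alpha> + 1) s k = ln (real k) * dweight \<alpha> s k"
proof (cases "k < 2")
  case False
  then have "ln (real k) > 0" by simp
  then show ?thesis by (simp add: dweight_def powr_add)
qed (auto simp: dweight_def less_2_cases_iff)

lemma dweight_antimono: "s \<le> t \<Longrightarrow> dweight \<alpha> t k \<le> dweight \<alpha> s k"
  by (cases "k = 0") (auto simp: dweight_def intro!: divide_left_mono powr_mono)

lemma dweight_has_derivative:
  "((\<lambda>s. dweight \<alpha> s k) has_real_derivative - dweight (\<alpha> + 1) s k) (at s)"
proof (cases "k = 0")
  case False
  have "((\<lambda>s. ln (real k) powr \<alpha> * real k powr (-1/2 - s)) has_real_derivative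
      - ln (real k) * (ln (real k) powr \<alpha> * real k powr (-1/2 - s))) (at s)"
    using False by (auto intro!: derivative_eq_intros)
  then show ?thesis unfolding dweight_Suc unfolding dweight_altdef by simp
qed simp

lemma dvar_summable:
  assumes "\<alpha> > -1/2" "s > 0" shows "summable (\<lambda>k. (dweight \<alpha> s k)\<^sup>2)"
  unfolding dweight_sq using log_power_zeta_summable[of "2*\<alpha>" "2 * s"] assms by simp

lemma sum_dweight_sq_le:
  assumes "\<alpha> > -1/2" "s > 0" "finite F" shows "(\<Sum>k\<in>F. (dweight \<alpha> s k)\<^sup>2) \<le> dvar \<alpha> s"
  unfolding dvar_def by (rule sum_le_suminf[OF dvar_summable]) (use assms in auto)

lemma dvar_nonneg: "\<alpha> > -1/2 \<Longrightarrow> s > 0 \<Longrightarrow> dvar \<alpha> s \<ge> 0"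
  unfolding dvar_def by (rule suminf_nonneg[OF dvar_summable]) auto

lemma filterlim_mult_at_right_0:
  "(c::real) > 0 \<Longrightarrow> filterlim (\<lambda>s. c * s) (at_right 0) (at_right 0)"
  by real_asymp

text \<open>The scaling parameter \<open>h\<close> serves later shifts of the exponent: it is 1 for
  the series itself, the ratio \<open>q\<close> for a grid cell, and 1/2 and 1/d for the terms
  outside a block.\<close>

lemma dvar_asymp:
  fixes \<alpha> h :: real
  assumes a: "\<alpha> > -1/2" and h: "h > 0"
  shows "((\<lambda>s. s powr (1 + 2 * \<alpha>) * dvar \<alpha> (h * s)) \<longlongrightarrow> h powr -(1 + 2 * \<alpha>) * (Gamma (1 + 2 * \<alpha>) / 2 powr (1 + 2 * \<alpha>))) (at_right 0)"
proof -
  have "((\<lambda>u. u powr (1 + 2*\<alpha>) * (\<Sum>k. ln (real k) powr (2*\<alpha>) / real k powr (1 + u))) \<longlongrightarrow> Gamma (1 + 2*\<alpha>)) (at_right 0)"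
    using log_power_zeta_asymp[of "2*\<alpha>"] a by simp
  from filterlim_compose[OF this filterlim_mult_at_right_0[of "2 * h"]] h
  have "((\<lambda>s. (2 * h * s) powr (1 + 2*\<alpha>) * dvar \<alpha> (h * s)) \<longlongrightarrow> Gamma (1 + 2*\<alpha>)) (at_right 0)"
    by (simp add: dvar_def dweight_sq mult.assoc)
  from tendsto_mult[OF tendsto_const this, of "(2 * h) powr -(1 + 2*\<alpha>)"]
  have *: "((\<lambda>s. (2 * h) powr -(1 + 2*\<alpha>) * ((2 * h * s) powr (1 + 2*\<alpha>) * dvar \<alpha> (h * s))) \<longlongrightarrow>
    (2 * h) powr -(1 + 2*\<alpha>) * Gamma (1 + 2*\<alpha>)) (at_right 0)" .
  have "((\<lambda>s. s powr (1 + 2 * \<alpha>) * dvar \<alpha> (h * s)) \<longlongrightarrow>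
    (2 * h) powr -(1 + 2*\<alpha>) * Gamma (1 + 2*\<alpha>)) (at_right 0)"
  proof (rule Lim_transform_eventually[OF *])
    show "\<forall>\<^sub>F s in at_right 0. (2 * h) powr -(1 + 2*\<alpha>) * ((2 * h * s) powr (1 + 2*\<alpha>) * dvar \<alpha> (h * s)) =
      s powr (1 + 2 * \<alpha>) * dvar \<alpha> (h * s)"
      using eventually_at_right_less[of 0]
    proof eventually_elim
      case (elim s)
      have "(2 * h) powr -(1 + 2*\<alpha>) * (2 * h * s) powr (1 + 2*\<alpha>) = s powr (1 + 2*\<alpha>)"
      proof -
        have "(2 * h * s) powr (1 + 2*\<alpha>) = (2 * h) powr (1 + 2*\<alpha>) * s powr (1 + 2*\<alpha>)"
          using h elim by (simp add: powr_mult)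
        moreover have "(2 * h) powr -(1 + 2*\<alpha>) * (2 * h) powr (1 + 2*\<alpha>) = 1"
          unfolding powr_add[symmetric] using h by simp
        ultimately show ?thesis by (simp only: mult.assoc[symmetric] mult_1_left)
      qed
      then show ?case by (metis mult.assoc)
    qed
  qed
  moreover have "(2 * h) powr -(1 + 2*\<alpha>) = h powr -(1 + 2 * \<alpha>) / 2 powr (1 + 2 * \<alpha>)"
    using h by (simp only: powr_mult powr_minus divide_inverse inverse_mult_distrib mult.commute)
  ultimately show ?thesis by simp
qed

text \<open>A variable truncated at sqrt k contributes a summand of at most this size, uniformly in
  k. The product is (ln k)^\<alpha> * k^(-s): for \<alpha> <= 0 it is bounded through its value at k
  = 2, and for \<alpha> > 0 through z <= exp z with z = s * ln k / \<alpha>.\<close>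

lemma dweight_bound:
  obtains C :: real where "C > 0"
    "\<And>s k. 0 < s \<Longrightarrow> dweight \<alpha> s k * sqrt (real k) \<le> C * s powr (- max \<alpha> 0)"
proof (cases "\<alpha> \<le> 0")
  case True
  show ?thesis
  proof (rule that[of "ln 2 powr \<alpha>"])
    fix s :: real and k :: nat assume s: "0 < s"
    show "dweight \<alpha> s k * sqrt (real k) \<le> ln 2 powr \<alpha> * s powr (- max \<alpha> 0)"
    proof (cases "k < 2")
      case False
      then have k: "real k \<ge> 2" by simp
      have "dweight \<alpha> s k * sqrt (real k) = ln (real k) powr \<alpha> * real k powr (-s)"
        proof -
        have "real k powr (-1/2 - s) * sqrt (real k) = real k powr (-s)"
          using k by (simp add: powr_half_sqrt[symmetric] powr_add[symmetric])
        then show ?thesis by (simp add: dweight_altdef)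
      qed
      also have "\<dots> \<le> ln 2 powr \<alpha> * 1"
      proof (rule mult_mono)
        show "ln (real k) powr \<alpha> \<le> ln 2 powr \<alpha>"
          using True k by (intro powr_mono2') auto
        show "real k powr (-s) \<le> 1" using s k by (simp add: powr_le1 powr_minus ge_one_powr_ge_zero field_simps)
      qed auto
      finally show ?thesis using True s by simp
    qed simp
  qed simp
next
  case False
  then have a: "\<alpha> > 0" by simp
  show ?thesis
  proof (rule that[of "\<alpha> powr \<alpha>"])
    fix s :: real and k :: nat assume s: "0 < s"
    show "dweight \<alpha> s k * sqrt (real k) \<le> \<alpha> powr \<alpha> * s powr (- max \<alpha> 0)"
    proof (cases "k < 2")
      case False
      then have k: "real k \<ge> 2" by simp
      define y where "y = ln (real k)"
      have y: "y > 0" using k by (simp add: y_def)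
      have "dweight \<alpha> s k * sqrt (real k) = y powr \<alpha> * exp (-s * y)"
      proof -
        have "real k powr (-1/2 - s) * sqrt (real k) = real k powr (-s)"
          using k by (simp add: powr_half_sqrt[symmetric] powr_add[symmetric])
        then show ?thesis using k by (simp add: dweight_altdef y_def powr_def)
      qed
      also have "\<dots> \<le> \<alpha> powr \<alpha> * s powr (-\<alpha>)"
      proof -
        have "s * y / \<alpha> \<le> exp (s * y / \<alpha>)" using exp_ge_add_one_self[of "s*y/\<alpha>"] by linarith
        then have "y \<le> (\<alpha> / s) * exp (s * y / \<alpha>)" using s a by (simp add: field_simps)
        then have "y powr \<alpha> \<le> ((\<alpha> / s) * exp (s * y / \<alpha>)) powr \<alpha>" using y a by (intro powr_mono2) auto
        also have "\<dots> = (\<alpha> / s) powr \<alpha> * exp (s * y)"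
          using a s by (simp add: powr_mult exp_powr_real powr_divide)
        finally have "y powr \<alpha> * exp (-s*y) \<le> (\<alpha> / s) powr \<alpha> * exp (s * y) * exp (-s*y)"
          by (intro mult_right_mono) auto
        also have "\<dots> = (\<alpha> / s) powr \<alpha>" by (simp add: mult.assoc exp_add[symmetric])
        finally show ?thesis using a s by (simp add: powr_divide powr_minus field_simps)
      qed
      finally show ?thesis using a by simp
    qed (use a in simp)
  qed (use a in simp)
qed

text \<open>Half of the exponent is given away: the squared weight at s is the one at s/2 times
  k^(-s), and s * ln k >= A.\<close>

lemma dweight_tail_le:
  assumes s: "s > 0" and k: "ln (real k) \<ge> A / s"
  shows "(dweight \<alpha> s k)\<^sup>2 \<le> exp (-A) * (dweight \<alpha> (s/2) k)\<^sup>2"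
proof (cases "k = 0")
  case False
  have "(dweight \<alpha> s k)\<^sup>2 = (dweight \<alpha> (s/2) k)\<^sup>2 * exp (- (s * ln (real k)))"
    using dweight_shift[of \<alpha> "s/2" "s/2" k] False
    by (simp add: power_mult_distrib power2_eq_square powr_def exp_add[symmetric])
  moreover have "exp (- (s * ln (real k))) \<le> exp (-A)" using s k by (simp add: field_simps)
  ultimately show ?thesis by (metis mult.commute mult_left_mono zero_le_power2)
qed simp

text \<open>As long as s * ln k <= \<delta>, replacing the exponent s by s/\<delta> costs the
  squared weight at most the factor \<open>exp 2\<close>. The gain is that
  \<open>dvar \<alpha> (s/\<delta>)\<close> is asymptotically \<delta>^(1 + 2\<alpha>) times
  \<open>dvar \<alpha> s\<close>.\<close>

lemma dweight_head_le:
  assumes s: "s > 0" and k: "ln (real k) \<le> \<delta> / s" and d: "\<delta> > 0"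
  shows "(dweight \<alpha> s k)\<^sup>2 \<le> exp 2 * (dweight \<alpha> (s/\<delta>) k)\<^sup>2"
proof (cases "k = 0")
  case False
  have "dweight \<alpha> (s/\<delta>) k = dweight \<alpha> s k * real k powr (- (s/\<delta> - s))"
    using dweight_shift[of \<alpha> s "s/\<delta> - s" k] by simp
  then have "(dweight \<alpha> (s/\<delta>) k)\<^sup>2 = (dweight \<alpha> s k)\<^sup>2 * exp (- 2 * (s/\<delta> - s) * ln (real k))"
    using False by (simp add: power_mult_distrib power2_eq_square powr_def exp_add[symmetric] algebra_simps)
  moreover have "exp (-2) \<le> exp (- 2 * (s/\<delta> - s) * ln (real k))"
  proof -
    have l: "ln (real k) \<ge> 0" using False by simp
    have "s/\<delta> * ln (real k) \<le> 1" using k s d by (simp add: field_simps)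
    moreover have "s * ln (real k) \<ge> 0" using l s by simp
    moreover have "- 2 * (s/\<delta> - s) * ln (real k) = - 2 * (s/\<delta> * ln (real k)) + 2 * (s * ln (real k))"
      by (simp add: algebra_simps)
    ultimately have "- 2 \<le> - 2 * (s/\<delta> - s) * ln (real k)" by linarith
    then show ?thesis by simp
  qed
  ultimately have "(dweight \<alpha> s k)\<^sup>2 * exp (-2) \<le> (dweight \<alpha> (s/\<delta>) k)\<^sup>2"
    by (metis mult_left_mono zero_le_power2)
  then show ?thesis by (simp add: exp_minus field_simps)
qed simp

section \<open>Dirichlet series with slowly growing partial sums\<close>

lemma dirichlet_series_continuous:
  fixes x :: "nat \<Rightarrow> real"
  assumes x0: "x 0 = 0" and e: "e \<ge> 0"
    and bd: "\<And>n. \<bar>\<Sum>k<n. x k\<bar> \<le> C * real n powr e"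
  shows "s > e \<Longrightarrow> summable (\<lambda>k. x k * real k powr (-s))"
    and "continuous_on {e<..} (\<lambda>s. \<Sum>k. x k * real k powr (-s))"
proof -
  define T where "T n = (\<Sum>k<n. x k)" for n
  define a where "a s k = real k powr (-s)" for s :: real and k :: nat
  have C: "C \<ge> 0" using order_trans[OF abs_ge_zero bd[of 1]] by simp
  \<comment> \<open>Abel summation: the boundary term tends to 0 and the remaining sum converges by
    the Weierstrass test, both uniformly on compact intervals of s.\<close>
  have parts: "(\<Sum>k<N. x k * a s k) = a s N * T N + (\<Sum>k<N. T (Suc k) * (a s k - a s (Suc k)))" for s N
    by (induction N) (simp_all add: T_def algebra_simps)
  have main: "\<exists>g. uniform_limit {s0..s1} (\<lambda>N s. \<Sum>k<N. x k * a s k) g sequentially"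
    if s0: "s0 > e" and s01: "s0 \<le> s1" for s0 s1
  proof -
    \<comment> \<open>The mean value theorem bounds the difference of k^(-s) and (k+1)^(-s) by s1 *
      k^(-s0 - 1). The factor \<open>2 powr e\<close> comes from k + 1 <= 2 k in the bound on
      \<open>T (Suc k)\<close>.\<close>
    define M where "M k = C * 2 powr e * s1 * real k powr (e - s0 - 1)" for k :: nat
    have Mb: "norm (T (Suc k) * (a s k - a s (Suc k))) \<le> M k" if s: "s \<in> {s0..s1}" for s k
    proof (cases "k = 0")
      \<comment> \<open>At k = 0 the majorant is 0 because \<open>0 powr _ = 0\<close>, and the left
        side vanishes since \<open>x 0 = 0\<close>.\<close>
      case True then show ?thesis using x0 by (simp add: T_def M_def)
    next
      case False
      then have k: "real k \<ge> 1" by simp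
      have "\<exists>z>real k. z < real (Suc k) \<and> real (Suc k) powr (-s) - real k powr (-s) =
          (real (Suc k) - real k) * (-s * z powr (-s - 1))"
        by (rule MVT2) (use k in \<open>auto intro!: derivative_eq_intros\<close>)
      then obtain z where z: "z > real k" "a s k - a s (Suc k) = s * z powr (-s - 1)"
        by (auto simp: a_def)
      have sp: "s > 0" using s s0 e by auto
      have "z powr (-s - 1) \<le> real k powr (-s - 1)" using z k sp by (intro powr_mono2') auto
      also have "\<dots> \<le> real k powr (-s0 - 1)" using s k by (intro powr_mono) auto
      finally have 1: "\<bar>a s k - a s (Suc k)\<bar> \<le> s1 * real k powr (-s0 - 1)"
        using z sp s by (auto simp: abs_mult intro!: mult_mono)
      have "\<bar>T (Suc k)\<bar> \<le> C * real (Suc k) powr e" unfolding T_def by (rule bd)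
      also have "\<dots> \<le> C * (2 * real k) powr e" using C e k by (intro mult_left_mono powr_mono2) auto
      finally have 2: "\<bar>T (Suc k)\<bar> \<le> C * (2 powr e * real k powr e)" using k by (simp add: powr_mult)
      have "\<bar>T (Suc k) * (a s k - a s (Suc k))\<bar> \<le> (C * (2 powr e * real k powr e)) * (s1 * real k powr (-s0 - 1))"
        unfolding abs_mult by (rule mult_mono[OF 2 1]) (use C in auto)
      also have "\<dots> = M k"
        unfolding M_def by (simp add: algebra_simps powr_add[symmetric])
      finally show ?thesis by simp
    qed
    have sM: "summable M"
      unfolding M_def by (intro summable_mult) (use s0 in \<open>simp add: summable_real_powr_iff\<close>)
    have u1: "uniform_limit {s0..s1} (\<lambda>N s. \<Sum>k<N. T (Suc k) * (a s k - a s (Suc k)))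
        (\<lambda>s. \<Sum>k. T (Suc k) * (a s k - a s (Suc k))) sequentially"
      by (rule Weierstrass_m_test[OF Mb sM])
    have u2: "uniform_limit {s0..s1} (\<lambda>N s. a s N * T N) (\<lambda>s. 0) sequentially"
    proof (rule uniform_limitI)
      fix d :: real assume d: "d > 0"
      have "(\<lambda>N. C * real N powr (e - s0)) \<longlonglongrightarrow> C * 0"
        using s0 by (intro tendsto_mult tendsto_const) (real_asymp)
      then have "\<forall>\<^sub>F N in sequentially. C * real N powr (e - s0) < d"
        using d by (intro order_tendstoD) auto
      then show "\<forall>\<^sub>F N in sequentially. \<forall>s\<in>{s0..s1}. dist (a s N * T N) 0 < d"
        using eventually_gt_at_top[of 0]
      proof eventually_elim
        case (elim N)
        show ?case
        proof
          fix s assume s: "s \<in> {s0..s1}"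
          have "\<bar>a s N * T N\<bar> \<le> real N powr (-s0) * (C * real N powr e)"
            unfolding abs_mult T_def using s elim
            by (intro mult_mono bd) (auto simp: a_def intro!: powr_mono)
          also have "\<dots> = C * real N powr (e - s0)" by (simp add: powr_add[symmetric] algebra_simps)
          finally show "dist (a s N * T N) 0 < d" using elim by simp
        qed
      qed
    qed
    from uniform_limit_add[OF u2 u1] show ?thesis unfolding parts by blast
  qed
  have pt: "(\<lambda>k. x k * a s k) sums g s" if "uniform_limit {s0..s1} (\<lambda>N s. \<Sum>k<N. x k * a s k) g sequentially"
    "s \<in> {s0..s1}" for s s0 s1 g
    using tendsto_uniform_limitI[OF that] by (simp add: sums_def)
  show "summable (\<lambda>k. x k * real k powr (-s))" if s: "s > e" for s
  proof -
    obtain g where "uniform_limit {s..s} (\<lambda>N s. \<Sum>k<N. x k * a s k) g sequentially" using main[of s s] s by blast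
    from pt[OF this, of s] show ?thesis by (auto simp: a_def sums_iff)
  qed
  have "isCont (\<lambda>s. \<Sum>k. x k * a s k) s" if s: "s > e" for s
  proof -
    define I where "I = {(s + e)/2..s+1}"
    obtain g where g: "uniform_limit I (\<lambda>N s. \<Sum>k<N. x k * a s k) g sequentially"
      using main[of "(s + e)/2" "s + 1"] s unfolding I_def by auto
    have "continuous_on I (\<lambda>s. a s k)" for k
      by (cases "k = 0") (auto simp: a_def intro!: continuous_intros)
    then have "continuous_on I g"
      by (intro uniform_limit_theorem[OF _ g] always_eventually allI continuous_intros) auto
    moreover have "g t = (\<Sum>k. x k * a t k)" if "t \<in> I" for t
      using pt[OF g[unfolded I_def], of t] that by (simp add: I_def sums_iff)
    ultimately have "continuous_on I (\<lambda>s. \<Sum>k. x k * a s k)" by (simp cong: continuous_on_cong)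
    moreover have "s \<in> interior I" using s by (auto simp: I_def)
    ultimately show ?thesis by (rule continuous_on_interior)
  qed
  then show "continuous_on {e<..} (\<lambda>s. \<Sum>k. x k * real k powr (-s))"
    unfolding a_def[symmetric] by (intro continuous_at_imp_continuous_on) auto
qed

section \<open>The iterated-logarithm normalisation\<close>

lemma lil_scale_sq:
  "s > 0 \<Longrightarrow> ln (ln (1 / s)) \<ge> 0 \<Longrightarrow> (lil_scale \<alpha> s)\<^sup>2 = ln (ln (1 / s)) / s powr (1 + 2 * \<alpha>)"
  by (simp add: lil_scale_def)

lemma loglog_at_top: "filterlim (\<lambda>s::real. ln (ln (1 / s))) at_top (at_right 0)"
  by real_asymp

lemma lil_scale_pos: "\<forall>\<^sub>F s in at_right 0. lil_scale \<alpha> s > 0"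
proof -
  have "\<forall>\<^sub>F s::real in at_right 0. ln (ln (1 / s)) > 0" using loglog_at_top by (rule filterlim_at_top_dense[THEN iffD1, rule_format])
  then show ?thesis using eventually_at_right_less[of 0]
    by eventually_elim (simp add: lil_scale_def)
qed

lemma lil_scale_at_top:
  assumes "\<alpha> > -1/2" shows "filterlim (lil_scale \<alpha>) at_top (at_right 0)"
proof -
  have "1 + 2 * \<alpha> > 0" using assms by simp
  then have "filterlim (\<lambda>s::real. ln (ln (1 / s)) / s powr (1 + 2 * \<alpha>)) at_top (at_right 0)" by real_asymp
  then show ?thesis unfolding lil_scale_def by (rule filterlim_compose[OF sqrt_at_top])
qed

text \<open>Carries a bound at a grid point to any smaller s in the same cell. Below
  \<open>exp (-1)\<close> the iterated logarithm is positive and decreasing in s.\<close>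

lemma lil_scale_antimono:
  assumes "\<alpha> > -1/2" "0 < s" "s \<le> t" "t < exp (-1)"
  shows "lil_scale \<alpha> t \<le> lil_scale \<alpha> s"
proof -
  have "ln t < -1" using assms by (metis exp_less_cancel_iff exp_ln less_le_trans)
  then have l: "ln (1/t) > 1" "ln (1/t) \<le> ln (1/s)" using assms by (simp_all add: ln_div)
  then have "0 \<le> ln (ln (1/t))" "ln (ln (1/t)) \<le> ln (ln (1/s))" by auto
  moreover have "s powr (1 + 2 * \<alpha>) \<le> t powr (1 + 2 * \<alpha>)" using assms by (intro powr_mono2) auto
  ultimately show ?thesis unfolding lil_scale_def using assms
    by (intro real_sqrt_le_mono frac_le) auto
qed

text \<open>The largest admissible tilt times the largest summand is negligible: this is why truncation at
  the square-root level suffices under a finite second moment.\<close>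

lemma lil_scale_tilt_negligible:
  assumes "\<alpha> > -1/2"
  shows "((\<lambda>s. s powr (- max \<alpha> 0) * ln (ln (1 / s)) / lil_scale \<alpha> s) \<longlongrightarrow> 0) (at_right 0)"
proof -
  \<comment> \<open>This exponent is the minimum of 1/2 and 1/2 + \<alpha>; its positivity is where
    \<alpha> > -1/2 enters.\<close>
  define g where "g = 1/2 + \<alpha> - max \<alpha> 0"
  have g: "g > 0" using assms by (auto simp: g_def max_def)
  have "((\<lambda>s::real. s powr g * sqrt (ln (ln (1 / s)))) \<longlongrightarrow> 0) (at_right 0)" using g by real_asymp
  then show ?thesis
  proof (rule Lim_transform_eventually)
    have "\<forall>\<^sub>F s::real in at_right 0. ln (ln (1 / s)) > 0"
      using loglog_at_top by (rule filterlim_at_top_dense[THEN iffD1, rule_format])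
    then show "\<forall>\<^sub>F s in at_right 0. s powr g * sqrt (ln (ln (1 / s))) =
        s powr (- max \<alpha> 0) * ln (ln (1 / s)) / lil_scale \<alpha> s"
      using eventually_at_right_less[of 0]
    proof eventually_elim
      case (elim s)
      have "lil_scale \<alpha> s = sqrt (ln (ln (1 / s))) / s powr (1/2 + \<alpha>)"
        using elim by (simp add: lil_scale_def real_sqrt_divide powr_half_sqrt[symmetric] powr_powr algebra_simps)
      moreover have "ln (ln (1 / s)) / (sqrt (ln (ln (1 / s))) / p) = ln (ln (1 / s)) / sqrt (ln (ln (1 / s))) * p" for p
        by simp
      ultimately have "ln (ln (1 / s)) / lil_scale \<alpha> s = sqrt (ln (ln (1 / s))) * s powr (1/2 + \<alpha>)"
        using real_div_sqrt[of "ln (ln (1 / s))"] elim by simp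
      moreover have "s powr g = s powr (- max \<alpha> 0) * s powr (1/2 + \<alpha>)"
        by (simp add: g_def powr_add[symmetric])
      ultimately have "s powr g * sqrt (ln (ln (1 / s))) = s powr (- max \<alpha> 0) * (ln (ln (1 / s)) / lil_scale \<alpha> s)"
        by (simp only: mult_ac)
      then show ?case by simp
    qed
  qed
qed

section \<open>Limit points and limsup of an oscillating function\<close>

lemma limit_points_of_oscillation:
  fixes f :: "real \<Rightarrow> real"
  assumes cont: "continuous_on {0<..<d} f" and d: "d > 0"
    and upper: "\<And>\<kappa>. \<kappa> > 1 \<Longrightarrow> \<forall>\<^sub>F s in at_right 0. \<bar>f s\<bar> < \<kappa>"
    and low: "\<And>\<kappa>. \<kappa> < 1 \<Longrightarrow> \<exists>\<^sub>F s in at_right 0. f s > \<kappa>"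
      "\<And>\<kappa>. \<kappa> < 1 \<Longrightarrow> \<exists>\<^sub>F s in at_right 0. - f s > \<kappa>"
  shows "limit_points_at_right0 f = {-1..1}"
proof (intro equalityI subsetI)
  fix L assume "L \<in> limit_points_at_right0 f"
  then have L: "\<exists>\<^sub>F s in at_right 0. dist (f s) L < e" if "e > 0" for e
    using that by (auto simp: limit_points_at_right0_def)
  have "\<bar>L\<bar> \<le> 1"
  proof (rule ccontr)
    assume "\<not> \<bar>L\<bar> \<le> 1"
    then have k: "(\<bar>L\<bar> - 1) / 2 > 0" "1 + (\<bar>L\<bar> - 1) / 2 > 1" by auto
    have "\<exists>\<^sub>F s in at_right 0. dist (f s) L < (\<bar>L\<bar> - 1) / 2 \<and> \<bar>f s\<bar> < 1 + (\<bar>L\<bar> - 1) / 2"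
      using frequently_eventually_frequently[OF L[OF k(1)] upper[OF k(2)]] .
    then obtain s where "dist (f s) L < (\<bar>L\<bar> - 1) / 2" "\<bar>f s\<bar> < 1 + (\<bar>L\<bar> - 1) / 2"
      using frequently_ex by blast
    then show False by (auto simp: dist_real_def abs_real_def field_simps split: if_splits)
  qed
  then show "L \<in> {-1..1}" by auto
next
  fix L :: real assume L: "L \<in> {-1..1}"
  have "\<exists>\<^sub>F s in at_right 0. dist (f s) L < e" if e: "e > 0" for e
  proof -
    \<comment> \<open>\<open>L\<close> is moved towards 0 so that \<open>l\<close> lies strictly
      inside (-1, 1). Such values are attained arbitrarily close to 0, whereas the endpoints 1 and
      -1 need not be.\<close>
    define l where "l = (if L \<ge> 0 then L - min (e/2) (1/2) else L + min (e/2) (1/2))"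
    have l: "l < 1" "- l < 1" "\<bar>l - L\<bar> < e" using L e by (auto simp: l_def min_def split: if_splits)
    have "\<exists>s\<in>{0<..<b}. dist (f s) L < e" if b: "b > 0" for b
    proof -
      define b' where "b' = min b d"
      have b': "b' > 0" using b d by (simp add: b'_def)
      have ex: "\<exists>s\<in>{0<..<b'}. P s" if "\<exists>\<^sub>F s in at_right 0. P s" for P :: "real \<Rightarrow> bool"
        using that b' unfolding frequently_def eventually_at_right_field by (metis greaterThanLessThan_iff)
      obtain s1 where s1: "s1 \<in> {0<..<b'}" "f s1 > l" using ex[OF low(1)[OF l(1)]] by blast
      obtain s2 where s2: "s2 \<in> {0<..<b'}" "f s2 < l" using ex[OF low(2)[OF l(2)]] by auto
      have "connected (f ` {0<..<b'})"
        by (intro connected_continuous_image continuous_on_subset[OF cont]) (auto simp: b'_def)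
      then have "l \<in> f ` {0<..<b'}"
        unfolding connected_iff_interval using s1 s2 by (meson image_eqI less_imp_le)
      then obtain s where "s \<in> {0<..<b'}" "f s = l" by auto
      then show ?thesis using l by (intro bexI[of _ s]) (auto simp: b'_def dist_real_def abs_minus_commute)
    qed
    then show ?thesis unfolding frequently_def eventually_at_right_field by fastforce
  qed
  then show "L \<in> limit_points_at_right0 f" by (auto simp: limit_points_at_right0_def)
qed

lemma Limsup_eq_of_oscillation:
  fixes f :: "real \<Rightarrow> real"
  assumes upper: "\<And>x. x > c \<Longrightarrow> \<forall>\<^sub>F s in F. f s < x"
    and low: "\<And>x. x < c \<Longrightarrow> \<exists>\<^sub>F s in F. f s > x"
  shows "Limsup F (\<lambda>s. ereal (f s)) = ereal c"
proof (rule antisym)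
  show "Limsup F (\<lambda>s. ereal (f s)) \<le> ereal c"
  proof (rule ccontr)
    assume "\<not> Limsup F (\<lambda>s. ereal (f s)) \<le> ereal c"
    then obtain x where x: "ereal c < ereal x" "ereal x < Limsup F (\<lambda>s. ereal (f s))"
      using ereal_dense2 by (metis not_le)
    then have "Limsup F (\<lambda>s. ereal (f s)) \<le> ereal x"
      using upper[of x] by (intro Limsup_bounded) (auto elim!: eventually_mono)
    then show False using x by simp
  qed
  show "ereal c \<le> Limsup F (\<lambda>s. ereal (f s))"
  proof (rule ccontr)
    assume "\<not> ereal c \<le> Limsup F (\<lambda>s. ereal (f s))"
    then obtain x where x: "Limsup F (\<lambda>s. ereal (f s)) < ereal x" "ereal x < ereal c"
      using ereal_dense2 by (metis not_le)
    then have "\<forall>\<^sub>F s in F. ereal (f s) < ereal x" by (intro Limsup_lessD)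
    moreover have "\<exists>\<^sub>F s in F. f s > x" using low x by simp
    ultimately have "\<exists>\<^sub>F s in F. f s > x \<and> ereal (f s) < ereal x"
      by (intro frequently_eventually_frequently)
    then show False by (auto dest: frequently_ex)
  qed
qed

section \<open>Exponential moments of truncated sequences\<close>

text \<open>The cubic error is stated relative to x^2: after taking expectations it only changes the
  second-moment term by a factor 1 + m or 1 - m. The constant results from exp 1 <= 3.\<close>

lemma exp_quadratic_remainder:
  fixes x m :: real
  assumes "\<bar>x\<bar> \<le> m" "m \<le> 1"
  shows "\<bar>exp x - (1 + x + x\<^sup>2 / 2)\<bar> \<le> m * x\<^sup>2 / 2"
proof -
  obtain t where t: "\<bar>t\<bar> \<le> \<bar>x\<bar>" "exp x = (\<Sum>i<3. x ^ i / fact i) + exp t / fact 3 * x ^ 3"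
    using Maclaurin_exp_le[of x 3] by blast
  have "exp t \<le> exp 1" using t assms by simp
  then have e: "exp t \<le> 3" using e_less_272 by linarith
  have "exp x - (1 + x + x\<^sup>2 / 2) = exp t / 6 * x ^ 3"
    unfolding t(2) by (simp add: eval_nat_numeral fact_numeral)
  also have "\<bar>exp t / 6 * x ^ 3\<bar> = exp t / 6 * (\<bar>x\<bar> * x\<^sup>2)"
    by (simp add: abs_mult power3_eq_cube power2_eq_square)
  also have "\<dots> \<le> 3 / 6 * (m * x\<^sup>2)"
    using e assms by (intro mult_mono divide_right_mono) auto
  finally show ?thesis by simp
qed

text \<open>Fatou's lemma and Markov's inequality are applied to the liminf over \<open>N\<close> of
  the exponentials, then Borel-Cantelli over \<open>n\<close>. A bound for infinitely many
  \<open>N\<close> presupposes no convergence, and turns into a bound on the limit once convergence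
  is known.\<close>

lemma (in prob_space) AE_eventually_frequently_less:
  fixes G :: "nat \<Rightarrow> nat \<Rightarrow> 'a \<Rightarrow> real" and l x C :: "nat \<Rightarrow> real"
  assumes [measurable]: "\<And>n N. G n N \<in> borel_measurable M"
    and mgf: "\<forall>\<^sub>F n in sequentially. 0 < l n \<and> 0 \<le> C n \<and>
      (\<forall>N. (\<integral>\<^sup>+\<omega>. ennreal (exp (l n * G n N \<omega>)) \<partial>M) \<le> ennreal (C n))"
    and sum: "summable (\<lambda>n. C n * exp (- (l n * x n)))"
  shows "AE \<omega> in M. \<forall>\<^sub>F n in sequentially. \<exists>\<^sub>F N in sequentially. G n N \<omega> < x n"
proof -
  define U where "U n \<omega> = liminf (\<lambda>N. ennreal (exp (l n * G n N \<omega>)))" for n \<omega>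
  have [measurable]: "U n \<in> borel_measurable M" for n unfolding U_def by measurable
  obtain n0 where n0: "\<And>n. n \<ge> n0 \<Longrightarrow> 0 < l n \<and> 0 \<le> C n \<and>
      (\<forall>N. (\<integral>\<^sup>+\<omega>. ennreal (exp (l n * G n N \<omega>)) \<partial>M) \<le> ennreal (C n))"
    using mgf unfolding eventually_sequentially by blast
  define A where "A n = (if n < n0 then {} else {\<omega>\<in>space M. 1 \<le> ennreal (exp (- (l n * x n))) * U n \<omega>})" for n
  have A[measurable]: "A n \<in> sets M" for n unfolding A_def by simp
  have pA: "measure M (A n) \<le> C n * exp (- (l n * x n))" if "n \<ge> n0" for n
  proof -
    have "emeasure M (A n) \<le> ennreal (exp (- (l n * x n))) * (\<integral>\<^sup>+\<omega>\<in>space M. U n \<omega> \<partial>M)"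
      using that nn_integral_Markov_inequality[of "U n" "space M" M "ennreal (exp (- (l n * x n)))"]
      by (simp add: A_def)
    also have "(\<integral>\<^sup>+\<omega>\<in>space M. U n \<omega> \<partial>M) = (\<integral>\<^sup>+\<omega>. U n \<omega> \<partial>M)"
      by (rule nn_integral_cong) simp
    also have "\<dots> \<le> liminf (\<lambda>N. \<integral>\<^sup>+\<omega>. ennreal (exp (l n * G n N \<omega>)) \<partial>M)"
      unfolding U_def by (rule nn_integral_liminf) measurable
    also have "\<dots> \<le> ennreal (C n)"
      using n0[OF that] by (intro Liminf_le) auto
    finally have "emeasure M (A n) \<le> ennreal (exp (- (l n * x n))) * ennreal (C n)"
      by (auto simp: mult_left_mono)
    also have "\<dots> = ennreal (C n * exp (- (l n * x n)))"
      using n0[OF that] by (simp add: ennreal_mult[symmetric] mult.commute)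
    finally show ?thesis using n0[OF that] by (simp add: emeasure_eq_measure)
  qed
  have "summable (\<lambda>n. measure M (A n))"
    by (rule summable_comparison_test_ev[OF _ sum])
       (use pA in \<open>auto simp: eventually_sequentially\<close>)
  then have "AE \<omega> in M. \<forall>\<^sub>F n in sequentially. \<omega> \<in> space M - A n"
    by (intro borel_cantelli_AE1) (auto simp: emeasure_eq_measure)
  then show ?thesis
  proof eventually_elim
    case (elim \<omega>)
    then show ?case using eventually_ge_at_top[of n0]
    proof eventually_elim
      case (elim n)
      show ?case
      proof (rule ccontr)
        assume "\<not> (\<exists>\<^sub>F N in sequentially. G n N \<omega> < x n)"
        then have "\<forall>\<^sub>F N in sequentially. x n \<le> G n N \<omega>"
          by (simp add: not_frequently not_less)
        then have "\<forall>\<^sub>F N in sequentially. ennreal (exp (l n * x n)) \<le> ennreal (exp (l n * G n N \<omega>))"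
          by eventually_elim (use n0[OF elim(2)] in \<open>auto intro!: ennreal_leI\<close>)
        then have "ennreal (exp (l n * x n)) \<le> U n \<omega>"
          unfolding U_def by (rule Liminf_bounded)
        then have "ennreal (exp (- (l n * x n))) * ennreal (exp (l n * x n)) \<le> ennreal (exp (- (l n * x n))) * U n \<omega>"
          by (intro mult_left_mono) auto
        then have "1 \<le> ennreal (exp (- (l n * x n))) * U n \<omega>"
          by (simp add: ennreal_mult[symmetric] exp_add[symmetric])
        with elim show False by (auto simp: A_def)
      qed
    qed
  qed
qed

text \<open>Chernoff's bound with scale \<open>p\<close>, iterated logarithm \<open>l\<close>,
  summand bound \<open>m\<close> and variance proxy \<open>v * W\<close>. If the variance is at most
  r * p^2 / (2 l) with r < K^2, the exponent for the deviation K * p exceeds l by a fixed factor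
  greater than 1, and \<open>lsum\<close> makes the probabilities summable.\<close>

lemma (in prob_space) AE_eventually_less_of_gaussian_mgf:
  fixes G :: "nat \<Rightarrow> nat \<Rightarrow> 'a \<Rightarrow> real" and l p m W :: "nat \<Rightarrow> real" and v D K r :: real
  assumes meas: "\<And>n N. G n N \<in> borel_measurable M"
    and l: "filterlim l at_top sequentially"
    and lsum: "\<And>\<theta>. \<theta> > 1 \<Longrightarrow> summable (\<lambda>n. exp (- \<theta> * l n))"
    and p: "\<forall>\<^sub>F n in sequentially. p n > 0"
    and m: "(\<lambda>n. m n * l n / p n) \<longlonglongrightarrow> 0"
    and r: "0 \<le> r" "r < K\<^sup>2" and K: "K > 0"
    and W: "\<forall>\<^sub>F n in sequentially. 2 * v * W n * l n / (p n)\<^sup>2 \<le> r"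
    and mgf: "\<forall>\<^sub>F n in sequentially. \<forall>t>0. t * m n \<le> 1 \<longrightarrow> (\<forall>N.
      (\<integral>\<^sup>+\<omega>. ennreal (exp (t * G n N \<omega>)) \<partial>M) \<le>
        ennreal (2 * exp (t * m n * D + t\<^sup>2 * (1 + t * m n) / 2 * v * W n)))"
    and m0: "\<forall>\<^sub>F n in sequentially. m n \<ge> 0"
  shows "AE \<omega> in M. \<forall>\<^sub>F n in sequentially. \<exists>\<^sub>F N in sequentially. G n N \<omega> < K * p n"
proof -
  define r' where "r' = (r + K\<^sup>2) / 2"
  have r': "r' > 0" "r < r'" "r' < K\<^sup>2" using r K by (auto simp: r'_def)
  \<comment> \<open>The minimiser of t^2 * V / 2 - t * K * p for V = r' * p^2 / (2 l). Taking r'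
    strictly between r and K^2 leaves room for the factor 1 + t * m.\<close>
  define t where "t n = 2 * K * l n / (p n * r')" for n
  define C where "C n = 2 * exp (t n * m n * D + (t n)\<^sup>2 * (1 + t n * m n) / 2 * v * W n)" for n
  have tm: "(\<lambda>n. t n * m n) \<longlonglongrightarrow> 0"
    using tendsto_mult[OF tendsto_const m, of "2 * K / r'"] by (simp add: t_def mult_ac)
  have "(\<lambda>n. t n * m n * D) \<longlonglongrightarrow> 0" "(\<lambda>n. r * (1 + t n * m n)) \<longlonglongrightarrow> r"
    using tendsto_mult_left_zero[OF tm] tendsto_mult[OF tendsto_const tendsto_add[OF tendsto_const tm], of r 1]
    by auto
  then have ev: "\<forall>\<^sub>F n in sequentially. t n * m n * D < 1" "\<forall>\<^sub>F n in sequentially. r * (1 + t n * m n) < r'"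
    "\<forall>\<^sub>F n in sequentially. t n * m n < 1"
    using r' tm by (auto intro: order_tendstoD)
  have lpos: "\<forall>\<^sub>F n in sequentially. l n > 0" using l by (simp add: filterlim_at_top_dense)
  have tpos: "\<forall>\<^sub>F n in sequentially. t n > 0"
    using p lpos by eventually_elim (use K r' in \<open>simp add: t_def\<close>)
  show ?thesis
  proof (rule AE_eventually_frequently_less[OF meas])
    show "\<forall>\<^sub>F n in sequentially. 0 < t n \<and> 0 \<le> C n \<and>
        (\<forall>N. (\<integral>\<^sup>+\<omega>. ennreal (exp (t n * G n N \<omega>)) \<partial>M) \<le> ennreal (C n))"
      using tpos ev(3) mgf by eventually_elim (auto simp: C_def)
    have bd: "\<forall>\<^sub>F n in sequentially. norm (C n * exp (- (t n * (K * p n)))) \<le> 2 * exp 1 * exp (- (K\<^sup>2 / r') * l n)"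
      using ev p lpos tpos W m0
    proof eventually_elim
      case (elim n)
      have a: "t n * (K * p n) = 2 * K\<^sup>2 / r' * l n"
        using elim by (simp add: t_def power2_eq_square)
      have "(t n)\<^sup>2 * (1 + t n * m n) / 2 * v * W n =
          K\<^sup>2 / r'\<^sup>2 * l n * ((2 * v * W n * l n / (p n)\<^sup>2) * (1 + t n * m n))"
      proof -
        have "(2 * K * a / (b * r'))\<^sup>2 * z / 2 * v * w = K\<^sup>2 / r'\<^sup>2 * a * ((2 * v * w * a / b\<^sup>2) * z)" for a b z w
          by (simp add: power_divide power_mult_distrib power2_eq_square mult_ac)
        from this[of "l n" "p n" "1 + t n * m n" "W n"] show ?thesis by (simp only: t_def)
      qed
      also have "\<dots> \<le> K\<^sup>2 / r'\<^sup>2 * l n * r'"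
      proof (rule mult_left_mono)
        have "(2 * v * W n * l n / (p n)\<^sup>2) * (1 + t n * m n) \<le> r * (1 + t n * m n)"
          using elim by (intro mult_right_mono) auto
        then show "(2 * v * W n * l n / (p n)\<^sup>2) * (1 + t n * m n) \<le> r'" using elim by linarith
      qed (use elim in auto)
      also have "\<dots> = K\<^sup>2 / r' * l n" using r' by (simp add: power2_eq_square)
      finally have "t n * m n * D + (t n)\<^sup>2 * (1 + t n * m n) / 2 * v * W n \<le> 1 + K\<^sup>2 / r' * l n"
        using elim by linarith
      then have "C n \<le> 2 * exp (1 + K\<^sup>2 / r' * l n)" by (simp add: C_def)
      then have "C n * exp (- (t n * (K * p n))) \<le> 2 * exp (1 + K\<^sup>2 / r' * l n) * exp (- (t n * (K * p n)))"
        by (intro mult_right_mono) auto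
      also have "\<dots> = 2 * exp 1 * exp (- (K\<^sup>2 / r') * l n)"
        unfolding a by (simp add: exp_add[symmetric] mult.assoc)
      finally show ?case by (simp add: C_def)
    qed
    have "K\<^sup>2 / r' > 1" using r' by simp
    from summable_mult[OF lsum[OF this], of "2 * exp 1"]
    show "summable (\<lambda>n. C n * exp (- (t n * (K * p n))))"
      by (rule summable_comparison_test_ev[OF bd])
  qed
qed

text \<open>The variables need not be centred; \<open>mean\<close> is the form in which their bias
  is harmless, since a weight b with |b| * sqrt k <= m multiplies the mean by at most m / sqrt k.
  Upper bounds use \<open>second\<close>, lower bounds use \<open>second_lim\<close>.\<close>

locale truncated_sequence = prob_space M for M :: "'a measure" +
  fixes \<xi> :: "nat \<Rightarrow> 'a \<Rightarrow> real" and v D :: real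
  assumes indep: "indep_vars (\<lambda>_. borel) \<xi> UNIV"
    and bound: "\<And>k \<omega>. \<bar>\<xi> k \<omega>\<bar> \<le> sqrt (real k)"
    and second: "\<And>k. expectation (\<lambda>\<omega>. (\<xi> k \<omega>)\<^sup>2) \<le> v"
    and v_pos: "v > 0"
    and second_lim: "(\<lambda>k. expectation (\<lambda>\<omega>. (\<xi> k \<omega>)\<^sup>2)) \<longlonglongrightarrow> v"
    and mean: "\<And>F. finite F \<Longrightarrow> (\<Sum>k\<in>F. \<bar>expectation (\<xi> k)\<bar> / sqrt (real k)) \<le> D"
begin

lemma meas [measurable]: "\<xi> k \<in> borel_measurable M"
  using indep unfolding indep_vars_def by auto

lemma xi_0 [simp]: "\<xi> 0 \<omega> = 0"
  using bound[of 0 \<omega>] by simp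

lemma int_xi [simp, intro]: "integrable M (\<xi> k)"
  by (rule integrable_const_bound[where B = "sqrt (real k)"]) (use bound in auto)

lemma int_xi_sq [simp, intro]: "integrable M (\<lambda>\<omega>. (\<xi> k \<omega>)\<^sup>2)"
proof (rule integrable_const_bound[where B = "real k"])
  show "AE \<omega> in M. norm ((\<xi> k \<omega>)\<^sup>2) \<le> real k"
    using power_mono[OF bound[of k] abs_ge_zero, of _ 2] by (intro AE_I2) simp
qed simp

lemma scaled_bound:
  assumes "\<bar>b\<bar> * sqrt (real k) \<le> m" shows "\<bar>b * \<xi> k \<omega>\<bar> \<le> m"
proof -
  have "\<bar>b\<bar> * \<bar>\<xi> k \<omega>\<bar> \<le> \<bar>b\<bar> * sqrt (real k)" by (intro mult_left_mono bound) auto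
  with assms show ?thesis by (simp add: abs_mult)
qed

lemma int_exp_xi [simp, intro]: "integrable M (\<lambda>\<omega>. exp (b * \<xi> k \<omega>))"
proof (rule integrable_const_bound[where B = "exp (\<bar>b\<bar> * sqrt (real k))"])
  show "AE \<omega> in M. norm (exp (b * \<xi> k \<omega>)) \<le> exp (\<bar>b\<bar> * sqrt (real k))"
    using scaled_bound[OF order_refl, of b k] by (auto simp: abs_le_iff)
qed simp

section \<open>Moment generating functions of single terms and of finite sums\<close>

lemma mgf_one:
  assumes m: "\<bar>b\<bar> * sqrt (real k) \<le> m" "m \<le> 1"
  shows "\<bar>expectation (\<lambda>\<omega>. exp (b * \<xi> k \<omega>)) - (1 + b * expectation (\<xi> k) + b\<^sup>2 * expectation (\<lambda>\<omega>. (\<xi> k \<omega>)\<^sup>2) / 2)\<bar>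
    \<le> m * (b\<^sup>2 * expectation (\<lambda>\<omega>. (\<xi> k \<omega>)\<^sup>2)) / 2"
proof -
  have eq: "expectation (\<lambda>\<omega>. exp (b * \<xi> k \<omega>) - (1 + b * \<xi> k \<omega> + b\<^sup>2 * (\<xi> k \<omega>)\<^sup>2 / 2)) =
      expectation (\<lambda>\<omega>. exp (b * \<xi> k \<omega>)) - (1 + b * expectation (\<xi> k) + b\<^sup>2 * expectation (\<lambda>\<omega>. (\<xi> k \<omega>)\<^sup>2) / 2)"
    by (simp add: prob_space)
  then have "\<bar>expectation (\<lambda>\<omega>. exp (b * \<xi> k \<omega>)) - (1 + b * expectation (\<xi> k) + b\<^sup>2 * expectation (\<lambda>\<omega>. (\<xi> k \<omega>)\<^sup>2) / 2)\<bar> \<le>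
     expectation (\<lambda>\<omega>. \<bar>exp (b * \<xi> k \<omega>) - (1 + b * \<xi> k \<omega> + b\<^sup>2 * (\<xi> k \<omega>)\<^sup>2 / 2)\<bar>)"
    unfolding eq[symmetric] using integral_norm_bound[of M "\<lambda>\<omega>. exp (b * \<xi> k \<omega>) - (1 + b * \<xi> k \<omega> + b\<^sup>2 * (\<xi> k \<omega>)\<^sup>2 / 2)"]
    by (simp only: real_norm_def)
  also have "\<dots> \<le> expectation (\<lambda>\<omega>. m * (b\<^sup>2 * (\<xi> k \<omega>)\<^sup>2) / 2)"
  proof (rule integral_mono)
    show "\<bar>exp (b * \<xi> k \<omega>) - (1 + b * \<xi> k \<omega> + b\<^sup>2 * (\<xi> k \<omega>)\<^sup>2 / 2)\<bar> \<le> m * (b\<^sup>2 * (\<xi> k \<omega>)\<^sup>2) / 2" for \<omega>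
      using exp_quadratic_remainder[OF scaled_bound[OF m(1)] m(2), of \<omega>] by (simp add: power_mult_distrib)
    show "integrable M (\<lambda>\<omega>. m * (b\<^sup>2 * (\<xi> k \<omega>)\<^sup>2) / 2)"
      by (intro integrable_mult_right Bochner_Integration.integrable_divide) simp
  qed (intro integrable_abs Bochner_Integration.integrable_diff Bochner_Integration.integrable_add; simp)
  finally show ?thesis by simp
qed

text \<open>The quadratic expansion followed by 1 + x <= exp x. The bias is split as (|b| * sqrt k)
  * (|mean| / sqrt k), whose first factor is at most m.\<close>

lemma mgf_one_le:
  assumes m: "\<bar>b\<bar> * sqrt (real k) \<le> m" "m \<le> 1"
  shows "expectation (\<lambda>\<omega>. exp (b * \<xi> k \<omega>)) \<le>
    exp (m * (\<bar>expectation (\<xi> k)\<bar> / sqrt (real k)) + (1 + m) / 2 * v * b\<^sup>2)"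
proof (cases "k = 0")
  case False
  define \<mu> where "\<mu> = expectation (\<xi> k)"
  define e where "e = expectation (\<lambda>\<omega>. (\<xi> k \<omega>)\<^sup>2)"
  have m0: "m \<ge> 0" using m(1) by (meson abs_ge_zero mult_nonneg_nonneg of_nat_0_le_iff order_trans real_sqrt_ge_zero)
  have e: "0 \<le> e" "e \<le> v" unfolding e_def by (auto intro: second)
  have "expectation (\<lambda>\<omega>. exp (b * \<xi> k \<omega>)) \<le> 1 + b * \<mu> + b\<^sup>2 * e / 2 + m * (b\<^sup>2 * e) / 2"
    using mgf_one[OF m] unfolding \<mu>_def e_def by linarith
  moreover have "b * \<mu> \<le> m * (\<bar>\<mu>\<bar> / sqrt (real k))"
  proof -
    have "b * \<mu> \<le> \<bar>b\<bar> * \<bar>\<mu>\<bar>" by (metis abs_ge_self abs_mult)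
    also have "\<dots> = \<bar>b\<bar> * sqrt (real k) * (\<bar>\<mu>\<bar> / sqrt (real k))" using False by simp
    also have "\<dots> \<le> m * (\<bar>\<mu>\<bar> / sqrt (real k))" by (rule mult_right_mono[OF m(1)]) auto
    finally show ?thesis .
  qed
  moreover have "b\<^sup>2 * e / 2 + m * (b\<^sup>2 * e) / 2 = (1 + m) / 2 * e * b\<^sup>2" by (simp add: field_simps)
  moreover have "(1 + m) / 2 * e * b\<^sup>2 \<le> (1 + m) / 2 * v * b\<^sup>2"
    using m0 e by (intro mult_right_mono mult_left_mono) auto
  ultimately have "expectation (\<lambda>\<omega>. exp (b * \<xi> k \<omega>)) \<le> 1 + (m * (\<bar>\<mu>\<bar> / sqrt (real k)) + (1 + m) / 2 * v * b\<^sup>2)"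
    by linarith
  then show ?thesis unfolding \<mu>_def by (meson exp_ge_add_one_self order_trans)
qed (use v_pos m in \<open>simp add: prob_space\<close>)

text \<open>With y the generating function minus 1, ln (1 + y) >= y - 2 y^2, and |y| <= 2 m turns
  the quadratic loss into 4 m |y|. Of the 6 m, one comes from the quadratic remainder and five from
  4 m |y|; that loss also costs the bias a second time, hence its factor 2.\<close>

lemma mgf_one_ge:
  assumes m: "\<bar>b\<bar> * sqrt (real k) \<le> m" "m \<le> 1/4"
  shows "expectation (\<lambda>\<omega>. exp (b * \<xi> k \<omega>)) \<ge>
    exp (- 2 * m * (\<bar>expectation (\<xi> k)\<bar> / sqrt (real k)) + (1 - 6 * m) / 2 * (b\<^sup>2 * expectation (\<lambda>\<omega>. (\<xi> k \<omega>)\<^sup>2)))"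
proof (cases "k = 0")
  case False
  define \<mu> where "\<mu> = b * expectation (\<xi> k)"
  define e where "e = b\<^sup>2 * expectation (\<lambda>\<omega>. (\<xi> k \<omega>)\<^sup>2)"
  define y where "y = expectation (\<lambda>\<omega>. exp (b * \<xi> k \<omega>)) - 1"
  have m0: "m \<ge> 0" using m(1) by (meson abs_ge_zero mult_nonneg_nonneg of_nat_0_le_iff order_trans real_sqrt_ge_zero)
  have e0: "0 \<le> e" unfolding e_def by simp
  have y: "\<bar>y - (\<mu> + e / 2)\<bar> \<le> m * e / 2"
    using mgf_one[OF m(1)] m(2) unfolding \<mu>_def e_def y_def by (simp add: algebra_simps)
  have "\<bar>y\<bar> = \<bar>expectation (\<lambda>\<omega>. exp (b * \<xi> k \<omega>) - 1)\<bar>" by (simp add: y_def prob_space)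
  also have "\<dots> \<le> expectation (\<lambda>\<omega>. \<bar>exp (b * \<xi> k \<omega>) - 1\<bar>)" by (rule integral_abs_bound)
  also have "\<dots> \<le> expectation (\<lambda>\<omega>. 2 * m)"
  proof (rule integral_mono)
    fix \<omega>
    have x: "\<bar>b * \<xi> k \<omega>\<bar> \<le> m" by (rule scaled_bound[OF m(1)])
    have "(b * \<xi> k \<omega>)\<^sup>2 \<le> m * 1"
      using mult_mono[OF x x] mult_left_mono[of m 1 m] m m0 by (simp add: power2_eq_square)
    moreover have "m * (b * \<xi> k \<omega>)\<^sup>2 \<le> 1 * (b * \<xi> k \<omega>)\<^sup>2" using m by (intro mult_right_mono) auto
    ultimately show "\<bar>exp (b * \<xi> k \<omega>) - 1\<bar> \<le> 2 * m"
      using exp_quadratic_remainder[OF x] x m by linarith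
  qed auto
  finally have y2: "\<bar>y\<bar> \<le> 2 * m" by (simp add: prob_space)
  have "y - 4 * m * \<bar>y\<bar> \<le> ln (1 + y)"
  proof -
    have "\<bar>ln (1 + y) - y\<bar> \<le> 2 * y\<^sup>2" using y2 m by (intro abs_ln_one_plus_x_minus_x_bound) auto
    moreover have "y\<^sup>2 \<le> 2 * m * \<bar>y\<bar>" using y2 mult_right_mono[OF y2, of "\<bar>y\<bar>"] by (simp add: power2_eq_square)
    ultimately show ?thesis by linarith
  qed
  moreover have "- 2 * \<bar>\<mu>\<bar> + (1 - 6 * m) / 2 * e \<le> y - 4 * m * \<bar>y\<bar>"
  proof -
    have "\<bar>y\<bar> \<le> \<bar>\<mu>\<bar> + e / 2 + m * e / 2" using y e0 by linarith
    then have "4 * m * \<bar>y\<bar> \<le> 4 * m * (\<bar>\<mu>\<bar> + e / 2 + m * e / 2)" using m0 by (intro mult_left_mono) auto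
    also have "\<dots> = 4 * m * \<bar>\<mu>\<bar> + (4 * m * e + 4 * m * (m * e)) / 2" by (simp add: algebra_simps)
    also have "\<dots> \<le> \<bar>\<mu>\<bar> + (4 * m * e + m * e) / 2"
    proof -
      have "4 * m * \<bar>\<mu>\<bar> \<le> 1 * \<bar>\<mu>\<bar>" using m by (intro mult_right_mono) auto
      moreover have "4 * m * (m * e) \<le> 1 * (m * e)" using m m0 e0 by (intro mult_right_mono) auto
      ultimately show ?thesis by (intro add_mono divide_right_mono) simp_all
    qed
    finally have *: "4 * m * \<bar>y\<bar> \<le> \<bar>\<mu>\<bar> + 5 * (m * e) / 2" by (simp add: mult.commute)
    have "(1 - 6 * m) / 2 * e = e / 2 - 6 * (m * e) / 2" by (simp add: field_simps)
    then show ?thesis using * y by linarith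
  qed
  moreover have "\<bar>\<mu>\<bar> \<le> m * (\<bar>expectation (\<xi> k)\<bar> / sqrt (real k))"
  proof -
    have "\<bar>\<mu>\<bar> = \<bar>b\<bar> * sqrt (real k) * (\<bar>expectation (\<xi> k)\<bar> / sqrt (real k))" using False by (simp add: \<mu>_def abs_mult)
    also have "\<dots> \<le> m * (\<bar>expectation (\<xi> k)\<bar> / sqrt (real k))" by (rule mult_right_mono[OF m(1)]) auto
    finally show ?thesis .
  qed
  ultimately have "- 2 * m * (\<bar>expectation (\<xi> k)\<bar> / sqrt (real k)) + (1 - 6 * m) / 2 * e \<le> ln (1 + y)"
    by linarith
  then have "exp (- 2 * m * (\<bar>expectation (\<xi> k)\<bar> / sqrt (real k)) + (1 - 6 * m) / 2 * e) \<le> 1 + y"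
    using y2 m by (subst (asm) ln_ge_iff) auto
  then show ?thesis by (simp add: y_def e_def)
qed (simp add: prob_space)

lemma mgf_sum:
  assumes "finite F"
  shows "integrable M (\<lambda>\<omega>. exp (\<Sum>k\<in>F. b k * \<xi> k \<omega>))"
    and "expectation (\<lambda>\<omega>. exp (\<Sum>k\<in>F. b k * \<xi> k \<omega>)) = (\<Prod>k\<in>F. expectation (\<lambda>\<omega>. exp (b k * \<xi> k \<omega>)))"
proof -
  have ind: "indep_vars (\<lambda>_. borel) (\<lambda>k \<omega>. exp (b k * \<xi> k \<omega>)) F"
    by (rule indep_vars_compose2[OF indep_vars_subset[OF indep]]) auto
  show "integrable M (\<lambda>\<omega>. exp (\<Sum>k\<in>F. b k * \<xi> k \<omega>))"
    using indep_vars_integrable[OF assms ind] by (simp add: exp_sum[OF assms])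
  show "expectation (\<lambda>\<omega>. exp (\<Sum>k\<in>F. b k * \<xi> k \<omega>)) = (\<Prod>k\<in>F. expectation (\<lambda>\<omega>. exp (b k * \<xi> k \<omega>)))"
    using indep_vars_lebesgue_integral[OF assms ind] by (simp add: exp_sum[OF assms])
qed

lemma mgf_upper:
  assumes F: "finite F" and m: "0 \<le> m" "m \<le> 1" "\<And>k. k \<in> F \<Longrightarrow> \<bar>b k\<bar> * sqrt (real k) \<le> m"
    and W: "(\<Sum>k\<in>F. (b k)\<^sup>2) \<le> W"
  shows "expectation (\<lambda>\<omega>. exp (\<Sum>k\<in>F. b k * \<xi> k \<omega>)) \<le> exp (m * D + (1 + m) / 2 * v * W)"
proof -
  have "(\<Prod>k\<in>F. expectation (\<lambda>\<omega>. exp (b k * \<xi> k \<omega>))) \<le>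
      (\<Prod>k\<in>F. exp (m * (\<bar>expectation (\<xi> k)\<bar> / sqrt (real k)) + (1 + m) / 2 * v * (b k)\<^sup>2))"
    by (intro prod_mono conjI mgf_one_le m) (auto intro!: integral_nonneg_AE)
  also have "\<dots> = exp (m * (\<Sum>k\<in>F. \<bar>expectation (\<xi> k)\<bar> / sqrt (real k)) + (1 + m) / 2 * v * (\<Sum>k\<in>F. (b k)\<^sup>2))"
    by (simp add: exp_sum[OF F, symmetric] sum.distrib sum_distrib_left)
  also have "\<dots> \<le> exp (m * D + (1 + m) / 2 * v * W)"
    using m v_pos by (simp add: add_mono mult_left_mono mean[OF F] W)
  finally show ?thesis by (simp add: mgf_sum(2)[OF F])
qed

lemma mgf_lower:
  assumes F: "finite F" and m: "0 \<le> m" "m \<le> 1/12" "\<And>k. k \<in> F \<Longrightarrow> \<bar>b k\<bar> * sqrt (real k) \<le> m"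
    and W: "(\<Sum>k\<in>F. (b k)\<^sup>2 * expectation (\<lambda>\<omega>. (\<xi> k \<omega>)\<^sup>2)) \<ge> W"
  shows "expectation (\<lambda>\<omega>. exp (\<Sum>k\<in>F. b k * \<xi> k \<omega>)) \<ge> exp (- 2 * m * D + (1 - 6 * m) / 2 * W)"
proof -
  have "exp (- 2 * m * D + (1 - 6 * m) / 2 * W) \<le>
      exp (- 2 * m * (\<Sum>k\<in>F. \<bar>expectation (\<xi> k)\<bar> / sqrt (real k)) + (1 - 6 * m) / 2 * (\<Sum>k\<in>F. (b k)\<^sup>2 * expectation (\<lambda>\<omega>. (\<xi> k \<omega>)\<^sup>2)))"
    unfolding exp_le_cancel_iff using m
    by (intro add_mono mult_left_mono_neg[OF mean[OF F]] mult_left_mono[OF W]) auto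
  also have "\<dots> = (\<Prod>k\<in>F. exp (- 2 * m * (\<bar>expectation (\<xi> k)\<bar> / sqrt (real k)) + (1 - 6 * m) / 2 * ((b k)\<^sup>2 * expectation (\<lambda>\<omega>. (\<xi> k \<omega>)\<^sup>2))))"
    by (simp only: exp_sum[OF F, symmetric] sum.distrib sum_distrib_left)
  also have "\<dots> \<le> (\<Prod>k\<in>F. expectation (\<lambda>\<omega>. exp (b k * \<xi> k \<omega>)))"
    by (intro prod_mono conjI mgf_one_ge m) (use m in auto)
  finally show ?thesis by (simp add: mgf_sum(2)[OF F])
qed

end

text \<open>Jensen's inequality for the uniform law on the interval, by the tangent of exp at the
  average \<open>z\<close>. The nonnegative integral on the right is the form in which Fubini is
  applied later.\<close>

lemma exp_average_le:
  fixes y :: "real \<Rightarrow> real"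
  assumes ab: "a < b" and cont: "continuous_on {a..b} y"
  shows "ennreal (exp ((LINT u:{a..b}|lborel. y u) / (b - a))) \<le>
    ennreal (1 / (b - a)) * (\<integral>\<^sup>+u. ennreal (exp (y u)) * indicator {a..b} u \<partial>lborel)"
proof -
  define h where "h = b - a"
  have h: "h > 0" using ab by (simp add: h_def)
  have inty: "set_integrable lborel {a..b} y"
    by (rule borel_integrable_atLeastAtMost') (rule cont)
  define I where "I = integral {a..b} y"
  define z where "z = I / h"
  have I: "(LINT u:{a..b}|lborel. y u) = I"
    unfolding I_def by (rule set_borel_integral_eq_integral(2)[OF inty])
  have hy: "(y has_integral I) {a..b}"
    unfolding I_def by (rule integrable_integral[OF integrable_continuous_real[OF cont]])
  have he: "((\<lambda>u. exp (y u)) has_integral integral {a..b} (\<lambda>u. exp (y u))) {a..b}"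
    by (intro integrable_integral integrable_continuous_real continuous_intros cont)
  have "((\<lambda>u. exp z * (1 - z) + exp z * y u) has_integral (h * (exp z * (1 - z)) + exp z * I)) {a..b}"
    using has_integral_add[OF has_integral_const_real[of "exp z * (1 - z)" a b] has_integral_mult_right[OF hy, of "exp z"]] ab
    by (simp add: h_def)
  moreover have "h * (exp z * (1 - z)) + exp z * I = h * exp z"
    using h by (simp add: z_def field_simps)
  ultimately have hl: "((\<lambda>u. exp z * (1 - z) + exp z * y u) has_integral (h * exp z)) {a..b}" by simp
  have "h * exp z \<le> integral {a..b} (\<lambda>u. exp (y u))"
  proof (rule has_integral_le[OF hl he])
    fix u
    have "exp z * (1 + (y u - z)) \<le> exp z * exp (y u - z)" by (intro mult_left_mono exp_ge_add_one_self) auto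
    then show "exp z * (1 - z) + exp z * y u \<le> exp (y u)" by (simp add: exp_add[symmetric] algebra_simps)
  qed
  then have "exp z \<le> 1 / h * integral {a..b} (\<lambda>u. exp (y u))" using h by (simp add: field_simps)
  then have "ennreal (exp z) \<le> ennreal (1 / h) * ennreal (integral {a..b} (\<lambda>u. exp (y u)))"
    using h by (simp add: ennreal_mult'[symmetric] ennreal_leI)
  also have "ennreal (integral {a..b} (\<lambda>u. exp (y u))) = (\<integral>\<^sup>+u. ennreal (exp (y u)) * indicator {a..b} u \<partial>lborel)"
    by (rule nn_integral_has_integral_lebesgue'[OF _ he, symmetric]) auto
  finally show ?thesis by (simp add: I z_def h_def)
qed

text \<open>The exponents 1/(j+1) get below every s > 0 and yet form a countable family, so the
  hypothesis can hold almost surely for all j at once.\<close>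

lemma dirichlet_weighted_series:
  fixes x :: "nat \<Rightarrow> real"
  assumes "\<And>j::nat. \<exists>C. \<forall>n. \<bar>\<Sum>k<n. dweight \<alpha> 0 k * x k\<bar> \<le> C * real n powr (1 / real (Suc j))"
  shows "s > 0 \<Longrightarrow> summable (\<lambda>k. dweight \<alpha> s k * x k)"
    and "continuous_on {0<..} (\<lambda>s. \<Sum>k. dweight \<alpha> s k * x k)"
proof -
  have eq: "dweight \<alpha> s k * x k = dweight \<alpha> 0 k * x k * real k powr (-s)" for s k
    using dweight_shift[of \<alpha> 0 s k] by simp
  have ex: "\<exists>j. 1 / real (Suc j) < s" if "s > 0" for s :: real
    using reals_Archimedean[OF that] by (simp add: inverse_eq_divide)
  show "summable (\<lambda>k. dweight \<alpha> s k * x k)" if s: "s > 0"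
  proof -
    obtain j where j: "1 / real (Suc j) < s" using ex[OF s] by blast
    obtain C where C: "\<And>n. \<bar>\<Sum>k<n. dweight \<alpha> 0 k * x k\<bar> \<le> C * real n powr (1 / real (Suc j))"
      using assms by blast
    have "summable (\<lambda>k. dweight \<alpha> 0 k * x k * real k powr (-s))"
      by (rule dirichlet_series_continuous(1)[OF _ _ C j]) auto
    then show ?thesis by (simp only: eq[symmetric])
  qed
  have "isCont (\<lambda>s. \<Sum>k. dweight \<alpha> s k * x k) s" if s: "s > 0" for s
  proof -
    obtain j where j: "1 / real (Suc j) < s" using ex[OF s] by blast
    obtain C where C: "\<And>n. \<bar>\<Sum>k<n. dweight \<alpha> 0 k * x k\<bar> \<le> C * real n powr (1 / real (Suc j))"
      using assms by blast
    have "continuous_on {1 / real (Suc j)<..} (\<lambda>s. \<Sum>k. dweight \<alpha> 0 k * x k * real k powr (-s))"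
      by (rule dirichlet_series_continuous(2)[OF _ _ C]) auto
    then have "continuous_on {1 / real (Suc j)<..} (\<lambda>s. \<Sum>k. dweight \<alpha> s k * x k)"
      by (simp only: eq[symmetric])
    then show ?thesis using j by (simp add: continuous_on_eq_continuous_at)
  qed
  then show "continuous_on {0<..} (\<lambda>s. \<Sum>k. dweight \<alpha> s k * x k)"
    by (intro continuous_at_imp_continuous_on) auto
qed

lemma LIMSEQ_frequently_le:
  fixes f :: "nat \<Rightarrow> real"
  assumes "f \<longlonglongrightarrow> L" "\<exists>\<^sub>F n in sequentially. f n < b"
  shows "L \<le> b"
proof (rule ccontr)
  assume "\<not> L \<le> b"
  then have "\<forall>\<^sub>F n in sequentially. f n > b" using assms(1) by (intro order_tendstoD) auto
  from frequently_eventually_frequently[OF assms(2) this] show False by (auto dest: frequently_ex)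
qed

section \<open>Iterated logarithms along a geometric grid\<close>

lemma geometric_at_right_0: "0 < q \<Longrightarrow> q < 1 \<Longrightarrow> filterlim (\<lambda>n. q ^ n :: real) (at_right 0) sequentially"
  by (auto simp: filterlim_at LIMSEQ_realpow_zero)

text \<open>On the grid the iterated logarithm is the logarithm of a multiple of n. The next two
  lemmas therefore compare with a p-series for \<theta> > 1 and with the harmonic series for
  \<theta> = 1, the dividing line that fixes the constant of the theorem.\<close>

lemma loglog_geometric:
  fixes q :: real assumes "0 < q" "q < 1" "n > 0"
  shows "exp (- \<theta> * ln (ln (1 / q ^ n))) = (real n * ln (1 / q)) powr (- \<theta>)"
  using assms by (simp add: powr_def ln_div ln_realpow)

lemma loglog_geometric_summable:
  fixes q :: real assumes q: "0 < q" "q < 1" and "\<theta> > 1"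
  shows "summable (\<lambda>n. exp (- \<theta> * ln (ln (1 / q ^ n))))"
proof (rule summable_comparison_test_ev)
  have c: "ln (1 / q) > 0" using q by simp
  show "\<forall>\<^sub>F n in sequentially. norm (exp (- \<theta> * ln (ln (1 / q ^ n)))) \<le> ln (1 / q) powr (- \<theta>) * real n powr (- \<theta>)"
    using eventually_gt_at_top[of 0]
  proof eventually_elim
    case (elim n)
    have "(real n * ln (1 / q)) powr (- \<theta>) = ln (1 / q) powr (- \<theta>) * real n powr (- \<theta>)"
      using c elim by (simp add: powr_mult mult.commute)
    then show ?case unfolding loglog_geometric[OF q elim] by simp
  qed
  show "summable (\<lambda>n. ln (1 / q) powr (- \<theta>) * real n powr (- \<theta>))"
    using assms by (intro summable_mult) (simp add: summable_real_powr_iff)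
qed

lemma loglog_geometric_not_summable:
  fixes q :: real assumes q: "0 < q" "q < 1"
  shows "\<not> summable (\<lambda>n. exp (- ln (ln (1 / q ^ n))))"
proof
  have c: "ln (1 / q) > 0" using q by simp
  assume "summable (\<lambda>n. exp (- ln (ln (1 / q ^ n))))"
  then have "summable (\<lambda>n. ln (1 / q) * exp (- ln (ln (1 / q ^ n))))" by (rule summable_mult)
  moreover have "\<forall>\<^sub>F n in sequentially. ln (1 / q) * exp (- ln (ln (1 / q ^ n))) = 1 / real n"
    using eventually_gt_at_top[of 0]
  proof eventually_elim
    case (elim n)
    show ?case using loglog_geometric[OF q elim, of 1] c elim by (simp add: powr_minus field_simps)
  qed
  ultimately have "summable (\<lambda>n. 1 / real n)" using summable_cong by fastforce
  then show False using not_summable_harmonic[where 'a = real] by (simp add: inverse_eq_divide)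
qed

context truncated_sequence
begin

text \<open>exp (t |x|) <= exp (t x) + exp (-t x) accounts for the factor 2; the bound of
  \<open>mgf_upper\<close> involves only absolute values and squares of the weights, so it is the
  same for both signs.\<close>

lemma mgf_abs_sum:
  assumes F: "finite F" and t: "t > 0" and m: "0 \<le> m" "t * m \<le> 1" "\<And>k. k \<in> F \<Longrightarrow> \<bar>w k\<bar> * sqrt (real k) \<le> m"
    and W: "(\<Sum>k\<in>F. (w k)\<^sup>2) \<le> W"
  shows "(\<integral>\<^sup>+\<omega>. ennreal (exp (t * \<bar>\<Sum>k\<in>F. w k * \<xi> k \<omega>\<bar>)) \<partial>M) \<le>
    ennreal (2 * exp (t * m * D + t\<^sup>2 * (1 + t * m) / 2 * v * W))"
proof -
  let ?B = "exp (t * m * D + t\<^sup>2 * (1 + t * m) / 2 * v * W)"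
  have mg: "expectation (\<lambda>\<omega>. exp (\<Sum>k\<in>F. (c * w k) * \<xi> k \<omega>)) \<le> ?B" if c: "\<bar>c\<bar> = t" for c
  proof -
    have "c\<^sup>2 = t\<^sup>2" using c power2_abs by metis
    then have "(\<Sum>k\<in>F. (c * w k)\<^sup>2) \<le> t\<^sup>2 * W"
      using mult_left_mono[OF W, of "t\<^sup>2"] by (simp add: power_mult_distrib sum_distrib_left)
    moreover have "\<bar>c * w k\<bar> * sqrt (real k) \<le> t * m" if "k \<in> F" for k
      using mult_left_mono[OF m(3)[OF that], of t] t c by (simp add: abs_mult mult.assoc)
    ultimately have "expectation (\<lambda>\<omega>. exp (\<Sum>k\<in>F. (c * w k) * \<xi> k \<omega>)) \<le>
        exp (t * m * D + (1 + t * m) / 2 * v * (t\<^sup>2 * W))"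
      using m t by (intro mgf_upper[OF F]) auto
    then show ?thesis by (simp add: mult_ac)
  qed
  have "(\<integral>\<^sup>+\<omega>. ennreal (exp (t * \<bar>\<Sum>k\<in>F. w k * \<xi> k \<omega>\<bar>)) \<partial>M) \<le>
      (\<integral>\<^sup>+\<omega>. ennreal (exp (\<Sum>k\<in>F. (t * w k) * \<xi> k \<omega>) + exp (\<Sum>k\<in>F. (- t * w k) * \<xi> k \<omega>)) \<partial>M)"
  proof (intro nn_integral_mono ennreal_leI)
    fix \<omega>
    have "(\<Sum>k\<in>F. (t * w k) * \<xi> k \<omega>) = t * (\<Sum>k\<in>F. w k * \<xi> k \<omega>)"
      "(\<Sum>k\<in>F. (- t * w k) * \<xi> k \<omega>) = - (t * (\<Sum>k\<in>F. w k * \<xi> k \<omega>))"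
      by (simp_all add: sum_distrib_left mult.assoc sum_negf)
    then show "exp (t * \<bar>\<Sum>k\<in>F. w k * \<xi> k \<omega>\<bar>) \<le> exp (\<Sum>k\<in>F. (t * w k) * \<xi> k \<omega>) + exp (\<Sum>k\<in>F. (- t * w k) * \<xi> k \<omega>)"
      by (cases "(\<Sum>k\<in>F. w k * \<xi> k \<omega>) \<ge> 0") (simp_all add: abs_real_def)
  qed
  also have "\<dots> = ennreal (expectation (\<lambda>\<omega>. exp (\<Sum>k\<in>F. (t * w k) * \<xi> k \<omega>) + exp (\<Sum>k\<in>F. (- t * w k) * \<xi> k \<omega>)))"
    by (intro nn_integral_eq_integral Bochner_Integration.integrable_add mgf_sum F) auto
  also have "expectation (\<lambda>\<omega>. exp (\<Sum>k\<in>F. (t * w k) * \<xi> k \<omega>) + exp (\<Sum>k\<in>F. (- t * w k) * \<xi> k \<omega>)) =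
      expectation (\<lambda>\<omega>. exp (\<Sum>k\<in>F. (t * w k) * \<xi> k \<omega>)) + expectation (\<lambda>\<omega>. exp (\<Sum>k\<in>F. (- t * w k) * \<xi> k \<omega>))"
    by (intro Bochner_Integration.integral_add mgf_sum F)
  also have "\<dots> \<le> 2 * ?B" using mg[of t] mg[of "-t"] t by simp
  finally show ?thesis by (simp add: ennreal_leI)
qed

text \<open>The integral is the average over the interval of b - a times the integrand, hence the
  factor b - a on the weights. Jensen moves the exponential inside the average and Fubini reduces to
  a fixed u, so the integral obeys the bound of a single sum.\<close>

lemma mgf_integral_sum:
  assumes ab: "a < b" and F: "finite F" and t: "t > 0" and m: "0 \<le> m" "t * m \<le> 1"
    and cont: "\<And>k. continuous_on {a..b} (\<lambda>u. w u k)" and [measurable]: "\<And>k. (\<lambda>u. w u k) \<in> borel_measurable borel"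
    and w: "\<And>u k. u \<in> {a..b} \<Longrightarrow> k \<in> F \<Longrightarrow> \<bar>(b - a) * w u k\<bar> * sqrt (real k) \<le> m"
    and W: "\<And>u. u \<in> {a..b} \<Longrightarrow> (\<Sum>k\<in>F. ((b - a) * w u k)\<^sup>2) \<le> W"
  shows "(\<integral>\<^sup>+\<omega>. ennreal (exp (t * (LINT u:{a..b}|lborel. \<bar>\<Sum>k\<in>F. w u k * \<xi> k \<omega>\<bar>))) \<partial>M) \<le>
    ennreal (2 * exp (t * m * D + t\<^sup>2 * (1 + t * m) / 2 * v * W))"
proof -
  define h where "h = b - a"
  have h: "h > 0" using ab by (simp add: h_def)
  let ?B = "ennreal (2 * exp (t * m * D + t\<^sup>2 * (1 + t * m) / 2 * v * W))"
  define f where "f u \<omega> = ennreal (exp (t * \<bar>\<Sum>k\<in>F. (h * w u k) * \<xi> k \<omega>\<bar>)) * indicator {a..b} u" for u \<omega>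
  have f [measurable]: "case_prod f \<in> borel_measurable (lborel \<Otimes>\<^sub>M M)"
    unfolding f_def by measurable
  interpret P: pair_sigma_finite lborel M ..
  have "(\<integral>\<^sup>+\<omega>. ennreal (exp (t * (LINT u:{a..b}|lborel. \<bar>\<Sum>k\<in>F. w u k * \<xi> k \<omega>\<bar>))) \<partial>M) \<le>
      (\<integral>\<^sup>+\<omega>. ennreal (1 / h) * (\<integral>\<^sup>+u. f u \<omega> \<partial>lborel) \<partial>M)"
  proof (rule nn_integral_mono)
    fix \<omega>
    define y where "y u = t * \<bar>\<Sum>k\<in>F. (h * w u k) * \<xi> k \<omega>\<bar>" for u
    have yeq: "y u = (t * h) * \<bar>\<Sum>k\<in>F. w u k * \<xi> k \<omega>\<bar>" for u
      using h by (simp add: y_def sum_distrib_left[symmetric] mult.assoc abs_mult)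
    have "(LINT u:{a..b}|lborel. y u) / (b - a) = t * (LINT u:{a..b}|lborel. \<bar>\<Sum>k\<in>F. w u k * \<xi> k \<omega>\<bar>)"
      unfolding yeq using h by (simp add: h_def[symmetric])
    moreover have "ennreal (exp ((LINT u:{a..b}|lborel. y u) / (b - a))) \<le>
        ennreal (1 / (b - a)) * (\<integral>\<^sup>+u. ennreal (exp (y u)) * indicator {a..b} u \<partial>lborel)"
      unfolding y_def by (intro exp_average_le[OF ab] continuous_intros cont)
    ultimately show "ennreal (exp (t * (LINT u:{a..b}|lborel. \<bar>\<Sum>k\<in>F. w u k * \<xi> k \<omega>\<bar>))) \<le>
        ennreal (1 / h) * (\<integral>\<^sup>+u. f u \<omega> \<partial>lborel)"
      by (simp add: f_def y_def h_def)
  qed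
  also have "\<dots> = ennreal (1 / h) * (\<integral>\<^sup>+\<omega>. (\<integral>\<^sup>+u. f u \<omega> \<partial>lborel) \<partial>M)"
    by (rule nn_integral_cmult) measurable
  also have "(\<integral>\<^sup>+\<omega>. (\<integral>\<^sup>+u. f u \<omega> \<partial>lborel) \<partial>M) = (\<integral>\<^sup>+u. (\<integral>\<^sup>+\<omega>. f u \<omega> \<partial>M) \<partial>lborel)"
    by (rule P.Fubini'[OF f])
  also have "\<dots> \<le> (\<integral>\<^sup>+u. ?B * indicator {a..b} u \<partial>lborel)"
  proof (rule nn_integral_mono)
    fix u
    show "(\<integral>\<^sup>+\<omega>. f u \<omega> \<partial>M) \<le> ?B * indicator {a..b} u"
    proof (cases "u \<in> {a..b}")
      case True
      then show ?thesis using mgf_abs_sum[OF F t m(1,2), of "\<lambda>k. h * w u k" W] w[of u] W[of u]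
        by (simp add: f_def h_def)
    qed (simp add: f_def)
  qed
  also have "\<dots> = ?B * ennreal h" using ab by (simp add: nn_integral_cmult_indicator h_def)
  finally have "(\<integral>\<^sup>+\<omega>. ennreal (exp (t * (LINT u:{a..b}|lborel. \<bar>\<Sum>k\<in>F. w u k * \<xi> k \<omega>\<bar>))) \<partial>M) \<le> ennreal (1 / h) * (?B * ennreal h)"
    by (simp add: mult_left_mono)
  also have "\<dots> = ?B" using h by (simp add: ennreal_mult'[symmetric])
  finally show ?thesis .
qed

text \<open>For k < n the weight at 0 is at most n^e times the weight at e, so the sum up to n has
  variance O(n^(2e)) and summands O(n^e). A tilt of order n^(-e) keeps the generating function
  bounded, and the threshold n^(2e) yields the summable bound exp (-n^e / C). This gives convergence
  and continuity for all s > 0 outside a single null set.\<close>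

lemma AE_partial_sums:
  assumes a: "\<alpha> > -1/2"
  shows "AE \<omega> in M. \<forall>j::nat. \<exists>C. \<forall>n. \<bar>\<Sum>k<n. dweight \<alpha> 0 k * \<xi> k \<omega>\<bar> \<le> C * real n powr (1 / real (Suc j))"
  unfolding AE_all_countable
proof
  fix j :: nat
  \<comment> \<open>Half of the target exponent, as the threshold below is n^(2e).\<close>
  define e where "e = 1 / real (Suc j) / 2"
  have e: "e > 0" by (simp add: e_def)
  obtain C0 where C0: "C0 > 0" "\<And>s k. 0 < s \<Longrightarrow> dweight \<alpha> s k * sqrt (real k) \<le> C0 * s powr (- max \<alpha> 0)"
    using dweight_bound[of \<alpha>] by blast
  define C where "C = C0 * e powr (- max \<alpha> 0)"
  have C: "C > 0" using C0 e by (simp add: C_def)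
  define t where "t n = 1 / (C * real n powr e)" for n :: nat
  define B where "B = 2 * exp (D + v * (dvar \<alpha> e / C\<^sup>2))"
  have wle: "dweight \<alpha> 0 k \<le> real n powr e * dweight \<alpha> e k" if "k < n" for k n
  proof (cases "k = 0")
    case False
    have "dweight \<alpha> 0 k = dweight \<alpha> e k * real k powr e" using dweight_shift[of \<alpha> 0 e k] False
      by (simp add: powr_minus)
    also have "\<dots> \<le> dweight \<alpha> e k * real n powr e" using that e False by (intro mult_left_mono powr_mono2) auto
    finally show ?thesis by (simp add: mult.commute)
  qed simp
  \<comment> \<open>The index \<open>N\<close> is a dummy here, the sums being finite
    already.\<close>
  have "AE \<omega> in M. \<forall>\<^sub>F n in sequentially. \<exists>\<^sub>F N::nat in sequentially. \<bar>\<Sum>k<n. dweight \<alpha> 0 k * \<xi> k \<omega>\<bar> < real n powr (2 * e)"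
  proof (rule AE_eventually_frequently_less[where l = t and C = "\<lambda>_. B"])
    show "\<forall>\<^sub>F n in sequentially. 0 < t n \<and> 0 \<le> B \<and>
        (\<forall>N. (\<integral>\<^sup>+\<omega>. ennreal (exp (t n * \<bar>\<Sum>k<n. dweight \<alpha> 0 k * \<xi> k \<omega>\<bar>)) \<partial>M) \<le> ennreal B)"
      using eventually_gt_at_top[of 0]
    proof eventually_elim
      case (elim n)
      define m where "m = C * real n powr e"
      have m: "m > 0" using C elim by (simp add: m_def)
      have tm: "t n * m = 1" using C elim by (simp add: t_def m_def)
      have "(\<integral>\<^sup>+\<omega>. ennreal (exp (t n * \<bar>\<Sum>k<n. dweight \<alpha> 0 k * \<xi> k \<omega>\<bar>)) \<partial>M) \<le>
          ennreal (2 * exp (t n * m * D + (t n)\<^sup>2 * (1 + t n * m) / 2 * v * ((real n powr e)\<^sup>2 * dvar \<alpha> e)))"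
      proof (rule mgf_abs_sum)
        show "\<bar>dweight \<alpha> 0 k\<bar> * sqrt (real k) \<le> m" if "k \<in> {..<n}" for k
        proof -
          have "dweight \<alpha> 0 k * sqrt (real k) \<le> real n powr e * dweight \<alpha> e k * sqrt (real k)"
            using wle[of k n] that by (intro mult_right_mono) auto
          also have "\<dots> \<le> real n powr e * C"
            using C0(2)[OF e, of k] by (simp add: C_def mult.assoc mult_left_mono)
          finally show ?thesis by (simp add: m_def mult.commute)
        qed
        have "(\<Sum>k<n. (dweight \<alpha> 0 k)\<^sup>2) \<le> (\<Sum>k<n. (real n powr e)\<^sup>2 * (dweight \<alpha> e k)\<^sup>2)"
          unfolding power_mult_distrib[symmetric] by (intro sum_mono power_mono wle) auto
        also have "\<dots> \<le> (real n powr e)\<^sup>2 * dvar \<alpha> e"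
          unfolding sum_distrib_left[symmetric] by (intro mult_left_mono sum_dweight_sq_le a e) auto
        finally show "(\<Sum>k<n. (dweight \<alpha> 0 k)\<^sup>2) \<le> (real n powr e)\<^sup>2 * dvar \<alpha> e" .
      qed (use m tm C elim in \<open>auto simp: t_def\<close>)
      also have "(t n)\<^sup>2 * (1 + t n * m) / 2 * v * ((real n powr e)\<^sup>2 * dvar \<alpha> e) = v * (dvar \<alpha> e / C\<^sup>2)"
        unfolding tm using C elim by (simp add: t_def power_divide power_mult_distrib)
      finally have "(\<integral>\<^sup>+\<omega>. ennreal (exp (t n * \<bar>\<Sum>k<n. dweight \<alpha> 0 k * \<xi> k \<omega>\<bar>)) \<partial>M) \<le> ennreal B"
        by (simp add: B_def tm)
      then show ?case using C elim by (simp add: t_def B_def)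
    qed
    have "summable (\<lambda>n. exp (- (real n powr e / C)))"
    proof (rule summable_comparison_test_ev)
      have "\<forall>\<^sub>F n::nat in sequentially. exp (- (real n powr e / C)) \<le> real n powr (-2)"
        using e C by real_asymp
      then show "\<forall>\<^sub>F n::nat in sequentially. norm (exp (- (real n powr e / C))) \<le> real n powr (-2)" by simp
    qed (simp add: summable_real_powr_iff)
    then have "summable (\<lambda>n. B * exp (- (real n powr e / C)))" by (rule summable_mult)
    moreover have "t n * real n powr (2 * e) = real n powr e / C" for n
    proof (cases "n = 0")
      case False
      have "real n powr (2 * e) = real n powr e * real n powr e" by (simp add: powr_add[symmetric])
      then show ?thesis using False by (simp add: t_def)
    qed (simp add: t_def)
    ultimately show "summable (\<lambda>n. B * exp (- (t n * real n powr (2 * e))))" by simp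
  qed simp
  then show "AE \<omega> in M. \<exists>C. \<forall>n. \<bar>\<Sum>k<n. dweight \<alpha> 0 k * \<xi> k \<omega>\<bar> \<le> C * real n powr (1 / real (Suc j))"
  proof eventually_elim
    case (elim \<omega>)
    let ?T = "\<lambda>n. \<bar>\<Sum>k<n. dweight \<alpha> 0 k * \<xi> k \<omega>\<bar>"
    obtain n0 where n0: "\<And>n. n \<ge> n0 \<Longrightarrow> ?T n < real n powr (2 * e)"
      using elim by (auto simp: eventually_sequentially)
    show ?case
    proof (intro exI[of _ "1 + (\<Sum>n<n0. ?T n)"] allI)
      fix n
      have e2: "1 / real (Suc j) = 2 * e" by (simp add: e_def del: of_nat_Suc)
      show "?T n \<le> (1 + (\<Sum>n<n0. ?T n)) * real n powr (1 / real (Suc j))"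
      proof (cases "n = 0")
        case False
        then have n1: "real n powr (2 * e) \<ge> 1" using e by (simp add: ge_one_powr_ge_zero)
        have S: "0 \<le> (\<Sum>n<n0. ?T n)" by (simp add: sum_nonneg)
        show ?thesis
        proof (cases "n < n0")
          case True
          then have "?T n \<le> (\<Sum>n<n0. ?T n)" by (intro member_le_sum) auto
          then have "?T n \<le> (1 + (\<Sum>n<n0. ?T n)) * 1" by simp
          also have "\<dots> \<le> (1 + (\<Sum>n<n0. ?T n)) * real n powr (2 * e)" using n1 S by (intro mult_left_mono) auto
          finally show ?thesis by (simp only: e2)
        next
          case False
          have "?T n \<le> 1 * real n powr (2 * e)" using n0[of n] False by simp
          also have "\<dots> \<le> (1 + (\<Sum>n<n0. ?T n)) * real n powr (2 * e)" using S by (intro mult_right_mono) auto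
          finally show ?thesis by (simp only: e2)
        qed
      qed simp
    qed
  qed
qed

end

section \<open>Deviations along a geometric grid\<close>

lemma geometric_bracket:
  fixes q s :: real
  assumes q: "0 < q" "q < 1" and s: "0 < s" "s \<le> q ^ n0"
  obtains n where "n \<ge> n0" "q ^ Suc n \<le> s" "s \<le> q ^ n"
proof -
  obtain N where N: "q ^ N < s" using real_arch_pow_inv[OF s(1) q(2)] by blast
  define n where "n = (LEAST n. q ^ Suc n < s)"
  have "q * q ^ N \<le> q ^ N" using q by (intro mult_left_le_one_le) auto
  then have ex: "q ^ Suc N < s" using N by simp
  have 1: "q ^ Suc n < s" unfolding n_def by (rule LeastI[of "\<lambda>n. q ^ Suc n < s", OF ex])
  have 2: "n \<ge> n0"
  proof (rule ccontr)
    assume "\<not> n \<ge> n0"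
    then have "q ^ n0 \<le> q ^ Suc n" using q by (intro power_decreasing) auto
    then show False using 1 s by simp
  qed
  have 3: "s \<le> q ^ n"
  proof (cases "n = 0")
    case True then show ?thesis using 2 s by simp
  next
    case False
    then obtain n' where n': "n = Suc n'" by (cases n) auto
    then have "\<not> q ^ Suc n' < s" using not_less_Least[of n' "\<lambda>n. q ^ Suc n < s"] by (simp add: n_def)
    then show ?thesis by (simp add: n')
  qed
  show ?thesis using that[of n] 1 2 3 by simp
qed

text \<open>By independence and 1 - p <= exp (-p), the event that no index from \<open>n0\<close> on
  succeeds has probability at most the exponential of minus any partial sum of the
  \<open>p n\<close>. If it had positive probability, those partial sums would be bounded.\<close>

lemma (in prob_space) AE_frequently_ge_of_not_summable:
  fixes Y :: "nat \<Rightarrow> 'a \<Rightarrow> real"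
  assumes ind: "indep_vars (\<lambda>_. borel) Y UNIV"
    and ns: "\<not> summable (\<lambda>n. prob {\<omega>\<in>space M. y n \<le> Y n \<omega>})"
  shows "AE \<omega> in M. \<exists>\<^sub>F n in sequentially. y n \<le> Y n \<omega>"
proof -
  have [measurable]: "Y n \<in> borel_measurable M" for n using ind by (auto simp: indep_vars_def)
  define p where "p n = prob {\<omega>\<in>space M. y n \<le> Y n \<omega>}" for n
  have p0: "0 \<le> p n" for n by (simp add: p_def)
  have compl: "prob {\<omega>\<in>space M. Y n \<omega> < y n} = 1 - p n" for n
  proof -
    have "{\<omega>\<in>space M. Y n \<omega> < y n} = space M - {\<omega>\<in>space M. y n \<le> Y n \<omega>}" by auto
    then show ?thesis unfolding p_def by (simp add: prob_compl)
  qed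
  have "AE \<omega> in M. \<not> (\<forall>n\<ge>n0. Y n \<omega> < y n)" for n0
  proof -
    define B where "B = {\<omega>\<in>space M. \<forall>n\<ge>n0. Y n \<omega> < y n}"
    have [measurable]: "B \<in> sets M" unfolding B_def by measurable
    have le: "prob B \<le> exp (- (\<Sum>n=n0..<n0 + Suc N. p n))" for N
    proof -
      let ?J = "{n0..<n0 + Suc N}"
      have "prob B \<le> prob (\<Inter>n\<in>?J. Y n -` {..<y n} \<inter> space M)"
        by (intro finite_measure_mono) (auto simp: B_def intro!: sets.finite_INT)
      also have "\<dots> = (\<Prod>n\<in>?J. prob (Y n -` {..<y n} \<inter> space M))"
        by (rule indep_varsD[OF ind]) auto
      also have "\<dots> = (\<Prod>n\<in>?J. 1 - p n)"
        by (intro prod.cong refl) (auto simp: compl[symmetric] intro!: arg_cong[where f = prob])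
      also have "\<dots> \<le> (\<Prod>n\<in>?J. exp (- p n))"
      proof (rule prod_mono)
        fix n show "0 \<le> 1 - p n \<and> 1 - p n \<le> exp (- p n)"
          using exp_ge_add_one_self[of "- p n"] by (simp add: p_def prob_le_1)
      qed
      finally show ?thesis by (simp only: exp_sum[OF finite_atLeastLessThan, symmetric] sum_negf)
    qed
    have "prob B \<le> 0"
    proof (rule ccontr)
      assume "\<not> prob B \<le> 0"
      then have B: "prob B > 0" by simp
      have "(\<Sum>n=n0..<n0 + Suc N. p n) \<le> - ln (prob B)" for N
        using le[of N] B by (metis exp_le_cancel_iff exp_ln minus_le_iff le_minus_iff)
      then have bd: "sum p {n0..<n0 + Suc N} \<le> - ln (prob B)" for N by simp
      have "summable (\<lambda>n. p (n + n0))"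
      proof (rule bounded_imp_summable)
        show "0 \<le> p (n + n0)" for n by (rule p0)
        show "(\<Sum>k\<le>n. p (k + n0)) \<le> - ln (prob B)" for n
        proof -
          have "(\<Sum>k\<le>n. p (k + n0)) = sum p {n0..<n0 + Suc n}"
            by (rule sum.reindex_bij_witness[of _ "\<lambda>k. k - n0" "\<lambda>k. k + n0"]) auto
          then show ?thesis using bd by simp
        qed
      qed
      then have "summable p" by (simp add: summable_iff_shift)
      then show False using ns by (simp add: p_def[abs_def])
    qed
    then have "prob B = 0" using measure_nonneg[of M B] by linarith
    then have "AE \<omega> in M. \<omega> \<notin> B"
      by (subst AE_iff_measurable[of B]) (auto simp: emeasure_eq_measure B_def)
    then show ?thesis by (rule AE_mp) (auto simp: B_def intro!: AE_I2)
  qed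
  then have "AE \<omega> in M. \<forall>n0. \<not> (\<forall>n\<ge>n0. Y n \<omega> < y n)" by (simp add: AE_all_countable)
  then show ?thesis
    by eventually_elim (auto simp: frequently_def eventually_sequentially not_le)
qed

text \<open>Under the exponentially tilted law the mass concentrates near \<open>l * U\<close>: the part of the moment
  generating function carried by the two tails is killed by tilting a little more, respectively less.\<close>

lemma (in prob_space) tilted_lower_bound:
  fixes Y :: "'a \<Rightarrow> real" and l U \<epsilon> \<delta> :: real
  assumes [measurable]: "Y \<in> borel_measurable M" and int: "\<And>t. integrable M (\<lambda>\<omega>. exp (t * Y \<omega>))"
    and l: "l > 0" and U: "U > 0" and e: "0 < \<epsilon>" "\<epsilon> \<le> 1" and d: "0 \<le> \<delta>" "10 * \<delta> \<le> \<epsilon>\<^sup>2"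
    and Q: "Q = l\<^sup>2 * U" "Q * \<epsilon>\<^sup>2 \<ge> 8"
    and lower: "expectation (\<lambda>\<omega>. exp (l * Y \<omega>)) \<ge> exp (Q / 2 * (1 - \<delta>))"
    and upper: "expectation (\<lambda>\<omega>. exp (l * (1 + \<epsilon>) * Y \<omega>)) \<le> exp (Q / 2 * (1 + \<epsilon>)\<^sup>2 * (1 + \<delta>))"
      "expectation (\<lambda>\<omega>. exp (l * (1 - \<epsilon>) * Y \<omega>)) \<le> exp (Q / 2 * (1 - \<epsilon>)\<^sup>2 * (1 + \<delta>))"
  shows "prob {\<omega>\<in>space M. (1 - \<epsilon>) * l * U \<le> Y \<omega>} \<ge> exp (- Q / 2 * (1 + 2 * \<epsilon> + \<delta>)) / 2"
proof -
  define a where "a = (1 - \<epsilon>) * l * U"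
  define b where "b = (1 + \<epsilon>) * l * U"
  define A where "A = {\<omega>\<in>space M. a \<le> Y \<omega>}"
  have [measurable]: "A \<in> sets M" unfolding A_def by measurable
  have Q0: "Q > 0" using l U by (simp add: Q)
  have la: "l * a = (1 - \<epsilon>) * Q" and lb: "l * b = (1 + \<epsilon>) * Q"
    by (simp_all add: a_def b_def Q power2_eq_square)
  \<comment> \<open>One summand dominates in each region: the first for Y between a and b, the
    second, with the larger tilt, for Y > b, the third, with the smaller tilt, for Y < a.\<close>
  let ?g = "\<lambda>\<omega>. exp (l * b) * indicator A \<omega> + exp (- (l * \<epsilon> * b)) * exp (l * (1 + \<epsilon>) * Y \<omega>)
      + exp (l * \<epsilon> * a) * exp (l * (1 - \<epsilon>) * Y \<omega>)"
  have "expectation (\<lambda>\<omega>. exp (l * Y \<omega>)) \<le> expectation ?g"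
  proof (rule integral_mono)
    fix \<omega> assume w: "\<omega> \<in> space M"
    have le: "0 < l * \<epsilon>" using l e by simp
    consider "Y \<omega> > b" | "Y \<omega> < a" | "a \<le> Y \<omega>" "Y \<omega> \<le> b" by linarith
    then show "exp (l * Y \<omega>) \<le> ?g \<omega>"
    proof cases
      case 1
      then have "l * Y \<omega> \<le> - (l * \<epsilon> * b) + l * (1 + \<epsilon>) * Y \<omega>"
        using mult_left_mono[of b "Y \<omega>" "l * \<epsilon>"] le by (simp add: algebra_simps)
      then have "exp (l * Y \<omega>) \<le> exp (- (l * \<epsilon> * b)) * exp (l * (1 + \<epsilon>) * Y \<omega>)"
        by (simp only: exp_add[symmetric] exp_le_cancel_iff)
      then show ?thesis by (simp add: add_increasing add_increasing2)
    next
      case 2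
      then have "l * Y \<omega> \<le> l * \<epsilon> * a + l * (1 - \<epsilon>) * Y \<omega>"
        using mult_left_mono[of "Y \<omega>" a "l * \<epsilon>"] le by (simp add: algebra_simps)
      then have "exp (l * Y \<omega>) \<le> exp (l * \<epsilon> * a) * exp (l * (1 - \<epsilon>) * Y \<omega>)"
        by (simp only: exp_add[symmetric] exp_le_cancel_iff)
      then show ?thesis by (simp add: add_increasing)
    next
      case 3
      then have "exp (l * Y \<omega>) \<le> exp (l * b) * indicator A \<omega>" using w l by (simp add: A_def)
      then show ?thesis by (simp add: add_increasing2)
    qed
  next
    show "integrable M ?g"
      by (intro Bochner_Integration.integrable_add integrable_mult_right int integrable_real_indicator)
         (auto simp: emeasure_eq_measure)
  qed (use int[of l] in simp)
  also have "expectation ?g = exp (l * b) * prob A + exp (- (l * \<epsilon> * b)) * expectation (\<lambda>\<omega>. exp (l * (1 + \<epsilon>) * Y \<omega>))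
      + exp (l * \<epsilon> * a) * expectation (\<lambda>\<omega>. exp (l * (1 - \<epsilon>) * Y \<omega>))"
  proof -
    have iA: "integrable M (\<lambda>\<omega>. exp (l * b) * indicator A \<omega> :: real)"
      by (intro integrable_mult_right integrable_real_indicator) (auto simp: emeasure_eq_measure)
    have "A \<inter> space M = A" by (auto simp: A_def)
    then show ?thesis
      using iA int by (simp add: Bochner_Integration.integral_add)
  qed
  \<comment> \<open>The identities -\<epsilon>(1 + \<epsilon>) + (1 + \<epsilon>)^2 / 2 = (1 -
    \<epsilon>^2) / 2 and \<epsilon>(1 - \<epsilon>) + (1 - \<epsilon>)^2 / 2 = (1 - \<epsilon>^2) /
    2 show that, apart from \<delta>, both tails lose the factor exp (-Q \<epsilon>^2 / 2) against
    exp (Q / 2).\<close>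
  also have "\<dots> \<le> exp (l * b) * prob A + exp (Q / 2 * (1 - \<epsilon>\<^sup>2 + 4 * \<delta>)) + exp (Q / 2 * (1 - \<epsilon>\<^sup>2 + 4 * \<delta>))"
  proof (intro add_mono order_refl)
    have e4: "(1 + \<epsilon>)\<^sup>2 \<le> 4" "(1 - \<epsilon>)\<^sup>2 \<le> 4" using power_mono[of "1 + \<epsilon>" 2 2] power_mono[of "1 - \<epsilon>" 2 2] e by auto
    have "exp (- (l * \<epsilon> * b)) * expectation (\<lambda>\<omega>. exp (l * (1 + \<epsilon>) * Y \<omega>)) \<le>
        exp (- (l * \<epsilon> * b)) * exp (Q / 2 * (1 + \<epsilon>)\<^sup>2 * (1 + \<delta>))"
      by (rule mult_left_mono[OF upper(1)]) simp
    also have "\<dots> = exp (Q / 2 * (1 - \<epsilon>\<^sup>2 + (1 + \<epsilon>)\<^sup>2 * \<delta>))"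
    proof -
      have "l * \<epsilon> * b = \<epsilon> * (1 + \<epsilon>) * Q" using lb by (metis mult.assoc mult.commute)
      then have "- (l * \<epsilon> * b) + Q / 2 * (1 + \<epsilon>)\<^sup>2 * (1 + \<delta>) = Q / 2 * (1 - \<epsilon>\<^sup>2 + (1 + \<epsilon>)\<^sup>2 * \<delta>)"
        by (simp add: field_simps power2_eq_square)
      then show ?thesis by (simp only: exp_add[symmetric])
    qed
    also have "\<dots> \<le> exp (Q / 2 * (1 - \<epsilon>\<^sup>2 + 4 * \<delta>))"
      using Q0 e4 d by (auto intro!: mult_left_mono mult_right_mono)
    finally show "exp (- (l * \<epsilon> * b)) * expectation (\<lambda>\<omega>. exp (l * (1 + \<epsilon>) * Y \<omega>)) \<le> exp (Q / 2 * (1 - \<epsilon>\<^sup>2 + 4 * \<delta>))" .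
    have "exp (l * \<epsilon> * a) * expectation (\<lambda>\<omega>. exp (l * (1 - \<epsilon>) * Y \<omega>)) \<le>
        exp (l * \<epsilon> * a) * exp (Q / 2 * (1 - \<epsilon>)\<^sup>2 * (1 + \<delta>))"
      by (rule mult_left_mono[OF upper(2)]) simp
    also have "\<dots> = exp (Q / 2 * (1 - \<epsilon>\<^sup>2 + (1 - \<epsilon>)\<^sup>2 * \<delta>))"
    proof -
      have "l * \<epsilon> * a = \<epsilon> * (1 - \<epsilon>) * Q" using la by (metis mult.assoc mult.commute)
      then have "l * \<epsilon> * a + Q / 2 * (1 - \<epsilon>)\<^sup>2 * (1 + \<delta>) = Q / 2 * (1 - \<epsilon>\<^sup>2 + (1 - \<epsilon>)\<^sup>2 * \<delta>)"
        by (simp add: field_simps power2_eq_square)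
      then show ?thesis by (simp only: exp_add[symmetric])
    qed
    also have "\<dots> \<le> exp (Q / 2 * (1 - \<epsilon>\<^sup>2 + 4 * \<delta>))"
      using Q0 e4 d by (auto intro!: mult_left_mono mult_right_mono)
    finally show "exp (l * \<epsilon> * a) * expectation (\<lambda>\<omega>. exp (l * (1 - \<epsilon>) * Y \<omega>)) \<le> exp (Q / 2 * (1 - \<epsilon>\<^sup>2 + 4 * \<delta>))" .
  qed
  finally have main: "exp (Q / 2 * (1 - \<delta>)) \<le> exp (l * b) * prob A + 2 * exp (Q / 2 * (1 - \<epsilon>\<^sup>2 + 4 * \<delta>))"
    using lower by simp
  \<comment> \<open>The gap between the exponents is Q/2 * (\<epsilon>^2 - 5 \<delta>) >= Q
    \<epsilon>^2 / 4 >= 2, and exp 2 >= 4. So the two tails together carry at most half of the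
    generating function.\<close>
  have "4 * exp (Q / 2 * (1 - \<epsilon>\<^sup>2 + 4 * \<delta>)) \<le> exp (Q / 2 * (1 - \<delta>))"
  proof -
    have "Q * (10 * \<delta>) \<le> Q * \<epsilon>\<^sup>2" using Q0 d by (intro mult_left_mono) auto
    then have 2: "2 + Q / 2 * (1 - \<epsilon>\<^sup>2 + 4 * \<delta>) \<le> Q / 2 * (1 - \<delta>)"
      using Q(2) by (simp add: algebra_simps)
    have "(4::real) \<le> exp 1 * exp 1" using mult_mono[of 2 "exp 1" 2 "exp (1::real)"] exp_ge_add_one_self[of 1] by simp
    then have "(4::real) \<le> exp 2" by (simp add: exp_add[symmetric])
    then have "4 * exp (Q / 2 * (1 - \<epsilon>\<^sup>2 + 4 * \<delta>)) \<le> exp 2 * exp (Q / 2 * (1 - \<epsilon>\<^sup>2 + 4 * \<delta>))" by simp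
    also have "\<dots> = exp (2 + Q / 2 * (1 - \<epsilon>\<^sup>2 + 4 * \<delta>))" by (simp only: exp_add)
    also have "\<dots> \<le> exp (Q / 2 * (1 - \<delta>))" using 2 by (simp only: exp_le_cancel_iff)
    finally show ?thesis .
  qed
  with main have "exp (Q / 2 * (1 - \<delta>)) / 2 \<le> exp (l * b) * prob A" by simp
  then have "exp (- (l * b)) * (exp (Q / 2 * (1 - \<delta>)) / 2) \<le> exp (- (l * b)) * (exp (l * b) * prob A)"
    by (intro mult_left_mono) auto
  also have "\<dots> = prob A" by (simp add: mult.assoc[symmetric] exp_add[symmetric])
  also have "exp (- (l * b)) * (exp (Q / 2 * (1 - \<delta>)) / 2) = exp (- (l * b) + Q / 2 * (1 - \<delta>)) / 2"
    by (simp only: exp_add times_divide_eq_right)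
  also have "- (l * b) + Q / 2 * (1 - \<delta>) = - Q / 2 * (1 + 2 * \<epsilon> + \<delta>)"
    unfolding lb by (simp add: field_simps)
  finally show ?thesis by (simp add: A_def a_def)
qed

context truncated_sequence
begin

definition lil_const :: "real \<Rightarrow> real" where
  "lil_const \<alpha> = sqrt (v * Gamma (1 + 2 * \<alpha>) / 2 powr (2 * \<alpha>))"

lemma lil_const_pos: "\<alpha> > -1/2 \<Longrightarrow> lil_const \<alpha> > 0"
  unfolding lil_const_def using v_pos Gamma_real_pos[of "1 + 2 * \<alpha>"] by simp

text \<open>The quotient of Gamma by \<open>2 powr (1 + 2 * \<alpha>)\<close> is the limit of the
  normalised \<open>dvar\<close>. So this is the factor "twice the variance" of the law of the
  iterated logarithm, with one power of 2 cancelled.\<close>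

lemma lil_const_sq:
  assumes "\<alpha> > -1/2"
  shows "(lil_const \<alpha>)\<^sup>2 = 2 * v * (Gamma (1 + 2 * \<alpha>) / 2 powr (1 + 2 * \<alpha>))"
proof -
  have "v * Gamma (1 + 2 * \<alpha>) / 2 powr (2 * \<alpha>) \<ge> 0" using v_pos Gamma_real_pos[of "1 + 2 * \<alpha>"] assms by simp
  then show ?thesis unfolding lil_const_def by (simp add: powr_add)
qed

text \<open>Common form of three estimates: the series at grid points, the integral of its
  derivative over a cell, and the terms outside a block. \<open>W\<close> is the respective bound on
  the sum of squared weights, and 2 v w < K^2 compares its limiting size with the threshold.\<close>

lemma grid_deviation:
  fixes G :: "nat \<Rightarrow> nat \<Rightarrow> 'a \<Rightarrow> real" and W :: "real \<Rightarrow> real"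
  assumes a: "\<alpha> > -1/2" and q: "0 < q" "q < 1" and meas: "\<And>n N. G n N \<in> borel_measurable M"
    and W: "((\<lambda>s. s powr (1 + 2 * \<alpha>) * W s) \<longlongrightarrow> w) (at_right 0)" and w: "0 \<le> w" "2 * v * w < K\<^sup>2"
    and K: "K > 0" and C: "C \<ge> 0"
    and mgf: "\<And>n t N. t > 0 \<Longrightarrow> t * (C * (q ^ n) powr (- max \<alpha> 0)) \<le> 1 \<Longrightarrow>
      (\<integral>\<^sup>+\<omega>. ennreal (exp (t * G n N \<omega>)) \<partial>M) \<le>
        ennreal (2 * exp (t * (C * (q ^ n) powr (- max \<alpha> 0)) * D + t\<^sup>2 * (1 + t * (C * (q ^ n) powr (- max \<alpha> 0))) / 2 * v * W (q ^ n)))"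
  shows "AE \<omega> in M. \<forall>\<^sub>F n in sequentially. \<exists>\<^sub>F N in sequentially. G n N \<omega> < K * lil_scale \<alpha> (q ^ n)"
proof -
  note qlim = geometric_at_right_0[OF q]
  define r where "r = (2 * v * w + K\<^sup>2) / 2"
  have r: "0 \<le> r" "2 * v * w < r" "r < K\<^sup>2" using w v_pos by (auto simp: r_def)
  have llim: "filterlim (\<lambda>n. ln (ln (1 / q ^ n))) at_top sequentially"
    by (rule filterlim_compose[OF loglog_at_top qlim])
  show ?thesis
  proof (rule AE_eventually_less_of_gaussian_mgf[where l = "\<lambda>n. ln (ln (1 / q ^ n))" and r = r and D = D and v = v
        and W = "\<lambda>n. W (q ^ n)" and m = "\<lambda>n. C * (q ^ n) powr (- max \<alpha> 0)"])
    show "\<forall>\<^sub>F n in sequentially. lil_scale \<alpha> (q ^ n) > 0"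
      using eventually_compose_filterlim[OF lil_scale_pos qlim] .
    show "(\<lambda>n. C * (q ^ n) powr (- max \<alpha> 0) * ln (ln (1 / q ^ n)) / lil_scale \<alpha> (q ^ n)) \<longlonglongrightarrow> 0"
      using tendsto_mult[OF tendsto_const filterlim_compose[OF lil_scale_tilt_negligible[OF a] qlim], of C]
      by (simp add: mult.assoc)
    have "((\<lambda>s. 2 * v * (s powr (1 + 2 * \<alpha>) * W s)) \<longlongrightarrow> 2 * v * w) (at_right 0)"
      by (intro tendsto_intros W)
    then have "\<forall>\<^sub>F s in at_right 0. 2 * v * (s powr (1 + 2 * \<alpha>) * W s) < r" using r by (intro order_tendstoD)
    then have "\<forall>\<^sub>F n in sequentially. 2 * v * ((q ^ n) powr (1 + 2 * \<alpha>) * W (q ^ n)) < r"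
      by (rule eventually_compose_filterlim[OF _ qlim])
    moreover have "\<forall>\<^sub>F n in sequentially. ln (ln (1 / q ^ n)) > 0" using llim by (simp add: filterlim_at_top_dense)
    ultimately show "\<forall>\<^sub>F n in sequentially. 2 * v * W (q ^ n) * ln (ln (1 / q ^ n)) / (lil_scale \<alpha> (q ^ n))\<^sup>2 \<le> r"
    proof eventually_elim
      case (elim n)
      have "(lil_scale \<alpha> (q ^ n))\<^sup>2 = ln (ln (1 / q ^ n)) / (q ^ n) powr (1 + 2 * \<alpha>)"
        using q elim by (intro lil_scale_sq) auto
      then show ?case using elim q by (simp add: mult_ac)
    qed
  qed (use meas r K llim loglog_geometric_summable[OF q] C mgf q in \<open>auto intro!: always_eventually\<close>)
qed

end

section \<open>Upper bound\<close>

lemma continuous_on_dweight [continuous_intros]: "continuous_on A (\<lambda>s. dweight \<alpha> s k)"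
  by (intro continuous_at_imp_continuous_on ballI DERIV_isCont[OF dweight_has_derivative])

lemma borel_measurable_dweight [measurable]: "(\<lambda>s. dweight \<alpha> s k) \<in> borel_measurable borel"
  by (rule borel_measurable_continuous_onI) (rule continuous_on_dweight)

text \<open>The right side integrates over the whole cell and is independent of s, so one random
  variable per cell controls every s in it. For finite sums differentiation is termwise; the series
  is reached afterwards by a limit.\<close>

lemma dweight_sum_increment:
  fixes x :: "nat \<Rightarrow> real"
  assumes s: "a \<le> s" "s \<le> b" and F: "finite F"
  shows "\<bar>(\<Sum>k\<in>F. dweight \<alpha> b k * x k) - (\<Sum>k\<in>F. dweight \<alpha> s k * x k)\<bar> \<le>
    (LINT u:{a..b}|lborel. \<bar>\<Sum>k\<in>F. dweight (\<alpha> + 1) u k * x k\<bar>)"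
proof -
  let ?Z = "\<lambda>u. \<Sum>k\<in>F. dweight (\<alpha> + 1) u k * x k"
  have c: "continuous_on A (\<lambda>u. \<bar>?Z u\<bar>)" "continuous_on A (\<lambda>u. - ?Z u)" for A by (intro continuous_intros)+
  have "((\<lambda>u. - ?Z u) has_integral ((\<Sum>k\<in>F. dweight \<alpha> b k * x k) - (\<Sum>k\<in>F. dweight \<alpha> s k * x k))) {s..b}"
  proof (rule fundamental_theorem_of_calculus[OF s(2)])
    fix u
    have "((\<lambda>u. \<Sum>k\<in>F. dweight \<alpha> u k * x k) has_real_derivative (\<Sum>k\<in>F. - dweight (\<alpha> + 1) u k * x k)) (at u)"
      by (intro DERIV_sum DERIV_cmult_right dweight_has_derivative)
    then show "((\<lambda>u. \<Sum>k\<in>F. dweight \<alpha> u k * x k) has_vector_derivative - ?Z u) (at u within {s..b})"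
      by (simp add: sum_negf has_real_derivative_iff_has_vector_derivative has_vector_derivative_at_within)
  qed
  from integral_unique[OF this]
  have "\<bar>(\<Sum>k\<in>F. dweight \<alpha> b k * x k) - (\<Sum>k\<in>F. dweight \<alpha> s k * x k)\<bar> = \<bar>integral {s..b} (\<lambda>u. - ?Z u)\<bar>"
    by (simp only:)
  also have "\<dots> \<le> integral {s..b} (\<lambda>u. \<bar>?Z u\<bar>)"
    using integral_norm_bound_integral[of "\<lambda>u. - ?Z u" "{s..b}" "\<lambda>u. \<bar>?Z u\<bar>"]
    by (simp add: integrable_continuous_real c)
  also have "\<dots> \<le> integral {a..b} (\<lambda>u. \<bar>?Z u\<bar>)"
    by (rule integral_subset_le) (use s in \<open>auto intro!: integrable_continuous_real c\<close>)
  also have "\<dots> = (LINT u:{a..b}|lborel. \<bar>?Z u\<bar>)"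
    by (rule set_borel_integral_eq_integral(2)[symmetric]) (intro borel_integrable_atLeastAtMost' c)
  finally show ?thesis .
qed

context truncated_sequence
begin

lemma AE_grid_upper:
  assumes a: "\<alpha> > -1/2" and q: "0 < q" "q < 1" and K: "K > lil_const \<alpha>"
  shows "AE \<omega> in M. \<forall>\<^sub>F n in sequentially. \<exists>\<^sub>F N in sequentially.
    \<bar>\<Sum>k<N. dweight \<alpha> (q ^ n) k * \<xi> k \<omega>\<bar> < K * lil_scale \<alpha> (q ^ n)"
proof -
  obtain C0 where C0: "C0 > 0" "\<And>s k. 0 < s \<Longrightarrow> dweight \<alpha> s k * sqrt (real k) \<le> C0 * s powr (- max \<alpha> 0)"
    using dweight_bound[of \<alpha>] by blast
  define w where "w = Gamma (1 + 2 * \<alpha>) / 2 powr (1 + 2 * \<alpha>)"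
  have c: "lil_const \<alpha> > 0" by (rule lil_const_pos[OF a])
  show ?thesis
  proof (rule grid_deviation[OF a q, where W = "dvar \<alpha>" and w = w and C = C0])
    show "((\<lambda>s. s powr (1 + 2 * \<alpha>) * dvar \<alpha> s) \<longlongrightarrow> w) (at_right 0)"
      using dvar_asymp[OF a, of 1] by (simp add: w_def)
    show "0 \<le> w" using Gamma_real_pos[of "1 + 2 * \<alpha>"] a by (simp add: w_def)
    show "2 * v * w < K\<^sup>2" using lil_const_sq[OF a] power_strict_mono[OF K, of 2] c by (simp add: w_def)
    fix n t N assume t: "0 < t" "t * (C0 * (q ^ n) powr (- max \<alpha> 0)) \<le> 1"
    show "(\<integral>\<^sup>+\<omega>. ennreal (exp (t * \<bar>\<Sum>k<N. dweight \<alpha> (q ^ n) k * \<xi> k \<omega>\<bar>)) \<partial>M) \<le>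
        ennreal (2 * exp (t * (C0 * (q ^ n) powr (- max \<alpha> 0)) * D + t\<^sup>2 * (1 + t * (C0 * (q ^ n) powr (- max \<alpha> 0))) / 2 * v * dvar \<alpha> (q ^ n)))"
      by (rule mgf_abs_sum) (use t C0 q a in \<open>auto intro!: sum_dweight_sq_le\<close>)
  qed (use C0 K c in auto)
qed

text \<open>A cell has length (1 - q) q^n, and the sum of squared weights for \<alpha> + 1 is of
  order (q^n)^(-3 - 2\<alpha>). The integral therefore has the order of the series itself, with the
  extra factor (1 - q)^2 and a power of q; this is the left side of \<open>small\<close>.\<close>

lemma AE_grid_increment:
  assumes a: "\<alpha> > -1/2" and q: "0 < q" "q < 1" and e: "\<epsilon> > 0"
    and small: "2 * v * ((1 - q)\<^sup>2 * (q powr -(3 + 2 * \<alpha>) * (Gamma (3 + 2 * \<alpha>) / 2 powr (3 + 2 * \<alpha>)))) < \<epsilon>\<^sup>2"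
  shows "AE \<omega> in M. \<forall>\<^sub>F n in sequentially. \<exists>\<^sub>F N in sequentially.
    (LINT u:{q ^ Suc n..q ^ n}|lborel. \<bar>\<Sum>k<N. dweight (\<alpha> + 1) u k * \<xi> k \<omega>\<bar>) < \<epsilon> * lil_scale \<alpha> (q ^ n)"
proof -
  obtain C1 where C1: "C1 > 0" "\<And>s k. 0 < s \<Longrightarrow> dweight (\<alpha> + 1) s k * sqrt (real k) \<le> C1 * s powr (- max (\<alpha> + 1) 0)"
    using dweight_bound[of "\<alpha> + 1"] by blast
  \<comment> \<open>The weights decrease in u, so the lower end q * q^n of the cell governs both the
    summands and the variance; the power of q records this.\<close>
  define C0 where "C0 = C1 * q powr (- (\<alpha> + 1))"
  have C0: "C0 > 0" using C1 q by (simp add: C0_def)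
  define W where "W s = ((1 - q) * s)\<^sup>2 * dvar (\<alpha> + 1) (q * s)" for s
  let ?w = "(1 - q)\<^sup>2 * (q powr -(3 + 2 * \<alpha>) * (Gamma (3 + 2 * \<alpha>) / 2 powr (3 + 2 * \<alpha>)))"
  show ?thesis
  proof (rule grid_deviation[OF a q, where W = W and w = ?w and C = C0])
    have a1: "\<alpha> + 1 > -1/2" using a by simp
    have ex: "1 + 2 * (\<alpha> + 1) = 3 + 2 * \<alpha>" by simp
    from tendsto_mult[OF tendsto_const dvar_asymp[OF a1 q(1), unfolded ex], of "(1 - q)\<^sup>2"]
    have *: "((\<lambda>s. (1 - q)\<^sup>2 * (s powr (3 + 2 * \<alpha>) * dvar (\<alpha> + 1) (q * s))) \<longlongrightarrow> ?w) (at_right 0)" .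
    show "((\<lambda>s. s powr (1 + 2 * \<alpha>) * W s) \<longlongrightarrow> ?w) (at_right 0)"
    proof (rule Lim_transform_eventually[OF *])
      show "\<forall>\<^sub>F s in at_right 0. (1 - q)\<^sup>2 * (s powr (3 + 2 * \<alpha>) * dvar (\<alpha> + 1) (q * s)) = s powr (1 + 2 * \<alpha>) * W s"
        using eventually_at_right_less[of 0]
      proof eventually_elim
        case (elim s)
        have "s powr (3 + 2 * \<alpha>) = s powr (1 + 2 * \<alpha>) * s powr 2"
          unfolding powr_add[symmetric] by (simp add: add_ac)
        then have "s powr (3 + 2 * \<alpha>) = s powr (1 + 2 * \<alpha>) * s\<^sup>2" using elim by simp
        then show ?case by (simp add: W_def power_mult_distrib)
      qed
    qed
    show "0 \<le> ?w" using Gamma_real_pos[of "3 + 2 * \<alpha>"] a by simp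
    show "2 * v * ?w < \<epsilon>\<^sup>2" by (rule small)
    show "(\<lambda>\<omega>. LINT u:{q ^ Suc n..q ^ n}|lborel. \<bar>\<Sum>k<N. dweight (\<alpha> + 1) u k * \<xi> k \<omega>\<bar>) \<in> borel_measurable M" for n N
      unfolding set_lebesgue_integral_def by measurable
    fix n t N assume t: "0 < t" "t * (C0 * (q ^ n) powr (- max \<alpha> 0)) \<le> 1"
    have s0: "0 < q ^ n" "q ^ n \<le> 1" using q by (auto intro: power_le_one)
    have h: "q ^ n - q ^ Suc n = (1 - q) * q ^ n" by (simp add: algebra_simps)
    show "(\<integral>\<^sup>+\<omega>. ennreal (exp (t * (LINT u:{q ^ Suc n..q ^ n}|lborel. \<bar>\<Sum>k<N. dweight (\<alpha> + 1) u k * \<xi> k \<omega>\<bar>))) \<partial>M) \<le>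
        ennreal (2 * exp (t * (C0 * (q ^ n) powr (- max \<alpha> 0)) * D + t\<^sup>2 * (1 + t * (C0 * (q ^ n) powr (- max \<alpha> 0))) / 2 * v * W (q ^ n)))"
    proof (rule mgf_integral_sum)
      show "q ^ Suc n < q ^ n" using q by simp
      fix u assume u: "u \<in> {q ^ Suc n..q ^ n}"
      have "q ^ Suc n > 0" using q by simp
      then have u0: "u > 0" using u by (simp del: power_Suc)
      show "\<bar>(q ^ n - q ^ Suc n) * dweight (\<alpha> + 1) u k\<bar> * sqrt (real k) \<le> C0 * (q ^ n) powr (- max \<alpha> 0)" for k
      proof -
        have "dweight (\<alpha> + 1) u k * sqrt (real k) \<le> C1 * u powr (- (\<alpha> + 1))"
          using C1(2)[OF u0, of k] a by simp
        also have "\<dots> \<le> C1 * (q * q ^ n) powr (- (\<alpha> + 1))"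
          using C1 u a q by (intro mult_left_mono powr_mono2') auto
        also have "\<dots> = C0 * (q ^ n) powr (- (\<alpha> + 1))"
          using q s0 by (simp add: C0_def powr_mult)
        finally have 1: "dweight (\<alpha> + 1) u k * sqrt (real k) \<le> C0 * (q ^ n) powr (- (\<alpha> + 1))" .
        have "\<bar>(q ^ n - q ^ Suc n) * dweight (\<alpha> + 1) u k\<bar> * sqrt (real k) = (1 - q) * q ^ n * (dweight (\<alpha> + 1) u k * sqrt (real k))"
          unfolding h using q s0 by (simp add: abs_mult)
        also have "\<dots> \<le> (1 - q) * q ^ n * (C0 * (q ^ n) powr (- (\<alpha> + 1)))"
          using q s0 by (intro mult_left_mono 1) auto
        \<comment> \<open>The length of the cell contributes one power of \<open>q ^ n\<close>,
          which brings the exponent -(\<alpha> + 1) back to -\<alpha>, the order of the summands of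
          the original series.\<close>
        also have "\<dots> = (1 - q) * (C0 * ((q ^ n) powr 1 * (q ^ n) powr (- (\<alpha> + 1))))" using s0 by simp
        also have "\<dots> = (1 - q) * (C0 * (q ^ n) powr (- \<alpha>))" unfolding powr_add[symmetric] by simp
        also have "\<dots> \<le> 1 * (C0 * (q ^ n) powr (- max \<alpha> 0))"
          using q s0 C0 by (intro mult_mono mult_left_mono powr_mono') auto
        finally show ?thesis by simp
      qed
      have "(\<Sum>k<N. ((q ^ n - q ^ Suc n) * dweight (\<alpha> + 1) u k)\<^sup>2) = ((1 - q) * q ^ n)\<^sup>2 * (\<Sum>k<N. (dweight (\<alpha> + 1) u k)\<^sup>2)"
        unfolding h by (simp add: power_mult_distrib sum_distrib_left)
      also have "\<dots> \<le> ((1 - q) * q ^ n)\<^sup>2 * (\<Sum>k<N. (dweight (\<alpha> + 1) (q * q ^ n) k)\<^sup>2)"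
        using u by (intro mult_left_mono sum_mono power_mono dweight_antimono) auto
      also have "\<dots> \<le> W (q ^ n)"
        unfolding W_def using a q by (intro mult_left_mono sum_dweight_sq_le) auto
      finally show "(\<Sum>k<N. ((q ^ n - q ^ Suc n) * dweight (\<alpha> + 1) u k)\<^sup>2) \<le> W (q ^ n)" .
    qed (use t C0 in \<open>auto intro!: continuous_intros\<close>)
  qed (use C0 e in auto)
qed

lemma AE_upper:
  assumes a: "\<alpha> > -1/2" and \<kappa>: "\<kappa> > lil_const \<alpha>"
  shows "AE \<omega> in M. \<forall>\<^sub>F s in at_right 0. \<bar>\<Sum>k. dweight \<alpha> s k * \<xi> k \<omega>\<bar> < \<kappa> * lil_scale \<alpha> s"
proof -
  \<comment> \<open>One third of the gap is spent on the grid points and one third on the increments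
    within a cell; the last third keeps the final inequality strict.\<close>
  define \<epsilon> where "\<epsilon> = (\<kappa> - lil_const \<alpha>) / 3"
  define K where "K = lil_const \<alpha> + \<epsilon>"
  have e: "\<epsilon> > 0" and K: "K > lil_const \<alpha>" "K + \<epsilon> < \<kappa>" using \<kappa> by (auto simp: \<epsilon>_def K_def field_simps)
  have K0: "K > 0" using K lil_const_pos[OF a] by simp
  define B where "B = Gamma (3 + 2 * \<alpha>) / 2 powr (3 + 2 * \<alpha>)"
  \<comment> \<open>The increments are made small by letting q tend to 1 before any sequence along
    the grid is considered.\<close>
  have "((\<lambda>q. 2 * v * ((1 - q)\<^sup>2 * (q powr -(3 + 2 * \<alpha>) * B))) \<longlongrightarrow> 2 * v * ((1 - 1)\<^sup>2 * (1 powr -(3 + 2 * \<alpha>) * B))) (at_left 1)"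
    by (intro tendsto_intros) auto
  then have "\<forall>\<^sub>F q in at_left 1. 2 * v * ((1 - q)\<^sup>2 * (q powr -(3 + 2 * \<alpha>) * B)) < \<epsilon>\<^sup>2"
    using e by (intro order_tendstoD) auto
  moreover have "\<forall>\<^sub>F q in at_left 1. q \<in> {0<..<1::real}" by (rule eventually_at_left_real) simp
  ultimately have "\<forall>\<^sub>F q in at_left 1. 2 * v * ((1 - q)\<^sup>2 * (q powr -(3 + 2 * \<alpha>) * B)) < \<epsilon>\<^sup>2 \<and> q \<in> {0<..<1}"
    by (rule eventually_conj)
  then obtain q where q0: "2 * v * ((1 - q)\<^sup>2 * (q powr -(3 + 2 * \<alpha>) * B)) < \<epsilon>\<^sup>2" and q: "0 < q" "q < 1"
    using eventually_happens'[of "at_left (1::real)"] by (auto simp: trivial_limit_at_left_real)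
  from AE_partial_sums[OF a] AE_grid_upper[OF a q K(1)] AE_grid_increment[OF a q e q0[unfolded B_def]]
  show ?thesis
  proof eventually_elim
    case (elim \<omega>)
    let ?X = "\<lambda>s. \<Sum>k. dweight \<alpha> s k * \<xi> k \<omega>"
    have lim: "(\<lambda>N. \<Sum>k<N. dweight \<alpha> s k * \<xi> k \<omega>) \<longlonglongrightarrow> ?X s" if "s > 0" for s
      by (rule summable_LIMSEQ[OF dirichlet_weighted_series(1)[OF _ that]]) (use elim in blast)
    have "\<forall>\<^sub>F n in sequentially. q ^ n < exp (-1)"
      using q by (intro order_tendstoD[OF LIMSEQ_realpow_zero]) auto
    with elim(2,3) have "\<forall>\<^sub>F n in sequentially. q ^ n < exp (-1) \<and>
        (\<exists>\<^sub>F N in sequentially. \<bar>\<Sum>k<N. dweight \<alpha> (q ^ n) k * \<xi> k \<omega>\<bar> < K * lil_scale \<alpha> (q ^ n)) \<and>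
        (\<exists>\<^sub>F N in sequentially. (LINT u:{q ^ Suc n..q ^ n}|lborel. \<bar>\<Sum>k<N. dweight (\<alpha> + 1) u k * \<xi> k \<omega>\<bar>) < \<epsilon> * lil_scale \<alpha> (q ^ n))"
      by eventually_elim blast
    then obtain n0 where n0: "\<And>n. n \<ge> n0 \<Longrightarrow> q ^ n < exp (-1)"
        "\<And>n. n \<ge> n0 \<Longrightarrow> \<exists>\<^sub>F N in sequentially. \<bar>\<Sum>k<N. dweight \<alpha> (q ^ n) k * \<xi> k \<omega>\<bar> < K * lil_scale \<alpha> (q ^ n)"
        "\<And>n. n \<ge> n0 \<Longrightarrow> \<exists>\<^sub>F N in sequentially. (LINT u:{q ^ Suc n..q ^ n}|lborel. \<bar>\<Sum>k<N. dweight (\<alpha> + 1) u k * \<xi> k \<omega>\<bar>) < \<epsilon> * lil_scale \<alpha> (q ^ n)"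
      by (auto simp: eventually_sequentially)
    have "\<forall>\<^sub>F s in at_right 0. s \<in> {0<..<q ^ n0}" using q by (intro eventually_at_right_real) simp
    then show ?case using lil_scale_pos[of \<alpha>]
    proof eventually_elim
      case (elim s)
      then have s: "0 < s" "s \<le> q ^ n0" and pos: "lil_scale \<alpha> s > 0" by auto
      obtain n where n: "n \<ge> n0" "q ^ Suc n \<le> s" "s \<le> q ^ n" using geometric_bracket[OF q s] by blast
      have qn: "q ^ n > 0" using q by simp
      have g: "\<bar>?X (q ^ n)\<bar> \<le> K * lil_scale \<alpha> (q ^ n)"
        by (rule LIMSEQ_frequently_le[OF tendsto_rabs[OF lim[OF qn]] n0(2)[OF n(1)]])
      have i: "\<bar>?X (q ^ n) - ?X s\<bar> \<le> \<epsilon> * lil_scale \<alpha> (q ^ n)"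
      proof (rule LIMSEQ_frequently_le[OF tendsto_rabs[OF tendsto_diff[OF lim[OF qn] lim[OF s(1)]]]])
        show "\<exists>\<^sub>F N in sequentially. \<bar>(\<Sum>k<N. dweight \<alpha> (q ^ n) k * \<xi> k \<omega>) - (\<Sum>k<N. dweight \<alpha> s k * \<xi> k \<omega>)\<bar> < \<epsilon> * lil_scale \<alpha> (q ^ n)"
          by (rule frequently_elim1[OF n0(3)[OF n(1)] le_less_trans[OF dweight_sum_increment[OF n(2,3) finite_lessThan]]])
      qed
      have "\<bar>?X s\<bar> \<le> (K + \<epsilon>) * lil_scale \<alpha> (q ^ n)" using g i unfolding distrib_right by linarith
      also have "\<dots> \<le> (K + \<epsilon>) * lil_scale \<alpha> s"
        using lil_scale_antimono[OF a s(1) n(3) n0(1)[OF n(1)]] K0 e by (intro mult_left_mono) auto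
      also have "\<dots> < \<kappa> * lil_scale \<alpha> s" using K(2) pos by (rule mult_strict_right_mono)
      finally show ?case .
    qed
  qed
qed

end

section \<open>Lower bound\<close>

text \<open>The grid ratio q = d / A is tied to the window for s * ln k: the upper end A / q^n of
  one block is the lower end d / q^(n+1) of the next, so the half-open blocks are adjacent and
  disjoint.\<close>

definition block :: "real \<Rightarrow> real \<Rightarrow> nat \<Rightarrow> nat set" where
  "block A d n = {k. d / (d / A) ^ n < ln (real k) \<and> ln (real k) \<le> A / (d / A) ^ n}"

lemma finite_block:
  assumes "0 < d" "d < A" shows "finite (block A d n)"
proof (rule finite_subset)
  show "block A d n \<subseteq> {..nat \<lceil>exp (A / (d / A) ^ n)\<rceil>}"
  proof
    fix k assume "k \<in> block A d n"
    then have k: "0 < ln (real k)" "ln (real k) \<le> A / (d / A) ^ n"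
      using assms by (auto simp: block_def intro: less_trans[of 0 "d / (d / A) ^ n"])
    have "k > 0" using k(1) by (cases k) auto
    then have "real k = exp (ln (real k))" by simp
    also have "\<dots> \<le> exp (A / (d / A) ^ n)" using k(2) by (simp only: exp_le_cancel_iff)
    finally have "real k \<le> exp (A / (d / A) ^ n)" .
    then show "k \<in> {..nat \<lceil>exp (A / (d / A) ^ n)\<rceil>}" by (simp add: le_nat_iff) linarith
  qed
qed simp

lemma disjoint_block:
  assumes "0 < d" "d < A" shows "disjoint_family (block A d)"
proof -
  define q where "q = d / A"
  have q: "0 < q" "q < 1" using assms by (auto simp: q_def)
  have "block A d n \<inter> block A d m = {}" if "n < m" for n m
  proof -
    have "q ^ m \<le> q ^ Suc n" using that q by (intro power_decreasing) auto
    then have "d / q ^ Suc n \<le> d / q ^ m" using q assms by (intro divide_left_mono) auto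
    moreover have "d / q ^ Suc n = A / q ^ n" using assms by (simp add: q_def)
    ultimately show ?thesis by (auto simp: block_def q_def[symmetric])
  qed
  then show ?thesis unfolding disjoint_family_on_def by (metis Int_commute linorder_neqE_nat)
qed

text \<open>The first summand bounds the tail ln k >= A / s, the second the head ln k <= d /
  s.\<close>

definition outside_var :: "real \<Rightarrow> real \<Rightarrow> real \<Rightarrow> real \<Rightarrow> real" where
  "outside_var \<alpha> A d s = exp (-A) * dvar \<alpha> (s / 2) + exp 2 * dvar \<alpha> (s / d)"

lemma sum_outside_block_le:
  assumes a: "\<alpha> > -1/2" and d: "0 < d" "d < A" and H: "finite H" "H \<inter> block A d n = {}"
  shows "(\<Sum>k\<in>H. (dweight \<alpha> ((d / A) ^ n) k)\<^sup>2) \<le> outside_var \<alpha> A d ((d / A) ^ n)"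
proof -
  define s where "s = (d / A) ^ n"
  have s: "s > 0" using d by (simp add: s_def)
  have "(dweight \<alpha> s k)\<^sup>2 \<le> exp (-A) * (dweight \<alpha> (s / 2) k)\<^sup>2 + exp 2 * (dweight \<alpha> (s / d) k)\<^sup>2" if "k \<in> H" for k
  proof -
    have "ln (real k) \<le> d / s \<or> A / s \<le> ln (real k)" using that H by (auto simp: block_def s_def)
    then show ?thesis
      using dweight_head_le[OF s _ d(1), of k \<alpha>] dweight_tail_le[OF s, of A k \<alpha>]
      by (smt (verit) exp_ge_zero mult_nonneg_nonneg zero_le_power2)
  qed
  then have "(\<Sum>k\<in>H. (dweight \<alpha> s k)\<^sup>2) \<le>
      exp (-A) * (\<Sum>k\<in>H. (dweight \<alpha> (s / 2) k)\<^sup>2) + exp 2 * (\<Sum>k\<in>H. (dweight \<alpha> (s / d) k)\<^sup>2)"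
    unfolding sum_distrib_left sum.distrib[symmetric] by (intro sum_mono)
  also have "\<dots> \<le> outside_var \<alpha> A d s"
    unfolding outside_var_def using s d by (intro add_mono mult_left_mono sum_dweight_sq_le a H) auto
  finally show ?thesis by (simp add: s_def)
qed

lemma dvar_le_block:
  assumes a: "\<alpha> > -1/2" and d: "0 < d" "d < A"
  shows "dvar \<alpha> ((d / A) ^ n) \<le> (\<Sum>k\<in>block A d n. (dweight \<alpha> ((d / A) ^ n) k)\<^sup>2) + outside_var \<alpha> A d ((d / A) ^ n)"
  unfolding dvar_def
proof (rule suminf_le_const)
  fix N
  let ?f = "\<lambda>k. (dweight \<alpha> ((d / A) ^ n) k)\<^sup>2"
  have "sum ?f {..<N} \<le> sum ?f (block A d n \<union> ({..<N} - block A d n))"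
    using finite_block[OF d] by (intro sum_mono2) auto
  also have "\<dots> = sum ?f (block A d n) + sum ?f ({..<N} - block A d n)"
    using finite_block[OF d] by (intro sum.union_disjoint) auto
  also have "\<dots> \<le> sum ?f (block A d n) + outside_var \<alpha> A d ((d / A) ^ n)"
    by (intro add_left_mono sum_outside_block_le a d) auto
  finally show "sum ?f {..<N} \<le> sum ?f (block A d n) + outside_var \<alpha> A d ((d / A) ^ n)" .
qed (use a d in \<open>auto intro!: dvar_summable\<close>)

text \<open>The limiting ratio of \<open>outside_var\<close> to \<open>dvar\<close>; the two powers
  are 2^(1 + 2\<alpha>) and d^(1 + 2\<alpha>).\<close>

definition outside_limit :: "real \<Rightarrow> real \<Rightarrow> real \<Rightarrow> real" where
  "outside_limit \<alpha> A d = exp (-A) * (1/2) powr -(1 + 2 * \<alpha>) + exp 2 * (1/d) powr -(1 + 2 * \<alpha>)"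

lemma outside_var_asymp:
  assumes a: "\<alpha> > -1/2" and d: "0 < d"
  shows "((\<lambda>s. s powr (1 + 2 * \<alpha>) * outside_var \<alpha> A d s) \<longlongrightarrow> outside_limit \<alpha> A d * (Gamma (1 + 2 * \<alpha>) / 2 powr (1 + 2 * \<alpha>))) (at_right 0)"
proof -
  have "((\<lambda>s. exp (-A) * (s powr (1 + 2 * \<alpha>) * dvar \<alpha> (1 / 2 * s)) + exp 2 * (s powr (1 + 2 * \<alpha>) * dvar \<alpha> (1 / d * s)))
     \<longlongrightarrow> exp (-A) * ((1/2) powr -(1 + 2 * \<alpha>) * (Gamma (1 + 2 * \<alpha>) / 2 powr (1 + 2 * \<alpha>))) +
         exp 2 * ((1/d) powr -(1 + 2 * \<alpha>) * (Gamma (1 + 2 * \<alpha>) / 2 powr (1 + 2 * \<alpha>)))) (at_right 0)"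
    using d by (intro tendsto_intros dvar_asymp[OF a]) auto
  then show ?thesis by (simp add: outside_var_def outside_limit_def algebra_simps)
qed

lemma outside_limit_small:
  assumes a: "\<alpha> > -1/2" and r: "\<rho> > 0"
  obtains A d where "0 < d" "d < A" "outside_limit \<alpha> A d < \<rho>"
proof -
  have "((\<lambda>A. exp (-A) * (1/2) powr -(1 + 2 * \<alpha>)) \<longlongrightarrow> 0) at_top" by real_asymp
  then have "\<forall>\<^sub>F A in at_top. exp (-A) * (1/2) powr -(1 + 2 * \<alpha>) < \<rho> / 2" using r by (intro order_tendstoD) auto
  then have "\<forall>\<^sub>F A in at_top. exp (-A) * (1/2) powr -(1 + 2 * \<alpha>) < \<rho> / 2 \<and> A > 0"
    using eventually_gt_at_top[of 0] by (rule eventually_conj)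
  then obtain A where A: "exp (-A) * (1/2) powr -(1 + 2 * \<alpha>) < \<rho> / 2" "A > 0"
    using eventually_happens'[OF trivial_limit_at_top_linorder] by blast
  have "1 + 2 * \<alpha> > 0" using a by simp
  then have "((\<lambda>d. exp 2 * (1/d) powr -(1 + 2 * \<alpha>)) \<longlongrightarrow> 0) (at_right 0)" by real_asymp
  then have "\<forall>\<^sub>F d in at_right 0. exp 2 * (1/d) powr -(1 + 2 * \<alpha>) < \<rho> / 2" using r by (intro order_tendstoD) auto
  then have "\<forall>\<^sub>F d in at_right 0. exp 2 * (1/d) powr -(1 + 2 * \<alpha>) < \<rho> / 2 \<and> d \<in> {0<..<A}"
    using eventually_at_right_real[OF A(2)] by (rule eventually_conj)
  then obtain d where "exp 2 * (1/d) powr -(1 + 2 * \<alpha>) < \<rho> / 2" "d \<in> {0<..<A}"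
    using eventually_happens'[OF trivial_limit_at_right_real] by blast
  then show ?thesis using A that[of d A] by (auto simp: outside_limit_def)
qed

context truncated_sequence
begin

lemma AE_remainder:
  assumes a: "\<alpha> > -1/2" and d: "0 < d" "d < A" and e: "\<epsilon> > 0"
    and small: "outside_limit \<alpha> A d * (lil_const \<alpha>)\<^sup>2 < \<epsilon>\<^sup>2"
  shows "AE \<omega> in M. \<forall>\<^sub>F n in sequentially. \<exists>\<^sub>F N in sequentially.
    \<bar>\<Sum>k\<in>{..<N} - block A d n. dweight \<alpha> ((d / A) ^ n) k * \<xi> k \<omega>\<bar> < \<epsilon> * lil_scale \<alpha> ((d / A) ^ n)"
proof -
  define q where "q = d / A"
  have q: "0 < q" "q < 1" using d by (auto simp: q_def)
  obtain C where C: "C > 0" "\<And>s k. 0 < s \<Longrightarrow> dweight \<alpha> s k * sqrt (real k) \<le> C * s powr (- max \<alpha> 0)"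
    using dweight_bound[of \<alpha>] by blast
  define w where "w = Gamma (1 + 2 * \<alpha>) / 2 powr (1 + 2 * \<alpha>)"
  have w: "w > 0" using Gamma_real_pos[of "1 + 2 * \<alpha>"] a by (simp add: w_def)
  show ?thesis unfolding q_def[symmetric]
  proof (rule grid_deviation[OF a q, where W = "outside_var \<alpha> A d" and w = "outside_limit \<alpha> A d * w" and C = C])
    show "((\<lambda>s. s powr (1 + 2 * \<alpha>) * outside_var \<alpha> A d s) \<longlongrightarrow> outside_limit \<alpha> A d * w) (at_right 0)"
      using outside_var_asymp[OF a d(1), of A] by (simp add: w_def)
    show "0 \<le> outside_limit \<alpha> A d * w" using w by (simp add: outside_limit_def)
    show "2 * v * (outside_limit \<alpha> A d * w) < \<epsilon>\<^sup>2" using small lil_const_sq[OF a] by (simp add: w_def mult_ac)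
    fix n t N assume t: "0 < t" "t * (C * (q ^ n) powr (- max \<alpha> 0)) \<le> 1"
    show "(\<integral>\<^sup>+\<omega>. ennreal (exp (t * \<bar>\<Sum>k\<in>{..<N} - block A d n. dweight \<alpha> (q ^ n) k * \<xi> k \<omega>\<bar>)) \<partial>M) \<le>
        ennreal (2 * exp (t * (C * (q ^ n) powr (- max \<alpha> 0)) * D + t\<^sup>2 * (1 + t * (C * (q ^ n) powr (- max \<alpha> 0))) / 2 * v * outside_var \<alpha> A d (q ^ n)))"
    proof (rule mgf_abs_sum)
      show "(\<Sum>k\<in>{..<N} - block A d n. (dweight \<alpha> (q ^ n) k)\<^sup>2) \<le> outside_var \<alpha> A d (q ^ n)"
        unfolding q_def by (rule sum_outside_block_le[OF a d]) auto
    qed (use t C q in auto)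
  qed (use C e in auto)
qed

end

context truncated_sequence
begin

text \<open>\<open>U n\<close> is the idealised variance c^2 / (2 s^(1 + 2\<alpha>)), and the tilt
  \<open>l n\<close> makes the tilted mean \<open>l n * U n\<close> equal to sqrt \<theta> * c * p.
  The tilting lemma then has the exponent Q/2 * (1 + 2 \<epsilon> + \<delta>) with Q = 2 \<theta> L.
  The choice \<theta> = 1 / (1 + 3 \<epsilon>) makes it at most L, on the divergent side of
  Borel-Cantelli; this is the origin of the square root in the threshold.\<close>

lemma block_prob_lower:
  assumes a: "\<alpha> > -1/2" and d: "0 < d" "d < A" and e: "0 < \<epsilon>" "\<epsilon> \<le> 1/2"
    and small: "outside_limit \<alpha> A d < \<epsilon>\<^sup>2 / 40"
  shows "\<forall>\<^sub>F n in sequentially. exp (- ln (ln (1 / (d / A) ^ n))) / 2 \<le>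
    prob {\<omega>\<in>space M. (1 - \<epsilon>) / sqrt (1 + 3 * \<epsilon>) * lil_const \<alpha> * lil_scale \<alpha> ((d / A) ^ n) \<le>
      (\<Sum>k\<in>block A d n. dweight \<alpha> ((d / A) ^ n) k * \<xi> k \<omega>)}"
proof -
  define q where "q = d / A"
  have q: "0 < q" "q < 1" using d by (auto simp: q_def)
  note qlim = geometric_at_right_0[OF q]
  \<comment> \<open>The largest relative error that the tilting lemma tolerates. In the lower bound
    it is shared out as \<delta>/4 for the variance, \<delta>/4 for the terms outside the block,
    \<delta>/8 for the second moments, \<delta>/8 for 6 m, and \<delta>/4 for the bias.\<close>
  define \<delta> where "\<delta> = \<epsilon>\<^sup>2 / 10"
  have d0: "\<delta> > 0" using e by (simp add: \<delta>_def)
  have "\<epsilon>\<^sup>2 \<le> \<epsilon>" using e mult_left_mono[of \<epsilon> 1 \<epsilon>] by (simp add: power2_eq_square)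
  then have e2: "\<epsilon>\<^sup>2 \<le> \<epsilon>" "\<epsilon>\<^sup>2 \<le> 1" using e by linarith+
  have d1: "\<delta> \<le> \<epsilon>" "\<delta> \<le> 1" using e2 e by (auto simp: \<delta>_def)
  define \<theta> where "\<theta> = 1 / (1 + 3 * \<epsilon>)"
  have th: "\<theta> > 0" using e by (simp add: \<theta>_def)
  define c where "c = lil_const \<alpha>"
  have c: "c > 0" unfolding c_def by (rule lil_const_pos[OF a])
  define V0 where "V0 = Gamma (1 + 2 * \<alpha>) / 2 powr (1 + 2 * \<alpha>)"
  have cV: "c\<^sup>2 = 2 * v * V0" unfolding c_def V0_def by (rule lil_const_sq[OF a])
  obtain C where C: "C > 0" "\<And>s k. 0 < s \<Longrightarrow> dweight \<alpha> s k * sqrt (real k) \<le> C * s powr (- max \<alpha> 0)"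
    using dweight_bound[of \<alpha>] by blast
  define L where "L n = ln (ln (1 / q ^ n))" for n
  define p where "p n = lil_scale \<alpha> (q ^ n)" for n
  define U where "U n = c\<^sup>2 * (p n)\<^sup>2 / (2 * L n)" for n
  define l where "l n = 2 * sqrt \<theta> * L n / (c * p n)" for n
  define m where "m n = l n * (1 + \<epsilon>) * (C * (q ^ n) powr (- max \<alpha> 0))" for n
  have Llim: "filterlim L at_top sequentially" unfolding L_def
    by (rule filterlim_compose[OF loglog_at_top qlim])
  have Lpos: "\<forall>\<^sub>F n in sequentially. L n > 0" using Llim by (simp add: filterlim_at_top_dense)
  have ppos: "\<forall>\<^sub>F n in sequentially. p n > 0" unfolding p_def
    using eventually_compose_filterlim[OF lil_scale_pos qlim] .
  \<comment> \<open>As Q = 2 \<theta> L, this amounts to Q \<delta> >= 32, which pays for the bias,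
    and Q \<epsilon>^2 >= 8, as the tilting lemma demands.\<close>
  have Lbig: "\<forall>\<^sub>F n in sequentially. L n \<ge> 16 / (\<delta> * \<theta>) + 4 / (\<theta> * \<epsilon>\<^sup>2)"
    using Llim by (simp add: filterlim_at_top)
  have mlim: "m \<longlonglongrightarrow> 0"
  proof -
    have "2 * t * x / (y * z) * E * (C * u) = 2 * t / y * E * C * (u * x / z)" for t x y z E u
      by (simp add: mult_ac)
    then have "m n = 2 * sqrt \<theta> / c * (1 + \<epsilon>) * C * ((q ^ n) powr (- max \<alpha> 0) * ln (ln (1 / q ^ n)) / lil_scale \<alpha> (q ^ n))" for n
      by (simp only: m_def l_def L_def p_def)
    then have "m = (\<lambda>n. 2 * sqrt \<theta> / c * (1 + \<epsilon>) * C * ((q ^ n) powr (- max \<alpha> 0) * ln (ln (1 / q ^ n)) / lil_scale \<alpha> (q ^ n)))" by (rule ext)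
    then show ?thesis
      using tendsto_mult[OF tendsto_const filterlim_compose[OF lil_scale_tilt_negligible[OF a] qlim], of "2 * sqrt \<theta> / c * (1 + \<epsilon>) * C"]
      by (simp only: mult_zero_right)
  qed
  have msmall: "\<forall>\<^sub>F n in sequentially. m n < \<delta> / 48"
    using mlim d0 by (intro order_tendstoD) auto
  have mD: "\<forall>\<^sub>F n in sequentially. m n * D < 1"
    using tendsto_mult_left_zero[OF mlim, of D] by (intro order_tendstoD) auto
  have "((\<lambda>s. 2 * v * (s powr (1 + 2 * \<alpha>) * dvar \<alpha> s)) \<longlongrightarrow> 2 * v * V0) (at_right 0)"
    using dvar_asymp[OF a, of 1] by (intro tendsto_intros) (simp add: V0_def)
  from filterlim_compose[OF this qlim]
  have Vlim: "(\<lambda>n. 2 * v * ((q ^ n) powr (1 + 2 * \<alpha>) * dvar \<alpha> (q ^ n))) \<longlonglongrightarrow> c\<^sup>2" by (simp add: cV)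
  have c2: "c\<^sup>2 > 0" using c by simp
  have V1: "\<forall>\<^sub>F n in sequentially. 2 * v * ((q ^ n) powr (1 + 2 * \<alpha>) * dvar \<alpha> (q ^ n)) < (1 + \<delta> / 4) * c\<^sup>2"
    by (rule order_tendstoD(2)[OF Vlim]) (use c2 d0 in simp)
  have V2: "\<forall>\<^sub>F n in sequentially. 2 * v * ((q ^ n) powr (1 + 2 * \<alpha>) * dvar \<alpha> (q ^ n)) > (1 - \<delta> / 4) * c\<^sup>2"
    by (rule order_tendstoD(1)[OF Vlim]) (use c2 d0 in simp)
  have "((\<lambda>s. 2 * v * (s powr (1 + 2 * \<alpha>) * outside_var \<alpha> A d s)) \<longlongrightarrow> 2 * v * (outside_limit \<alpha> A d * V0)) (at_right 0)"
    unfolding V0_def by (rule tendsto_mult[OF tendsto_const outside_var_asymp[OF a d(1)]])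
  from filterlim_compose[OF this qlim]
  have Rlim: "(\<lambda>n. 2 * v * ((q ^ n) powr (1 + 2 * \<alpha>) * outside_var \<alpha> A d (q ^ n))) \<longlonglongrightarrow> outside_limit \<alpha> A d * c\<^sup>2"
    by (simp add: cV mult_ac)
  have R: "\<forall>\<^sub>F n in sequentially. 2 * v * ((q ^ n) powr (1 + 2 * \<alpha>) * outside_var \<alpha> A d (q ^ n)) < \<delta> / 4 * c\<^sup>2"
    by (rule order_tendstoD(2)[OF Rlim]) (use small c2 in \<open>simp add: \<delta>_def\<close>)
  have "\<forall>\<^sub>F k in sequentially. expectation (\<lambda>\<omega>. (\<xi> k \<omega>)\<^sup>2) > (1 - \<delta> / 8) * v"
    by (rule order_tendstoD(1)[OF second_lim]) (use v_pos d0 in simp)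
  then obtain k0 where k0: "\<And>k. k \<ge> k0 \<Longrightarrow> expectation (\<lambda>\<omega>. (\<xi> k \<omega>)\<^sup>2) > (1 - \<delta> / 8) * v"
    by (auto simp: eventually_sequentially)
  \<comment> \<open>Pushes the whole block beyond \<open>k0\<close>, where the second moments are
    close to v.\<close>
  have "filterlim (\<lambda>n. d / q ^ n) at_top sequentially" using q d by real_asymp
  then have kbig: "\<forall>\<^sub>F n in sequentially. d / q ^ n \<ge> ln (real (Suc k0))" by (simp add: filterlim_at_top)
  show ?thesis unfolding q_def[symmetric]
    using Lpos ppos Lbig msmall mD V1 V2 R kbig
  proof eventually_elim
    case (elim n)
    define B where "B = block A d n"
    define w where "w k = dweight \<alpha> (q ^ n) k" for k
    define Y where "Y \<omega> = (\<Sum>k\<in>B. w k * \<xi> k \<omega>)" for \<omega>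
    have B: "finite B" unfolding B_def by (rule finite_block[OF d])
    have qn: "q ^ n > 0" using q by simp
    have lpos: "l n > 0" using elim th c by (simp add: l_def)
    have Upos: "U n > 0" using elim c by (simp add: U_def)
    define Q where "Q = (l n)\<^sup>2 * U n"
    have lU: "l n * U n = sqrt \<theta> * c * p n"
      using elim c by (simp add: l_def U_def power2_eq_square field_simps)
    have QL: "Q = 2 * \<theta> * L n"
    proof -
      have "Q = l n * (l n * U n)" by (simp add: Q_def power2_eq_square)
      also have "\<dots> = 2 * (sqrt \<theta> * sqrt \<theta>) * L n" unfolding lU using elim c by (simp add: l_def)
      finally show ?thesis using th by simp
    qed
    have Q1: "Q * \<delta> \<ge> 32" and Q2: "Q * \<epsilon>\<^sup>2 \<ge> 8"
    proof -
      have "16 / (\<delta> * \<theta>) \<le> L n" "4 / (\<theta> * \<epsilon>\<^sup>2) \<le> L n"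
        using elim(3) d0 th e by (auto intro: order_trans[rotated])
      then show "Q * \<delta> \<ge> 32" "Q * \<epsilon>\<^sup>2 \<ge> 8" unfolding QL using d0 th e by (simp_all add: field_simps)
    qed
    have Q0: "Q > 0" using lpos Upos by (simp add: Q_def)
    have Us: "2 * U n * (q ^ n) powr (1 + 2 * \<alpha>) = c\<^sup>2"
    proof -
      have "(p n)\<^sup>2 = L n / (q ^ n) powr (1 + 2 * \<alpha>)"
        unfolding p_def L_def by (rule lil_scale_sq) (use qn elim(1) in \<open>auto simp: L_def\<close>)
      then show ?thesis using elim(1) q by (simp add: U_def)
    qed
    define S where "S = (q ^ n) powr (1 + 2 * \<alpha>)"
    have S: "S > 0" using q by (simp add: S_def)
    have Vu: "v * dvar \<alpha> (q ^ n) \<le> (1 + \<delta> / 4) * U n"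
    proof -
      have "(v * dvar \<alpha> (q ^ n)) * (2 * S) \<le> ((1 + \<delta> / 4) * U n) * (2 * S)"
        using elim(6) unfolding Us[symmetric] S_def[symmetric] by (simp add: mult_ac)
      then show ?thesis using S by simp
    qed
    have Vl: "(1 - \<delta> / 4) * U n \<le> v * dvar \<alpha> (q ^ n)"
    proof -
      have "((1 - \<delta> / 4) * U n) * (2 * S) \<le> (v * dvar \<alpha> (q ^ n)) * (2 * S)"
        using elim(7) unfolding Us[symmetric] S_def[symmetric] by (simp add: mult_ac)
      then show ?thesis using S by simp
    qed
    have Ru: "v * outside_var \<alpha> A d (q ^ n) \<le> \<delta> / 4 * U n"
    proof -
      have "(v * outside_var \<alpha> A d (q ^ n)) * (2 * S) \<le> (\<delta> / 4 * U n) * (2 * S)"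
        using elim(8) unfolding Us[symmetric] S_def[symmetric] by (simp add: mult_ac)
      then show ?thesis using S by simp
    qed
    have m0: "m n \<ge> 0" using lpos e C by (simp add: m_def)
    have wm: "\<bar>l n * \<sigma> * w k\<bar> * sqrt (real k) \<le> m n" if "0 \<le> \<sigma>" "\<sigma> \<le> 1 + \<epsilon>" for \<sigma> k
    proof -
      have "\<bar>l n * \<sigma> * w k\<bar> * sqrt (real k) = l n * \<sigma> * (w k * sqrt (real k))"
        using lpos that by (simp add: abs_mult w_def)
      also have "\<dots> \<le> l n * (1 + \<epsilon>) * (C * (q ^ n) powr (- max \<alpha> 0))"
        unfolding w_def by (rule mult_mono[OF mult_left_mono C(2)[OF qn]]) (use lpos that in auto)
      finally show ?thesis by (simp add: m_def)
    qed
    \<comment> \<open>Applied with \<sigma> = 1 + \<epsilon> and \<sigma> = 1 - \<epsilon>. Since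
      \<epsilon> <= 1/2, \<sigma>^2 >= 1/4, and Q \<delta> >= 32 then absorbs the bias term, which
      is below 1.\<close>
    have upper: "expectation (\<lambda>\<omega>. exp (l n * \<sigma> * Y \<omega>)) \<le> exp (Q / 2 * \<sigma>\<^sup>2 * (1 + \<delta>))"
      if \<sigma>: "1/2 \<le> \<sigma>" "\<sigma> \<le> 1 + \<epsilon>" for \<sigma>
    proof -
      have "expectation (\<lambda>\<omega>. exp (\<Sum>k\<in>B. (l n * \<sigma> * w k) * \<xi> k \<omega>)) \<le>
          exp (m n * D + (1 + m n) / 2 * v * ((l n * \<sigma>)\<^sup>2 * dvar \<alpha> (q ^ n)))"
      proof (rule mgf_upper[OF B m0])
        show "m n \<le> 1" using elim(4) d1 by simp
        show "(\<Sum>k\<in>B. (l n * \<sigma> * w k)\<^sup>2) \<le> (l n * \<sigma>)\<^sup>2 * dvar \<alpha> (q ^ n)"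
          unfolding power_mult_distrib[of "l n * \<sigma>"] sum_distrib_left[symmetric] w_def
          by (intro mult_left_mono sum_dweight_sq_le a qn B) auto
      qed (use wm \<sigma> in auto)
      also have "\<dots> \<le> exp (Q / 2 * \<sigma>\<^sup>2 * (1 + \<delta>))"
      proof -
        have "(1 + m n) / 2 * v * ((l n * \<sigma>)\<^sup>2 * dvar \<alpha> (q ^ n)) = (1 + m n) / 2 * (l n * \<sigma>)\<^sup>2 * (v * dvar \<alpha> (q ^ n))"
          by simp
        also have "\<dots> \<le> (1 + \<delta> / 48) / 2 * (l n * \<sigma>)\<^sup>2 * ((1 + \<delta> / 4) * U n)"
          by (rule mult_mono[OF mult_right_mono Vu]) (use elim(4) m0 v_pos dvar_nonneg[OF a qn] in auto)
        also have "\<dots> = Q / 2 * \<sigma>\<^sup>2 * ((1 + \<delta> / 48) * (1 + \<delta> / 4))"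
          by (simp add: Q_def power_mult_distrib)
        also have "\<dots> \<le> Q / 2 * \<sigma>\<^sup>2 * (1 + \<delta> * 3 / 4)"
        proof (rule mult_left_mono)
          have "\<delta> * \<delta> \<le> \<delta>" using d0 d1 by (simp add: mult_left_le)
          then show "(1 + \<delta> / 48) * (1 + \<delta> / 4) \<le> 1 + \<delta> * 3 / 4" using d0 by (simp add: field_simps)
        qed (use Q0 in simp)
        finally have 1: "(1 + m n) / 2 * v * ((l n * \<sigma>)\<^sup>2 * dvar \<alpha> (q ^ n)) \<le> Q / 2 * \<sigma>\<^sup>2 * (1 + \<delta> * 3 / 4)" .
        have "1/4 \<le> \<sigma>\<^sup>2" using power_mono[OF \<sigma>(1), of 2] by (simp add: power2_eq_square)
        then have "32 * (1/4) \<le> (Q * \<delta>) * \<sigma>\<^sup>2" using Q1 by (intro mult_mono) auto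
        then have "1 \<le> Q / 2 * \<sigma>\<^sup>2 * (\<delta> / 4)" by (simp add: mult_ac)
        then have "m n * D \<le> Q / 2 * \<sigma>\<^sup>2 * (\<delta> / 4)" using elim(5) by linarith
        then have "m n * D + (1 + m n) / 2 * v * ((l n * \<sigma>)\<^sup>2 * dvar \<alpha> (q ^ n)) \<le> Q / 2 * \<sigma>\<^sup>2 * (\<delta> / 4) + Q / 2 * \<sigma>\<^sup>2 * (1 + \<delta> * 3 / 4)"
          using 1 by (rule add_mono)
        also have "\<dots> = Q / 2 * \<sigma>\<^sup>2 * (1 + \<delta>)" by (simp add: field_simps)
        finally show ?thesis by (simp only: exp_le_cancel_iff)
      qed
      finally show ?thesis by (simp add: Y_def sum_distrib_left mult.assoc)
    qed
    have lower: "expectation (\<lambda>\<omega>. exp (l n * Y \<omega>)) \<ge> exp (Q / 2 * (1 - \<delta>))"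
    proof -
      have "exp (- 2 * m n * D + (1 - 6 * m n) / 2 * (Q * (1 - \<delta> * 5 / 8))) \<le>
          expectation (\<lambda>\<omega>. exp (\<Sum>k\<in>B. (l n * w k) * \<xi> k \<omega>))"
      proof (rule mgf_lower[OF B m0])
        show "m n \<le> 1 / 12" using elim(4) d1 by simp
        show "\<bar>l n * w k\<bar> * sqrt (real k) \<le> m n" for k using wm[of 1 k] e by simp
        have big: "(1 - \<delta> / 8) * v \<le> expectation (\<lambda>\<omega>. (\<xi> k \<omega>)\<^sup>2)" if "k \<in> B" for k
        proof -
          have "ln (real (Suc k0)) < ln (real k)" using that elim(9) by (auto simp: B_def block_def q_def)
          moreover have "0 \<le> ln (real (Suc k0))" by simp
          ultimately have "real (Suc k0) < real k" by (cases "k = 0") auto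
          then show ?thesis using k0[of k] by simp
        qed
        have "Q * (1 - \<delta> * 5 / 8) \<le> Q * ((1 - \<delta> / 8) * (1 - \<delta> / 2))"
        proof (rule mult_left_mono)
          have "0 \<le> \<delta> * \<delta>" using d0 by simp
          then show "1 - \<delta> * 5 / 8 \<le> (1 - \<delta> / 8) * (1 - \<delta> / 2)" by (simp add: field_simps)
        qed (use Q0 in simp)
        also have "\<dots> = (l n)\<^sup>2 * (1 - \<delta> / 8) * ((1 - \<delta> / 4) * U n - \<delta> / 4 * U n)"
          by (simp add: Q_def algebra_simps)
        also have "\<dots> \<le> (l n)\<^sup>2 * (1 - \<delta> / 8) * (v * (\<Sum>k\<in>B. (w k)\<^sup>2))"
        proof (rule mult_left_mono)
          have "v * dvar \<alpha> (q ^ n) \<le> v * ((\<Sum>k\<in>B. (w k)\<^sup>2) + outside_var \<alpha> A d (q ^ n))"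
            using dvar_le_block[OF a d, of n] v_pos by (intro mult_left_mono) (auto simp: B_def w_def q_def)
          then show "(1 - \<delta> / 4) * U n - \<delta> / 4 * U n \<le> v * (\<Sum>k\<in>B. (w k)\<^sup>2)"
            using Vl Ru by (simp add: distrib_left)
        qed (use d1 in simp)
        also have "\<dots> = (\<Sum>k\<in>B. (l n * w k)\<^sup>2 * ((1 - \<delta> / 8) * v))"
          by (simp add: sum_distrib_left sum_distrib_right power_mult_distrib mult_ac)
        also have "\<dots> \<le> (\<Sum>k\<in>B. (l n * w k)\<^sup>2 * expectation (\<lambda>\<omega>. (\<xi> k \<omega>)\<^sup>2))"
          by (intro sum_mono mult_left_mono big) auto
        finally show "Q * (1 - \<delta> * 5 / 8) \<le> (\<Sum>k\<in>B. (l n * w k)\<^sup>2 * expectation (\<lambda>\<omega>. (\<xi> k \<omega>)\<^sup>2))" .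
      qed
      moreover have "Q / 2 * (1 - \<delta>) \<le> - 2 * m n * D + (1 - 6 * m n) / 2 * (Q * (1 - \<delta> * 5 / 8))"
      proof -
        have "(1 - \<delta> / 8) / 2 * (Q * (1 - \<delta> * 5 / 8)) \<le> (1 - 6 * m n) / 2 * (Q * (1 - \<delta> * 5 / 8))"
          using elim(4) d1 Q0 by (intro mult_right_mono) auto
        moreover have "Q / 2 * (1 - \<delta> * 3 / 4) \<le> (1 - \<delta> / 8) / 2 * (Q * (1 - \<delta> * 5 / 8))"
        proof -
          have "0 \<le> \<delta> * \<delta>" using d0 by simp
          then have "1 - \<delta> * 3 / 4 \<le> (1 - \<delta> / 8) * (1 - \<delta> * 5 / 8)" by (simp add: field_simps)
          from mult_left_mono[OF this, of "Q / 2"] Q0 show ?thesis by simp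
        qed
        moreover have "Q / 2 * (1 - \<delta>) + 2 \<le> Q / 2 * (1 - \<delta> * 3 / 4)" using Q1 by (simp add: field_simps)
        ultimately show ?thesis using elim(5) by linarith
      qed
      ultimately have "exp (Q / 2 * (1 - \<delta>)) \<le> expectation (\<lambda>\<omega>. exp (\<Sum>k\<in>B. (l n * w k) * \<xi> k \<omega>))"
        by (meson exp_le_cancel_iff order_trans)
      then show ?thesis by (simp add: Y_def sum_distrib_left mult.assoc)
    qed
    have tl: "exp (- Q / 2 * (1 + 2 * \<epsilon> + \<delta>)) / 2 \<le> prob {\<omega>\<in>space M. (1 - \<epsilon>) * l n * U n \<le> Y \<omega>}"
    proof (rule tilted_lower_bound)
      show "integrable M (\<lambda>\<omega>. exp (t * Y \<omega>))" for t
        using mgf_sum(1)[OF B, of "\<lambda>k. t * w k"] by (simp add: Y_def sum_distrib_left mult.assoc)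
      show "Y \<in> borel_measurable M" unfolding Y_def by measurable
    qed (use lpos Upos e d0 Q2 lower upper in \<open>auto simp: Q_def \<delta>_def\<close>)
    have Ll: "exp (- L n) / 2 \<le> exp (- Q / 2 * (1 + 2 * \<epsilon> + \<delta>)) / 2"
    proof -
      have "\<theta> * (1 + 2 * \<epsilon> + \<delta>) \<le> 1" using e d1 by (simp add: \<theta>_def)
      then have "L n * (\<theta> * (1 + 2 * \<epsilon> + \<delta>)) \<le> L n * 1" using elim(1) by (intro mult_left_mono) auto
      then show ?thesis by (simp add: QL mult_ac)
    qed
    have thr: "(1 - \<epsilon>) * l n * U n = (1 - \<epsilon>) / sqrt (1 + 3 * \<epsilon>) * c * p n"
      using lU by (simp add: mult.assoc \<theta>_def real_sqrt_divide)
    show ?case using order_trans[OF Ll tl] unfolding thr by (simp only: L_def c_def p_def Y_def w_def B_def)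
  qed
qed

lemma indep_block_sums:
  assumes "disjoint_family F"
  shows "indep_vars (\<lambda>_. borel) (\<lambda>n \<omega>. \<Sum>k\<in>F n. (w n k :: real) * \<xi> k \<omega>) (UNIV :: nat set)"
proof -
  have "indep_vars (\<lambda>n. PiM (F n) (\<lambda>_. borel)) (\<lambda>n \<omega>. restrict (\<lambda>k. \<xi> k \<omega>) (F n)) UNIV"
    by (rule indep_vars_restrict[OF indep]) (use assms in auto)
  then have "indep_vars (\<lambda>_. borel) (\<lambda>n \<omega>. (\<lambda>x. \<Sum>k\<in>F n. w n k * x k) (restrict (\<lambda>k. \<xi> k \<omega>) (F n))) UNIV"
    by (rule indep_vars_compose2) measurable
  then show ?thesis by (simp cong: sum.cong)
qed

text \<open>Infinitely often the block sum exceeds its threshold, while the rest of the series is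
  eventually below \<epsilon> * c times the scale. Frequency near 0 is inherited from the grid
  points.\<close>

lemma AE_lower:
  assumes a: "\<alpha> > -1/2" and \<kappa>: "\<kappa> < lil_const \<alpha>"
  shows "AE \<omega> in M. \<exists>\<^sub>F s in at_right 0. \<kappa> * lil_scale \<alpha> s < (\<Sum>k. dweight \<alpha> s k * \<xi> k \<omega>)"
proof -
  define c where "c = lil_const \<alpha>"
  have c: "c > 0" unfolding c_def by (rule lil_const_pos[OF a])
  \<comment> \<open>The quotient is the loss inside the block, the subtracted term the allowance for
    the remainder; both losses vanish as \<epsilon> tends to 0.\<close>
  have "((\<lambda>\<epsilon>. (1 - \<epsilon>) / sqrt (1 + 3 * \<epsilon>) * c - \<epsilon> * c) \<longlongrightarrow> (1 - 0) / sqrt (1 + 3 * 0) * c - 0 * c) (at_right 0)"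
    by (intro tendsto_intros) auto
  then have "\<forall>\<^sub>F \<epsilon> in at_right 0. \<kappa> < (1 - \<epsilon>) / sqrt (1 + 3 * \<epsilon>) * c - \<epsilon> * c"
    using \<kappa> by (intro order_tendstoD) (auto simp: c_def)
  moreover have "\<forall>\<^sub>F \<epsilon> in at_right 0. \<epsilon> \<in> {0<..<1/2::real}" by (rule eventually_at_right_real) simp
  ultimately have "\<forall>\<^sub>F \<epsilon> in at_right 0. \<kappa> < (1 - \<epsilon>) / sqrt (1 + 3 * \<epsilon>) * c - \<epsilon> * c \<and> \<epsilon> \<in> {0<..<1/2}"
    by (rule eventually_conj)
  then obtain \<epsilon> where \<epsilon>: "\<kappa> < (1 - \<epsilon>) / sqrt (1 + 3 * \<epsilon>) * c - \<epsilon> * c" and "\<epsilon> \<in> {0<..<1/2}"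
    using eventually_happens'[OF trivial_limit_at_right_real] by blast
  then have e: "0 < \<epsilon>" "\<epsilon> \<le> 1/2" by auto
  have "\<epsilon>\<^sup>2 / 40 > 0" using e by simp
  then obtain A d where d: "0 < d" "d < A" and small: "outside_limit \<alpha> A d < \<epsilon>\<^sup>2 / 40"
    using outside_limit_small[OF a] by metis
  define q where "q = d / A"
  have q: "0 < q" "q < 1" using d by (auto simp: q_def)
  note qlim = geometric_at_right_0[OF q]
  define y where "y n = (1 - \<epsilon>) / sqrt (1 + 3 * \<epsilon>) * c * lil_scale \<alpha> (q ^ n)" for n
  define Y where "Y n \<omega> = (\<Sum>k\<in>block A d n. dweight \<alpha> (q ^ n) k * \<xi> k \<omega>)" for n \<omega>
  have "\<not> summable (\<lambda>n. prob {\<omega>\<in>space M. y n \<le> Y n \<omega>})"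
  proof
    assume *: "summable (\<lambda>n. prob {\<omega>\<in>space M. y n \<le> Y n \<omega>})"
    have "\<forall>\<^sub>F n in sequentially. norm (exp (- ln (ln (1 / q ^ n))) / 2) \<le> prob {\<omega>\<in>space M. y n \<le> Y n \<omega>}"
      using block_prob_lower[OF a d e small] by (simp add: y_def Y_def c_def q_def)
    from summable_comparison_test_ev[OF this *]
    have "summable (\<lambda>n. exp (- ln (ln (1 / q ^ n))) / 2)" .
    from summable_mult[OF this, of 2] loglog_geometric_not_summable[OF q] show False by simp
  qed
  moreover have "indep_vars (\<lambda>_. borel) Y UNIV"
    unfolding Y_def by (rule indep_block_sums[OF disjoint_block[OF d]])
  ultimately have Yio: "AE \<omega> in M. \<exists>\<^sub>F n in sequentially. y n \<le> Y n \<omega>"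
    by (intro AE_frequently_ge_of_not_summable)
  have "outside_limit \<alpha> A d < \<epsilon>\<^sup>2" using small zero_le_power2[of \<epsilon>] by linarith
  then have "outside_limit \<alpha> A d * c\<^sup>2 < \<epsilon>\<^sup>2 * c\<^sup>2" using c by (intro mult_strict_right_mono) auto
  then have small': "outside_limit \<alpha> A d * (lil_const \<alpha>)\<^sup>2 < (\<epsilon> * c)\<^sup>2" by (simp add: c_def power_mult_distrib)
  have "\<epsilon> * c > 0" using e c by simp
  from AE_partial_sums[OF a] Yio AE_remainder[OF a d this small']
  show ?thesis
  proof eventually_elim
    case (elim \<omega>)
    let ?X = "\<lambda>s. \<Sum>k. dweight \<alpha> s k * \<xi> k \<omega>"
    have lim: "(\<lambda>N. \<Sum>k<N. dweight \<alpha> s k * \<xi> k \<omega>) \<longlonglongrightarrow> ?X s" if "s > 0" for s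
      by (rule summable_LIMSEQ[OF dirichlet_weighted_series(1)[OF _ that]]) (use elim in blast)
    have "\<forall>\<^sub>F n in sequentially. lil_scale \<alpha> (q ^ n) > 0"
      using eventually_compose_filterlim[OF lil_scale_pos qlim] .
    from eventually_conj[OF this elim(3)[folded q_def]]
    have "\<exists>\<^sub>F n in sequentially. y n \<le> Y n \<omega> \<and> lil_scale \<alpha> (q ^ n) > 0 \<and>
        (\<exists>\<^sub>F N in sequentially. \<bar>\<Sum>k\<in>{..<N} - block A d n. dweight \<alpha> (q ^ n) k * \<xi> k \<omega>\<bar> < \<epsilon> * c * lil_scale \<alpha> (q ^ n))"
      by (rule frequently_eventually_frequently[OF elim(2)])
    then have fr: "\<exists>\<^sub>F n in sequentially. \<kappa> * lil_scale \<alpha> (q ^ n) < ?X (q ^ n)"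
    proof (rule frequently_elim1)
      fix n assume n: "y n \<le> Y n \<omega> \<and> lil_scale \<alpha> (q ^ n) > 0 \<and>
        (\<exists>\<^sub>F N in sequentially. \<bar>\<Sum>k\<in>{..<N} - block A d n. dweight \<alpha> (q ^ n) k * \<xi> k \<omega>\<bar> < \<epsilon> * c * lil_scale \<alpha> (q ^ n))"
      have qn: "q ^ n > 0" using q by simp
      have fB: "finite (block A d n)" by (rule finite_block[OF d])
      then obtain N0 where N0: "block A d n \<subseteq> {..<N0}" using finite_nat_iff_bounded by auto
      have ev: "\<forall>\<^sub>F N in sequentially. (\<Sum>k\<in>{..<N} - block A d n. dweight \<alpha> (q ^ n) k * \<xi> k \<omega>) =
          (\<Sum>k<N. dweight \<alpha> (q ^ n) k * \<xi> k \<omega>) - Y n \<omega>"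
        using eventually_ge_at_top[of N0]
      proof eventually_elim
        case (elim N)
        then show ?case using N0 fB unfolding Y_def by (intro sum_diff) auto
      qed
      have "(\<lambda>N. \<Sum>k\<in>{..<N} - block A d n. dweight \<alpha> (q ^ n) k * \<xi> k \<omega>) \<longlonglongrightarrow> ?X (q ^ n) - Y n \<omega>"
        by (rule Lim_transform_eventually[OF tendsto_diff[OF lim[OF qn] tendsto_const]])
           (use ev in eventually_elim, simp)
      then have "\<bar>?X (q ^ n) - Y n \<omega>\<bar> \<le> \<epsilon> * c * lil_scale \<alpha> (q ^ n)"
        by (intro LIMSEQ_frequently_le[OF tendsto_rabs]) (use n in auto)
      then have "y n - \<epsilon> * c * lil_scale \<alpha> (q ^ n) \<le> ?X (q ^ n)" using n by linarith
      moreover have "\<kappa> * lil_scale \<alpha> (q ^ n) < ((1 - \<epsilon>) / sqrt (1 + 3 * \<epsilon>) * c - \<epsilon> * c) * lil_scale \<alpha> (q ^ n)"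
        using \<epsilon> n by (intro mult_strict_right_mono) auto
      ultimately show "\<kappa> * lil_scale \<alpha> (q ^ n) < ?X (q ^ n)" unfolding y_def left_diff_distrib by linarith
    qed
    show ?case
    proof (rule ccontr)
      assume "\<not> (\<exists>\<^sub>F s in at_right 0. \<kappa> * lil_scale \<alpha> s < ?X s)"
      then have "\<forall>\<^sub>F s in at_right 0. \<not> \<kappa> * lil_scale \<alpha> s < ?X s" by (simp add: not_frequently)
      then have "\<forall>\<^sub>F n in sequentially. \<not> \<kappa> * lil_scale \<alpha> (q ^ n) < ?X (q ^ n)"
        by (rule eventually_compose_filterlim[OF _ qlim])
      with fr show False by (simp add: frequently_def)
    qed
  qed
qed

end

section \<open>Truncation and conclusion\<close>

text \<open>Telescoping: for a = sqrt n and b = sqrt (n + 1), (b - a)(b + a) = 1 and a + b <= 2 b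
  give 1/b <= 2 (b - a).\<close>

lemma sum_inverse_sqrt_le: "(\<Sum>k=1..n. 1 / sqrt (real k)) \<le> 2 * sqrt (real n)"
proof (induction n)
  case (Suc n)
  define a where "a = sqrt (real n)"
  define b where "b = sqrt (real (Suc n))"
  have ab: "0 \<le> a" "a \<le> b" "b > 0" "b * b - a * a = 1" by (auto simp: a_def b_def)
  have "1 \<le> 2 * (b - a) * b"
  proof -
    have "0 \<le> (b - a) * (b - a)" by simp
    then show ?thesis using ab(4) by (simp add: algebra_simps)
  qed
  then have "1 / b \<le> 2 * b - 2 * a" using ab by (simp add: field_simps)
  then show ?case using Suc.IH by (simp add: a_def[symmetric] b_def[symmetric] del: of_nat_Suc)
qed simp

lemma nat_floor_square_bound:
  fixes y :: real assumes "sqrt (real k) < \<bar>y\<bar>" shows "k \<le> nat \<lfloor>y\<^sup>2\<rfloor>"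
proof -
  have "(sqrt (real k))\<^sup>2 < \<bar>y\<bar>\<^sup>2" using assms by (intro power_strict_mono) auto
  then have "real k < y\<^sup>2" by simp
  then show ?thesis by linarith
qed

text \<open>For a fixed value y only indices k <= y^2 contribute. Taking expectations bounds both
  sums by the second moment: the first yields the bias condition of the truncated sequence, the
  second the Borel-Cantelli sum for the truncation. The 1 counts the index 0.\<close>

lemma sum_truncation_le:
  fixes y :: real assumes F: "finite F"
  shows "(\<Sum>k\<in>F. if sqrt (real k) < \<bar>y\<bar> then \<bar>y\<bar> / sqrt (real k) else 0) \<le> 2 * y\<^sup>2"
    and "(\<Sum>k\<in>F. if sqrt (real k) < \<bar>y\<bar> then 1 else 0) \<le> 1 + y\<^sup>2"
proof -
  define n where "n = nat \<lfloor>y\<^sup>2\<rfloor>"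
  have n: "real n \<le> y\<^sup>2" by (simp add: n_def)
  have "(\<Sum>k\<in>F. if sqrt (real k) < \<bar>y\<bar> then \<bar>y\<bar> / sqrt (real k) else 0) \<le> (\<Sum>k=0..n. \<bar>y\<bar> / sqrt (real k))"
    unfolding sum.inter_filter[OF F, symmetric]
    by (rule sum_mono2) (auto simp: n_def dest: nat_floor_square_bound)
  also have "\<dots> = \<bar>y\<bar> * (\<Sum>k=1..n. 1 / sqrt (real k))"
    by (simp add: sum.atLeast_Suc_atMost sum_distrib_left)
  also have "\<dots> \<le> \<bar>y\<bar> * (2 * \<bar>y\<bar>)"
  proof (rule mult_left_mono)
    have "sqrt (real n) \<le> \<bar>y\<bar>" using real_sqrt_le_mono[OF n] by simp
    then show "(\<Sum>k=1..n. 1 / sqrt (real k)) \<le> 2 * \<bar>y\<bar>" using sum_inverse_sqrt_le[of n] by linarith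
  qed simp
  also have "\<dots> = 2 * y\<^sup>2" by (simp add: power2_eq_square)
  finally show "(\<Sum>k\<in>F. if sqrt (real k) < \<bar>y\<bar> then \<bar>y\<bar> / sqrt (real k) else 0) \<le> 2 * y\<^sup>2" .
  have "(\<Sum>k\<in>F. if sqrt (real k) < \<bar>y\<bar> then 1 else 0) \<le> (\<Sum>k=0..n. 1::real)"
    unfolding sum.inter_filter[OF F, symmetric]
    by (rule sum_mono2) (auto simp: n_def dest: nat_floor_square_bound)
  then show "(\<Sum>k\<in>F. if sqrt (real k) < \<bar>y\<bar> then 1 else 0) \<le> 1 + y\<^sup>2" using n by simp
qed

definition truncate_at :: "nat \<Rightarrow> real \<Rightarrow> real" where
  "truncate_at k y = (if \<bar>y\<bar> \<le> sqrt (real k) then y else 0)"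

lemma truncate_at_measurable [measurable]: "truncate_at k \<in> borel_measurable borel"
  unfolding truncate_at_def by measurable

lemma abs_truncate_at_le: "\<bar>truncate_at k y\<bar> \<le> \<bar>y\<bar>" "\<bar>truncate_at k y\<bar> \<le> sqrt (real k)"
  by (auto simp: truncate_at_def)

lemma truncate_at_sq_le: "(truncate_at k y)\<^sup>2 \<le> y\<^sup>2"
  by (auto simp: truncate_at_def)

section \<open>The i.i.d. sequence and its truncation\<close>

locale iid_square_integrable = prob_space M for M :: "'a measure" +
  fixes \<eta> :: "nat \<Rightarrow> 'a \<Rightarrow> real"
  assumes meas [measurable]: "\<And>k. \<eta> k \<in> borel_measurable M"
    and indep: "indep_vars (\<lambda>_. borel) \<eta> UNIV"
    and ident: "\<And>k. distr M borel (\<eta> k) = distr M borel (\<eta> 1)"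
    and int1: "integrable M (\<eta> 1)"
    and mean0: "expectation (\<eta> 1) = 0"
    and int2: "integrable M (\<lambda>\<omega>. (\<eta> 1 \<omega>)\<^sup>2)"
    and var_pos: "expectation (\<lambda>\<omega>. (\<eta> 1 \<omega>)\<^sup>2) > 0"
begin

abbreviation \<sigma>2 :: real where "\<sigma>2 \<equiv> expectation (\<lambda>\<omega>. (\<eta> 1 \<omega>)\<^sup>2)"

abbreviation \<xi> :: "nat \<Rightarrow> 'a \<Rightarrow> real" where "\<xi> \<equiv> \<lambda>k \<omega>. truncate_at k (\<eta> k \<omega>)"

lemma expectation_ident:
  fixes f :: "real \<Rightarrow> real"
  assumes [measurable]: "f \<in> borel_measurable borel"
  shows "expectation (\<lambda>\<omega>. f (\<eta> k \<omega>)) = expectation (\<lambda>\<omega>. f (\<eta> 1 \<omega>))"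
  using integral_distr[of "\<eta> k" M borel f] integral_distr[of "\<eta> 1" M borel f] ident[of k] by simp

lemma int_truncate [simp]: "integrable M (\<lambda>\<omega>. truncate_at k (\<eta> 1 \<omega>))"
  by (rule Bochner_Integration.integrable_bound[OF int1]) (use abs_truncate_at_le in auto)

lemma int_truncate_sq [simp]: "integrable M (\<lambda>\<omega>. (truncate_at k (\<eta> 1 \<omega>))\<^sup>2)"
  by (rule Bochner_Integration.integrable_bound[OF int2]) (use truncate_at_sq_le in auto)

text \<open>Since \<eta> is centred, the mean of the truncated variable is minus the mean of the
  discarded part. By identical distribution all k may use the same variable \<open>\<eta> 1\<close>,
  so the pointwise bound applies under the expectation.\<close>

lemma truncated_mean_sum_le:
  assumes F: "finite F" shows "(\<Sum>k\<in>F. \<bar>expectation (\<xi> k)\<bar> / sqrt (real k)) \<le> 2 * \<sigma>2"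
proof -
  let ?d = "\<lambda>k \<omega>. if sqrt (real k) < \<bar>\<eta> 1 \<omega>\<bar> then \<bar>\<eta> 1 \<omega>\<bar> / sqrt (real k) else 0"
  have eq: "?d k \<omega> = \<bar>\<eta> 1 \<omega> - truncate_at k (\<eta> 1 \<omega>)\<bar> / sqrt (real k)" for k \<omega>
    by (auto simp: truncate_at_def)
  have intd: "integrable M (?d k)" for k
    unfolding eq by (intro Bochner_Integration.integrable_divide integrable_abs Bochner_Integration.integrable_diff int1 int_truncate)
  have "(\<Sum>k\<in>F. \<bar>expectation (\<xi> k)\<bar> / sqrt (real k)) \<le> (\<Sum>k\<in>F. expectation (?d k))"
  proof (rule sum_mono)
    fix k
    have "expectation (\<xi> k) = - expectation (\<lambda>\<omega>. \<eta> 1 \<omega> - truncate_at k (\<eta> 1 \<omega>))"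
      using expectation_ident[of "truncate_at k" k] int1 mean0 by (simp del: One_nat_def)
    then have "\<bar>expectation (\<xi> k)\<bar> \<le> expectation (\<lambda>\<omega>. \<bar>\<eta> 1 \<omega> - truncate_at k (\<eta> 1 \<omega>)\<bar>)"
      using integral_norm_bound[of M "\<lambda>\<omega>. \<eta> 1 \<omega> - truncate_at k (\<eta> 1 \<omega>)"] by simp
    then have "\<bar>expectation (\<xi> k)\<bar> / sqrt (real k) \<le> expectation (\<lambda>\<omega>. \<bar>\<eta> 1 \<omega> - truncate_at k (\<eta> 1 \<omega>)\<bar>) / sqrt (real k)"
      by (intro divide_right_mono) auto
    then show "\<bar>expectation (\<xi> k)\<bar> / sqrt (real k) \<le> expectation (?d k)" unfolding eq by simp
  qed
  also have "\<dots> = expectation (\<lambda>\<omega>. \<Sum>k\<in>F. ?d k \<omega>)"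
    by (rule Bochner_Integration.integral_sum[symmetric]) (rule intd)
  also have "\<dots> \<le> expectation (\<lambda>\<omega>. 2 * (\<eta> 1 \<omega>)\<^sup>2)"
    by (intro integral_mono Bochner_Integration.integrable_sum intd integrable_mult_right int2 sum_truncation_le(1) F)
  finally show ?thesis by simp
qed

lemma truncated_second_moment: 
  shows "expectation (\<lambda>\<omega>. (\<xi> k \<omega>)\<^sup>2) \<le> \<sigma>2"
    and "(\<lambda>k. expectation (\<lambda>\<omega>. (\<xi> k \<omega>)\<^sup>2)) \<longlonglongrightarrow> \<sigma>2"
proof -
  have eq: "expectation (\<lambda>\<omega>. (\<xi> k \<omega>)\<^sup>2) = expectation (\<lambda>\<omega>. (truncate_at k (\<eta> 1 \<omega>))\<^sup>2)" for k
    using expectation_ident[of "\<lambda>y. (truncate_at k y)\<^sup>2" k] by simp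
  show "expectation (\<lambda>\<omega>. (\<xi> k \<omega>)\<^sup>2) \<le> \<sigma>2"
    unfolding eq by (intro integral_mono int_truncate_sq int2 truncate_at_sq_le)
  show "(\<lambda>k. expectation (\<lambda>\<omega>. (\<xi> k \<omega>)\<^sup>2)) \<longlonglongrightarrow> \<sigma>2"
    unfolding eq
  proof (rule integral_dominated_convergence[where w = "\<lambda>\<omega>. (\<eta> 1 \<omega>)\<^sup>2"])
    have "(\<lambda>k. (truncate_at k y)\<^sup>2) \<longlonglongrightarrow> y\<^sup>2" for y
    proof (rule tendsto_eventually)
      have "filterlim (\<lambda>k. sqrt (real k)) at_top sequentially" by real_asymp
      then have "\<forall>\<^sub>F k in sequentially. \<bar>y\<bar> \<le> sqrt (real k)" by (simp add: filterlim_at_top)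
      then show "\<forall>\<^sub>F k in sequentially. (truncate_at k y)\<^sup>2 = y\<^sup>2"
        by eventually_elim (simp add: truncate_at_def)
    qed
    then show "AE \<omega> in M. (\<lambda>k. (truncate_at k (\<eta> 1 \<omega>))\<^sup>2) \<longlonglongrightarrow> (\<eta> 1 \<omega>)\<^sup>2" by simp
  qed (use int2 truncate_at_sq_le in auto)
qed

lemma truncated_sequence_xi: "truncated_sequence M \<xi> \<sigma>2 (2 * \<sigma>2)"
proof unfold_locales
  show "indep_vars (\<lambda>_. borel) \<xi> UNIV" by (rule indep_vars_compose2[OF indep]) simp
qed (use abs_truncate_at_le truncated_second_moment truncated_mean_sum_le var_pos in auto)

text \<open>Supplies the downward oscillation: the lower bound for the negated sequence is used for
  the liminf.\<close>

lemma truncated_sequence_neg_xi: "truncated_sequence M (\<lambda>k \<omega>. - \<xi> k \<omega>) \<sigma>2 (2 * \<sigma>2)"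
proof unfold_locales
  show "indep_vars (\<lambda>_. borel) (\<lambda>k \<omega>. - \<xi> k \<omega>) UNIV"
    by (rule indep_vars_compose2[OF indep, of "\<lambda>k y. - truncate_at k y"]) simp
qed (use abs_truncate_at_le truncated_second_moment truncated_mean_sum_le var_pos in auto)

lemma AE_eventually_truncate_eq: "AE \<omega> in M. \<forall>\<^sub>F k in sequentially. \<eta> k \<omega> = \<xi> k \<omega>"
proof -
  define A where "A k = {\<omega>\<in>space M. sqrt (real k) < \<bar>\<eta> k \<omega>\<bar>}" for k
  have [measurable]: "A k \<in> sets M" for k unfolding A_def by measurable
  have inti: "integrable M (\<lambda>\<omega>. if sqrt (real k) < \<bar>\<eta> 1 \<omega>\<bar> then 1 else 0 :: real)" for k
    by (rule integrable_const_bound[where B = 1]) auto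
  have pA: "prob (A k) = expectation (\<lambda>\<omega>. if sqrt (real k) < \<bar>\<eta> 1 \<omega>\<bar> then 1 else 0)" for k
  proof -
    have "prob (A k) = expectation (indicator (A k))" by (simp add: A_def)
    also have "\<dots> = expectation (\<lambda>\<omega>. if sqrt (real k) < \<bar>\<eta> k \<omega>\<bar> then 1 else 0)"
      by (intro Bochner_Integration.integral_cong) (auto simp: A_def)
    also have "\<dots> = expectation (\<lambda>\<omega>. if sqrt (real k) < \<bar>\<eta> 1 \<omega>\<bar> then 1 else 0)"
      by (rule expectation_ident[of "\<lambda>y. if sqrt (real k) < \<bar>y\<bar> then 1 else 0"]) measurable
    finally show ?thesis .
  qed
  have "summable (\<lambda>k. prob (A k))"
  proof (rule bounded_imp_summable)
    fix n
    have "(\<Sum>k\<le>n. prob (A k)) = expectation (\<lambda>\<omega>. \<Sum>k\<le>n. if sqrt (real k) < \<bar>\<eta> 1 \<omega>\<bar> then 1 else 0)"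
      unfolding pA by (rule Bochner_Integration.integral_sum[symmetric]) (rule inti)
    also have "\<dots> \<le> expectation (\<lambda>\<omega>. 1 + (\<eta> 1 \<omega>)\<^sup>2)"
      by (intro integral_mono Bochner_Integration.integrable_sum inti Bochner_Integration.integrable_add
          int2 integrable_const sum_truncation_le(2)) simp
    finally show "(\<Sum>k\<le>n. prob (A k)) \<le> expectation (\<lambda>\<omega>. 1 + (\<eta> 1 \<omega>)\<^sup>2)" .
  qed simp
  then have "AE \<omega> in M. \<forall>\<^sub>F k in sequentially. \<omega> \<in> space M - A k"
    by (intro borel_cantelli_AE1) (auto simp: emeasure_eq_measure)
  then show ?thesis
    by eventually_elim (erule eventually_mono, auto simp: A_def truncate_at_def)
qed

end

section \<open>Transfer to the original variables and conclusion\<close>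

lemma rand_series_eq:
  assumes "summable (\<lambda>k. dweight \<alpha> s k * \<eta> k \<omega>)"
  shows "rand_series \<alpha> \<eta> s \<omega> = (\<Sum>k. dweight \<alpha> s k * \<eta> k \<omega>)"
  \<comment> \<open>\<open>rand_series\<close> starts at the index 2; the two weights before it
    vanish.\<close>
  using suminf_split_initial_segment[OF assms, of 2]
  by (simp add: rand_series_def dweight_def eval_nat_numeral)

text \<open>Changing finitely many terms changes the sum by a bounded amount, which is negligible against
  the normalisation.\<close>

lemma rand_series_oscillation_transfer:
  fixes y :: "nat \<Rightarrow> real"
  assumes a: "\<alpha> > -1/2" and c: "c > 0"
    and ev: "\<forall>\<^sub>F k in sequentially. \<eta> k \<omega> = y k"
    and ps: "\<And>j::nat. \<exists>C. \<forall>n. \<bar>\<Sum>k<n. dweight \<alpha> 0 k * y k\<bar> \<le> C * real n powr (1 / real (Suc j))"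
    and upper: "\<And>j::nat. \<forall>\<^sub>F s in at_right 0. \<bar>\<Sum>k. dweight \<alpha> s k * y k\<bar> < c * (1 + 1 / real (Suc j)) * lil_scale \<alpha> s"
    and low: "\<And>j::nat. \<exists>\<^sub>F s in at_right 0. c * (1 - 1 / real (Suc j)) * lil_scale \<alpha> s < (\<Sum>k. dweight \<alpha> s k * y k)"
      "\<And>j::nat. \<exists>\<^sub>F s in at_right 0. c * (1 - 1 / real (Suc j)) * lil_scale \<alpha> s < - (\<Sum>k. dweight \<alpha> s k * y k)"
  defines "f \<equiv> \<lambda>s. rand_series \<alpha> \<eta> s \<omega> / (c * lil_scale \<alpha> s)"
  shows "continuous_on {0<..<exp (-1)} f"
    and "\<And>\<kappa>. \<kappa> > 1 \<Longrightarrow> \<forall>\<^sub>F s in at_right 0. \<bar>f s\<bar> < \<kappa>"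
    and "\<And>\<kappa>. \<kappa> < 1 \<Longrightarrow> \<exists>\<^sub>F s in at_right 0. \<kappa> < f s"
    and "\<And>\<kappa>. \<kappa> < 1 \<Longrightarrow> \<exists>\<^sub>F s in at_right 0. \<kappa> < - f s"
proof -
  let ?Y = "\<lambda>s. \<Sum>k. dweight \<alpha> s k * y k"
  obtain K where K: "\<And>k. k \<ge> K \<Longrightarrow> \<eta> k \<omega> = y k" using ev by (auto simp: eventually_sequentially)
  \<comment> \<open>The difference of the two series. The weights decrease in s, so its absolute
    value stays below its analogue \<open>B\<close> with weights at s = 0.\<close>
  define R where "R s = (\<Sum>k<K. dweight \<alpha> s k * (\<eta> k \<omega> - y k))" for s
  define B where "B = (\<Sum>k<K. dweight \<alpha> 0 k * \<bar>\<eta> k \<omega> - y k\<bar>)"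
  have X: "rand_series \<alpha> \<eta> s \<omega> = ?Y s + R s" if s: "s > 0" for s
  proof -
    have "(\<lambda>k. dweight \<alpha> s k * (\<eta> k \<omega> - y k)) sums R s"
      unfolding R_def by (rule sums_finite) (use K in \<open>auto simp: not_less\<close>)
    from sums_add[OF summable_sums[OF dirichlet_weighted_series(1)[OF ps s]] this]
    have *: "(\<lambda>k. dweight \<alpha> s k * \<eta> k \<omega>) sums (?Y s + R s)" by (simp add: algebra_simps)
    then show ?thesis using rand_series_eq[where \<eta> = \<eta> and \<omega> = \<omega>, OF sums_summable[OF *]] by (simp add: sums_iff)
  qed
  have RB: "\<bar>R s\<bar> \<le> B" if "s > 0" for s
    unfolding R_def B_def
    by (rule order_trans[OF sum_abs]) (use that in \<open>auto simp: abs_mult intro!: sum_mono mult_right_mono dweight_antimono\<close>)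
  have scale_pos: "lil_scale \<alpha> s > 0" if "s \<in> {0<..<exp (-1)}" for s
  proof -
    have "ln s < -1" using that by (metis exp_less_cancel_iff exp_ln greaterThanLessThan_iff)
    then have "ln (1 / s) > 1" using that by (simp add: ln_div)
    then have "ln (ln (1 / s)) > 0" by (rule ln_gt_zero)
    then show ?thesis using that by (simp add: lil_scale_def)
  qed
  show "continuous_on {0<..<exp (-1)} f"
  proof -
    have "continuous_on {0<..<exp (-1)} (\<lambda>s. ?Y s + R s)"
      unfolding R_def
      by (intro continuous_intros continuous_on_subset[OF dirichlet_weighted_series(2)[OF ps]]) auto
    then have 1: "continuous_on {0<..<exp (-1)} (\<lambda>s. rand_series \<alpha> \<eta> s \<omega>)"
      by (rule continuous_on_eq) (simp add: X)
    have "ln (1 / s) > 1" if "s \<in> {0<..<exp (-1)}" for s :: real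
    proof -
      have "ln s < -1" using that by (metis exp_less_cancel_iff exp_ln greaterThanLessThan_iff)
      then show ?thesis using that by (simp add: ln_div)
    qed
    then have 2: "continuous_on {0<..<exp (-1)} (lil_scale \<alpha>)"
      unfolding lil_scale_def by (intro continuous_intros) force+
    show ?thesis unfolding f_def
      by (intro continuous_intros 1 2) (use scale_pos c in \<open>force dest: scale_pos\<close>)
  qed
  have Bsmall: "\<forall>\<^sub>F s in at_right 0. \<bar>R s\<bar> < e * lil_scale \<alpha> s \<and> 0 < s \<and> 0 < lil_scale \<alpha> s" if e: "e > 0" for e
  proof -
    have "\<forall>\<^sub>F s in at_right 0. lil_scale \<alpha> s > B / e"
      using lil_scale_at_top[OF a] by (simp add: filterlim_at_top_dense)
    then show ?thesis using eventually_at_right_less[of 0] lil_scale_pos[of \<alpha>]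
    proof eventually_elim
      case (elim s)
      then have "B < e * lil_scale \<alpha> s" using e by (simp add: field_simps)
      then show ?case using RB[OF elim(2)] elim by simp
    qed
  qed
  have arch: "\<exists>j. 1 / real (Suc j) < x" if "x > 0" for x :: real
    using reals_Archimedean[OF that] by (simp add: inverse_eq_divide)
  show "\<forall>\<^sub>F s in at_right 0. \<bar>f s\<bar> < \<kappa>" if \<kappa>: "\<kappa> > 1" for \<kappa>
  proof -
    obtain j where j: "1 / real (Suc j) < \<kappa> - 1" using arch[of "\<kappa> - 1"] \<kappa> by auto
    define e where "e = c * (\<kappa> - 1 - 1 / real (Suc j))"
    have "e > 0" using j c by (simp add: e_def)
    from upper[of j] Bsmall[OF this] show ?thesis
    proof eventually_elim
      case (elim s)
      have "\<bar>?Y s + R s\<bar> < c * (1 + 1 / real (Suc j)) * lil_scale \<alpha> s + e * lil_scale \<alpha> s" using elim by linarith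
      also have "\<dots> = \<kappa> * (c * lil_scale \<alpha> s)" by (simp add: e_def algebra_simps)
      finally have "\<bar>?Y s + R s\<bar> < \<kappa> * (c * lil_scale \<alpha> s)" .
      moreover have "c * lil_scale \<alpha> s > 0" using elim c by simp
      ultimately show ?case using elim X[of s] by (simp add: f_def pos_divide_less_eq)
    qed
  qed
  \<comment> \<open>Taking \<tau> = 1 and \<tau> = -1 treats both directions at once.\<close>
  have low_gen: "\<exists>\<^sub>F s in at_right 0. \<kappa> < \<tau> * f s"
    if \<kappa>: "\<kappa> < 1" and \<tau>: "\<bar>\<tau>\<bar> = 1"
      and lo: "\<And>j::nat. \<exists>\<^sub>F s in at_right 0. c * (1 - 1 / real (Suc j)) * lil_scale \<alpha> s < \<tau> * ?Y s" for \<kappa> \<tau>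
  proof -
    obtain j where j: "1 / real (Suc j) < 1 - \<kappa>" using arch[of "1 - \<kappa>"] \<kappa> by auto
    define e where "e = c * (1 - 1 / real (Suc j) - \<kappa>)"
    have "e > 0" using j c by (simp add: e_def)
    from frequently_eventually_frequently[OF lo[of j] Bsmall[OF this]] show ?thesis
    proof (rule frequently_elim1)
      fix s assume s: "c * (1 - 1 / real (Suc j)) * lil_scale \<alpha> s < \<tau> * ?Y s \<and>
        \<bar>R s\<bar> < e * lil_scale \<alpha> s \<and> 0 < s \<and> 0 < lil_scale \<alpha> s"
      have "\<kappa> * (c * lil_scale \<alpha> s) = c * (1 - 1 / real (Suc j)) * lil_scale \<alpha> s - e * lil_scale \<alpha> s"
        by (simp add: e_def algebra_simps)
      also have "\<dots> < \<tau> * ?Y s - \<bar>R s\<bar>" using s by linarith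
      also have "\<dots> \<le> \<tau> * ?Y s + \<tau> * R s"
      proof -
        have "\<bar>\<tau> * R s\<bar> = \<bar>R s\<bar>" using \<tau> by (simp add: abs_mult)
        then show ?thesis by linarith
      qed
      finally have "\<kappa> * (c * lil_scale \<alpha> s) < \<tau> * rand_series \<alpha> \<eta> s \<omega>" using X[of s] s by (simp add: distrib_left)
      moreover have "c * lil_scale \<alpha> s > 0" using s c by simp
      ultimately show "\<kappa> < \<tau> * f s" by (simp add: f_def pos_less_divide_eq)
    qed
  qed
  show "\<exists>\<^sub>F s in at_right 0. \<kappa> < f s" if "\<kappa> < 1" for \<kappa>
    using low_gen[OF that, of 1] low(1) by simp
  show "\<exists>\<^sub>F s in at_right 0. \<kappa> < - f s" if "\<kappa> < 1" for \<kappa>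
    using low_gen[OF that, of "-1"] low(2) by simp
qed

theorem theorem3p1:
  fixes M :: "'a measure" and \<eta> :: "nat \<Rightarrow> 'a \<Rightarrow> real" and \<alpha> :: real
  assumes "prob_space M"
    and meas: "\<And>k. \<eta> k \<in> borel_measurable M"
    and indep: "prob_space.indep_vars M (\<lambda>_. borel) \<eta> UNIV"
    and ident: "\<And>k. distr M borel (\<eta> k) = distr M borel (\<eta> 1)"
    and int1: "integrable M (\<eta> 1)"
    and mean0: "integral\<^sup>L M (\<eta> 1) = 0"
    and int2: "integrable M (\<lambda>\<omega>. (\<eta> 1 \<omega>)\<^sup>2)"
    and var_pos: "integral\<^sup>L M (\<lambda>\<omega>. (\<eta> 1 \<omega>)\<^sup>2) > 0"
    and alpha: "\<alpha> > -1/2"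
  shows "AE \<omega> in M.
     (let \<sigma>2 = integral\<^sup>L M (\<lambda>\<omega>. (\<eta> 1 \<omega>)\<^sup>2);
          c = sqrt (\<sigma>2 * Gamma (1 + 2 * \<alpha>) / 2 powr (2 * \<alpha>))
      in Limsup (at_right 0)
           (\<lambda>s. ereal (sqrt (s powr (1 + 2 * \<alpha>) / ln (ln (1 / s))) * rand_series \<alpha> \<eta> s \<omega>))
           = ereal c
       \<and> Liminf (at_right 0)
           (\<lambda>s. ereal (sqrt (s powr (1 + 2 * \<alpha>) / ln (ln (1 / s))) * rand_series \<alpha> \<eta> s \<omega>))
           = ereal (- c)
       \<and> limit_points_at_right0
           (\<lambda>s. sqrt (2 powr (2 * \<alpha>) / (\<sigma>2 * Gamma (1 + 2 * \<alpha>))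
                      * (s powr (1 + 2 * \<alpha>) / ln (ln (1 / s)))) * rand_series \<alpha> \<eta> s \<omega>)
           = {-1..1})"
proof -
  interpret prob_space M by fact
  interpret iid_square_integrable M \<eta>
    by unfold_locales (use assms in auto)
  interpret T: truncated_sequence M \<xi> \<sigma>2 "2 * \<sigma>2" by (rule truncated_sequence_xi)
  interpret N: truncated_sequence M "\<lambda>k \<omega>. - \<xi> k \<omega>" \<sigma>2 "2 * \<sigma>2" by (rule truncated_sequence_neg_xi)
  define c where "c = sqrt (\<sigma>2 * Gamma (1 + 2 * \<alpha>) / 2 powr (2 * \<alpha>))"
  have cT: "T.lil_const \<alpha> = c" by (simp only: T.lil_const_def c_def)
  have c: "c > 0" using T.lil_const_pos[OF alpha] by (simp only: cT)
  have jlt: "c * (1 - 1 / real (Suc j)) < c" "c < c * (1 + 1 / real (Suc j))" for j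
    using c by (simp_all add: field_simps)
  \<comment> \<open>Constants c (1 + 1/(j+1)) and c (1 - 1/(j+1)) approach c through a countable
    family, so one null set serves all of them.\<close>
  have up: "AE \<omega> in M. \<forall>j::nat. \<forall>\<^sub>F s in at_right 0. \<bar>\<Sum>k. dweight \<alpha> s k * \<xi> k \<omega>\<bar> < c * (1 + 1 / real (Suc j)) * lil_scale \<alpha> s"
    unfolding AE_all_countable using T.AE_upper[OF alpha, unfolded cT] jlt(2) by blast
  have lo1: "AE \<omega> in M. \<forall>j::nat. \<exists>\<^sub>F s in at_right 0. c * (1 - 1 / real (Suc j)) * lil_scale \<alpha> s < (\<Sum>k. dweight \<alpha> s k * \<xi> k \<omega>)"
    unfolding AE_all_countable using T.AE_lower[OF alpha, unfolded cT] jlt(1) by blast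
  have lo2: "AE \<omega> in M. \<forall>j::nat. \<exists>\<^sub>F s in at_right 0. c * (1 - 1 / real (Suc j)) * lil_scale \<alpha> s < (\<Sum>k. dweight \<alpha> s k * (- \<xi> k \<omega>))"
    unfolding AE_all_countable using N.AE_lower[OF alpha, unfolded cT] jlt(1) by blast
  from AE_eventually_truncate_eq T.AE_partial_sums[OF alpha] up lo1 lo2
  have "AE \<omega> in M. Limsup (at_right 0)
           (\<lambda>s. ereal (sqrt (s powr (1 + 2 * \<alpha>) / ln (ln (1 / s))) * rand_series \<alpha> \<eta> s \<omega>)) = ereal c
       \<and> Liminf (at_right 0)
           (\<lambda>s. ereal (sqrt (s powr (1 + 2 * \<alpha>) / ln (ln (1 / s))) * rand_series \<alpha> \<eta> s \<omega>)) = ereal (- c)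
       \<and> limit_points_at_right0
           (\<lambda>s. sqrt (2 powr (2 * \<alpha>) / (\<sigma>2 * Gamma (1 + 2 * \<alpha>))
                      * (s powr (1 + 2 * \<alpha>) / ln (ln (1 / s)))) * rand_series \<alpha> \<eta> s \<omega>) = {-1..1}"
  proof eventually_elim
    case (elim \<omega>)
    define f where "f s = rand_series \<alpha> \<eta> s \<omega> / (c * lil_scale \<alpha> s)" for s
    have "summable (\<lambda>k. dweight \<alpha> s k * \<xi> k \<omega>)" if "s > 0" for s
      by (rule dirichlet_weighted_series(1)[OF _ that]) (use elim in blast)
    then have neg: "(\<Sum>k. dweight \<alpha> s k * (- \<xi> k \<omega>)) = - (\<Sum>k. dweight \<alpha> s k * \<xi> k \<omega>)" if "s > 0" for s
      using suminf_minus[of "\<lambda>k. dweight \<alpha> s k * \<xi> k \<omega>"] that by simp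
    have lo2': "\<exists>\<^sub>F s in at_right 0. c * (1 - 1 / real (Suc j)) * lil_scale \<alpha> s < - (\<Sum>k. dweight \<alpha> s k * \<xi> k \<omega>)" for j :: nat
      using frequently_eventually_frequently[OF elim(5)[rule_format, of j] eventually_at_right_less[of 0]]
      by (rule frequently_elim1) (elim conjE, simp only: neg)
    note osc = rand_series_oscillation_transfer[where \<eta> = \<eta> and \<omega> = \<omega> and y = "\<lambda>k. \<xi> k \<omega>", OF alpha c elim(1) elim(2)[rule_format] elim(3)[rule_format]
        elim(4)[rule_format] lo2', folded f_def]
    \<comment> \<open>Valid for every s, including those with
      \<open>ln (ln (1 / s)) \<le> 0\<close>: \<open>sqrt\<close> commutes with division on all
      reals, and division by 0 yields 0.\<close>
    have n1: "sqrt (s powr (1 + 2 * \<alpha>) / ln (ln (1 / s))) * rand_series \<alpha> \<eta> s \<omega> = c * f s" for s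
      using c by (simp add: f_def lil_scale_def real_sqrt_divide)
    have n2: "sqrt (2 powr (2 * \<alpha>) / (\<sigma>2 * Gamma (1 + 2 * \<alpha>)) * (s powr (1 + 2 * \<alpha>) / ln (ln (1 / s)))) * rand_series \<alpha> \<eta> s \<omega> = f s" for s
    proof -
      have "sqrt (2 powr (2 * \<alpha>) / (\<sigma>2 * Gamma (1 + 2 * \<alpha>))) = 1 / c"
        by (simp add: c_def real_sqrt_divide)
      then show ?thesis using n1[of s] c unfolding real_sqrt_mult by simp
    qed
    have "Limsup (at_right 0) (\<lambda>s. ereal (c * f s)) = ereal c"
    proof (rule Limsup_eq_of_oscillation)
      fix x assume "x > c"
      then have "x / c > 1" using c by simp
      from osc(2)[OF this] show "\<forall>\<^sub>F s in at_right 0. c * f s < x"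
        by eventually_elim (use c in \<open>auto simp: field_simps abs_less_iff\<close>)
    next
      fix x assume "x < c"
      then have "x / c < 1" using c by simp
      from osc(3)[OF this] show "\<exists>\<^sub>F s in at_right 0. x < c * f s"
        by (rule frequently_elim1) (use c in \<open>simp add: field_simps\<close>)
    qed
    moreover have "Limsup (at_right 0) (\<lambda>s. ereal (- (c * f s))) = ereal c"
    proof (rule Limsup_eq_of_oscillation)
      fix x assume "x > c"
      then have "x / c > 1" using c by simp
      from osc(2)[OF this] show "\<forall>\<^sub>F s in at_right 0. - (c * f s) < x"
        by eventually_elim (use c in \<open>auto simp: field_simps abs_less_iff\<close>)
    next
      fix x assume "x < c"
      then have "x / c < 1" using c by simp
      from osc(4)[OF this] show "\<exists>\<^sub>F s in at_right 0. x < - (c * f s)"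
        by (rule frequently_elim1) (use c in \<open>simp add: field_simps\<close>)
    qed
    then have "- Liminf (at_right 0) (\<lambda>s. ereal (c * f s)) = ereal c"
      using ereal_Limsup_uminus[of "at_right 0" "\<lambda>s. ereal (c * f s)"] by simp
    then have "- (- Liminf (at_right 0) (\<lambda>s. ereal (c * f s))) = - ereal c" by (simp only:)
    then have "Liminf (at_right 0) (\<lambda>s. ereal (c * f s)) = ereal (- c)" by simp
    moreover have "limit_points_at_right0 f = {-1..1}"
      by (rule limit_points_of_oscillation[OF osc(1)]) (use osc in auto)
    ultimately show ?case unfolding n1 n2 by simp
  qed
  then show ?thesis by (simp only: Let_def c_def)
qed

end
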